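(* The following hold. (1) As a right $H_{\mathbf 1}$-module, $Q_{\mathbf 1}$ is free. More precisely, the subset $\{h^{\mathbf m}\otimes v_{\mathbf 1}\mid \mathbf m\in\mathbb Z_+^2\}$ is a basis of $Q_{\mathbf 1}$ as an $H_{\mathbf 1}$-module. (2) The functors $M\mapsto\mathrm{Wh}_{\mathbf 1}(M)$ and $V\mapsto Q_{\mathbf 1}\otimes_{H_{\mathbf 1}}V$ are inverse equivalences between $\Omega^{\bar S_2}_{\mathbf 1}$ and $H_{\mathbf 1}\text{-fmod}$.
   Context: $\bar S_2$ is the complex Lie algebra of polynomial vector fields $p_1\partial_1+p_2\partial_2$, $p_i\in\mathbb C[t_1,t_2]$, $\partial_i=\partial/\partial t_i$, with constant divergence $\partial_1(p_1)+\partial_2(p_2)\in\mathbb C$. $d_i=t_i\partial_i$, and $h^{\mathbf m}=d_1^{m_1}d_2^{m_2}\in U(\bar S_2)$ for $\mathbf m=(m_1,m_2)\in\mathbb Z_+^2$ ($\mathbb Z_+$ the nonnegative integers). Let $\Delta_2=\mathrm{span}\{\partial_1,\partial_2\}$. $\Omega^{\bar S_2}_{\mathbf 1}$ is the category of $\bar S_2$-modules $M$ on which $\Delta_2$ acts locally finitely, such that for every $v\in M$ and $x\in\Delta_2$ one has $(x-\phi_{\mathbf 1}(x))^kv=0$ for some $k\in\mathbb N$, where $\phi_{\mathbf 1}:\Delta_2\to\mathbb C$ is linear with $\phi_{\mathbf 1}(\partial_1)=\phi_{\mathbf 1}(\partial_2)=1$, and such that $\mathrm{Wh}_{\mathbf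 1}(M)=\{v\in M:\partial_1v=\partial_2v=v\}$ is finite-dimensional. $\mathbb C_{\mathbf 1}=\mathbb Cv_{\mathbf 1}$ is the one-dimensional $U(\Delta_2)$-module with $\partial_iv_{\mathbf 1}=v_{\mathbf 1}$, $i=1,2$. $Q_{\mathbf 1}=U(\bar S_2)\otimes_{U(\Delta_2)}\mathbb C_{\mathbf 1}$ is the induced $\bar S_2$-module and $H_{\mathbf 1}=\mathrm{End}_{\bar S_2}(Q_{\mathbf 1})^{\mathrm{op}}$, so that $Q_{\mathbf 1}$ is a left $U(\bar S_2)$-module and a right $H_{\mathbf 1}$-module. $H_{\mathbf 1}$-fmod is the category of finite-dimensional (left) $H_{\mathbf 1}$-modules. $\mathrm{Wh}_{\mathbf 1}(M)$ is a left $H_{\mathbf 1}$-module via the identification $\mathrm{Wh}_{\mathbf 1}(M)\cong\mathrm{Hom}_{\bar S_2}(Q_{\mathbf 1},M)$, $\theta\mapsto\theta(1\otimes v_{\mathbf 1})$. *)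

theory Defs
  imports
    "HOL-Algebra.Free_Abelian_Groups"
    "HOL-Algebra.Generated_Groups"
    "HOL-Algebra.QuotRing"
    "HOL-Algebra.Module"
    "HOL-Algebra.Algebraic_Closure_Type"
    "HOL-Library.Product_Plus"
begin

section \<open>Polynomial vector fields in two variables\<close>

text \<open>The ring \<open>\<complex>[t\<^sub>1,t\<^sub>2]\<close> is represented as \<open>\<complex>[t\<^sub>1][t\<^sub>2]\<close>: the inner variable is \<open>t\<^sub>1\<close>, the outer
  variable is \<open>t\<^sub>2\<close>. The pair \<open>(p\<^sub>1, p\<^sub>2)\<close> stands for the vector field \<open>p\<^sub>1\<partial>\<^sub>1 + p\<^sub>2\<partial>\<^sub>2\<close>; addition of
  pairs is componentwise.\<close>

type_synonym poly2 = "complex poly poly"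
type_synonym vfield = "poly2 \<times> poly2"

definition t1 :: poly2 where "t1 = [:[:0, 1:]:]"
definition t2 :: poly2 where "t2 = [:0, 1:]"
definition const2 :: "complex \<Rightarrow> poly2" where "const2 c = [:[:c:]:]"

definition pd1 :: "poly2 \<Rightarrow> poly2" where "pd1 p = map_poly Polynomial.pderiv p"
definition pd2 :: "poly2 \<Rightarrow> poly2" where "pd2 p = Polynomial.pderiv p"

definition vscale :: "complex \<Rightarrow> vfield \<Rightarrow> vfield" where
  "vscale c x = (const2 c * fst x, const2 c * snd x)"

definition vapply :: "vfield \<Rightarrow> poly2 \<Rightarrow> poly2" where
  "vapply x p = fst x * pd1 p + snd x * pd2 p"

definition vbracket :: "vfield \<Rightarrow> vfield \<Rightarrow> vfield" where
  "vbracket x y =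
     (vapply x (fst y) - vapply y (fst x), vapply x (snd y) - vapply y (snd x))"

definition S2bar :: "vfield set" where
  "S2bar = {x. \<exists>c. pd1 (fst x) + pd2 (snd x) = const2 c}"

definition partial1 :: vfield where "partial1 = (1, 0)"
definition partial2 :: vfield where "partial2 = (0, 1)"
definition d1 :: vfield where "d1 = (t1, 0)"
definition d2 :: vfield where "d2 = (0, t2)"

definition Delta2 :: "vfield set" where
  "Delta2 = {vscale a partial1 + vscale b partial2 | a b. True}"

text \<open>\<open>\<phi>\<^sub>1(a\<partial>\<^sub>1 + b\<partial>\<^sub>2) = a + b\<close>; only the values on \<^const>\<open>Delta2\<close> matter.\<close>

definition phi1 :: "vfield \<Rightarrow> complex" where
  "phi1 x = Polynomial.coeff (Polynomial.coeff (fst x) 0) 0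
          + Polynomial.coeff (Polynomial.coeff (snd x) 0) 0"


section \<open>Modules over noncommutative rings, bases, tensor products\<close>

text \<open>Modules are records of type \<^typ>\<open>('a, 'b) Module.module\<close>, whose fields \<open>mult\<close> and \<open>one\<close> are
  junk (as in the library locale for modules over commutative rings). For a right module, the term
  \<open>r \<odot>\<^bsub>M\<^esub> x\<close> stands for \<open>x\<cdot>r\<close>.\<close>

definition left_module :: "('r, 'c) ring_scheme \<Rightarrow> ('r, 'm, 'd) module_scheme \<Rightarrow> bool" where
  "left_module R M \<longleftrightarrow> ring R \<and> abelian_group M \<and>
     (\<forall>r\<in>carrier R. \<forall>x\<in>carrier M. r \<odot>\<^bsub>M\<^esub> x \<in> carrier M) \<and>
     (\<forall>r\<in>carrier R. \<forall>x\<in>carrier M. \<forall>y\<in>carrier M.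
        r \<odot>\<^bsub>M\<^esub> (x \<oplus>\<^bsub>M\<^esub> y) = r \<odot>\<^bsub>M\<^esub> x \<oplus>\<^bsub>M\<^esub> r \<odot>\<^bsub>M\<^esub> y) \<and>
     (\<forall>r\<in>carrier R. \<forall>s\<in>carrier R. \<forall>x\<in>carrier M.
        (r \<oplus>\<^bsub>R\<^esub> s) \<odot>\<^bsub>M\<^esub> x = r \<odot>\<^bsub>M\<^esub> x \<oplus>\<^bsub>M\<^esub> s \<odot>\<^bsub>M\<^esub> x) \<and>
     (\<forall>r\<in>carrier R. \<forall>s\<in>carrier R. \<forall>x\<in>carrier M.
        (r \<otimes>\<^bsub>R\<^esub> s) \<odot>\<^bsub>M\<^esub> x = r \<odot>\<^bsub>M\<^esub> (s \<odot>\<^bsub>M\<^esub> x)) \<and>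
     (\<forall>x\<in>carrier M. \<one>\<^bsub>R\<^esub> \<odot>\<^bsub>M\<^esub> x = x)"

definition opposite_ring :: "('r, 'c) ring_scheme \<Rightarrow> ('r, 'c) ring_scheme" where
  "opposite_ring R = R\<lparr>monoid.mult := \<lambda>x y. y \<otimes>\<^bsub>R\<^esub> x\<rparr>"

definition right_module :: "('r, 'c) ring_scheme \<Rightarrow> ('r, 'm, 'd) module_scheme \<Rightarrow> bool" where
  "right_module R M \<longleftrightarrow> ring R \<and> left_module (opposite_ring R) M"

definition mod_hom ::
  "('r, 'c) ring_scheme \<Rightarrow> ('r, 'm, 'd) module_scheme \<Rightarrow> ('r, 'n, 'e) module_scheme \<Rightarrow> ('m \<Rightarrow> 'n) set"
where
  "mod_hom R M N = {f \<in> carrier M \<rightarrow>\<^sub>E carrier N.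
     (\<forall>x\<in>carrier M. \<forall>y\<in>carrier M. f (x \<oplus>\<^bsub>M\<^esub> y) = f x \<oplus>\<^bsub>N\<^esub> f y) \<and>
     (\<forall>r\<in>carrier R. \<forall>x\<in>carrier M. f (r \<odot>\<^bsub>M\<^esub> x) = r \<odot>\<^bsub>N\<^esub> f x)}"

text \<open>\<open>B\<close> generates \<open>M\<close> and is linearly independent, for left or right modules.\<close>

definition module_basis ::
  "('r, 'c) ring_scheme \<Rightarrow> ('r, 'm, 'd) module_scheme \<Rightarrow> 'm set \<Rightarrow> bool" where
  "module_basis R M B \<longleftrightarrow> B \<subseteq> carrier M \<and>
     (\<forall>x\<in>carrier M. \<exists>A a. finite A \<and> A \<subseteq> B \<and> a \<in> A \<rightarrow> carrier R \<and>
        x = (\<Oplus>\<^bsub>M\<^esub>b\<in>A. a b \<odot>\<^bsub>M\<^esub> b)) \<and>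
     (\<forall>A a. finite A \<and> A \<subseteq> B \<and> a \<in> A \<rightarrow> carrier R \<and>
        (\<Oplus>\<^bsub>M\<^esub>b\<in>A. a b \<odot>\<^bsub>M\<^esub> b) = \<zero>\<^bsub>M\<^esub> \<longrightarrow> (\<forall>b\<in>A. a b = \<zero>\<^bsub>R\<^esub>))"

definition free_module :: "('r, 'c) ring_scheme \<Rightarrow> ('r, 'm, 'd) module_scheme \<Rightarrow> bool" where
  "free_module R M \<longleftrightarrow> (\<exists>B. module_basis R M B)"

abbreviation complex_field :: "complex ring" where
  "complex_field \<equiv> ring_of_type_algebra"

definition fin_dim :: "(complex, 'm, 'd) module_scheme \<Rightarrow> bool" where
  "fin_dim M \<longleftrightarrow> Module.module complex_field M \<and> (\<exists>B. finite B \<and> module_basis complex_field M B)"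

text \<open>The tensor product \<open>M \<otimes>\<^sub>R N\<close> of a right module \<open>M\<close> and a left module \<open>N\<close>: the quotient of the
  free abelian group on the pairs by the subgroup generated by the bilinear, balanced relations.\<close>

definition tensor_free ::
  "('r, 'm, 'd) module_scheme \<Rightarrow> ('s, 'n, 'e) module_scheme \<Rightarrow> ('m \<times> 'n \<Rightarrow>\<^sub>0 int) monoid" where
  "tensor_free M N = free_Abelian_group (carrier M \<times> carrier N)"

definition tensor_rels ::
  "('r, 'c) ring_scheme \<Rightarrow> ('r, 'm, 'd) module_scheme \<Rightarrow> ('r, 'n, 'e) module_scheme
     \<Rightarrow> ('m \<times> 'n \<Rightarrow>\<^sub>0 int) set" where
  "tensor_rels R M N =
     {frag_of (x \<oplus>\<^bsub>M\<^esub> x', y) - frag_of (x, y) - frag_of (x', y) | x x' y.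
        x \<in> carrier M \<and> x' \<in> carrier M \<and> y \<in> carrier N} \<union>
     {frag_of (x, y \<oplus>\<^bsub>N\<^esub> y') - frag_of (x, y) - frag_of (x, y') | x y y'.
        x \<in> carrier M \<and> y \<in> carrier N \<and> y' \<in> carrier N} \<union>
     {frag_of (r \<odot>\<^bsub>M\<^esub> x, y) - frag_of (x, r \<odot>\<^bsub>N\<^esub> y) | r x y.
        r \<in> carrier R \<and> x \<in> carrier M \<and> y \<in> carrier N}"

definition tensor_kernel ::
  "('r, 'c) ring_scheme \<Rightarrow> ('r, 'm, 'd) module_scheme \<Rightarrow> ('r, 'n, 'e) module_scheme
     \<Rightarrow> ('m \<times> 'n \<Rightarrow>\<^sub>0 int) set" where
  "tensor_kernel R M N = generate (tensor_free M N) (tensor_rels R M N)"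

definition tensor_group ::
  "('r, 'c) ring_scheme \<Rightarrow> ('r, 'm, 'd) module_scheme \<Rightarrow> ('r, 'n, 'e) module_scheme
     \<Rightarrow> ('m \<times> 'n \<Rightarrow>\<^sub>0 int) set monoid" where
  "tensor_group R M N = tensor_free M N Mod tensor_kernel R M N"

definition pure_tensor ::
  "('r, 'c) ring_scheme \<Rightarrow> ('r, 'm, 'd) module_scheme \<Rightarrow> ('r, 'n, 'e) module_scheme
     \<Rightarrow> 'm \<Rightarrow> 'n \<Rightarrow> ('m \<times> 'n \<Rightarrow>\<^sub>0 int) set" where
  "pure_tensor R M N x y = tensor_kernel R M N #>\<^bsub>tensor_free M N\<^esub> frag_of (x, y)"

text \<open>The map \<open>f \<otimes> g : M \<otimes>\<^sub>R N \<rightarrow> M' \<otimes>\<^sub>R N'\<close> for \<open>R\<close>-linear \<open>f\<close> and \<open>g\<close>. All representatives \<open>c\<close> of the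
  class \<open>t\<close> yield the same class, so the union is that class.\<close>

definition tensor_map ::
  "('r, 'c) ring_scheme \<Rightarrow> ('r, 'm, 'd) module_scheme \<Rightarrow> ('r, 'n, 'e) module_scheme
     \<Rightarrow> ('r, 'p, 'f) module_scheme \<Rightarrow> ('r, 'q, 'g) module_scheme
     \<Rightarrow> ('m \<Rightarrow> 'p) \<Rightarrow> ('n \<Rightarrow> 'q) \<Rightarrow> ('m \<times> 'n \<Rightarrow>\<^sub>0 int) set \<Rightarrow> ('p \<times> 'q \<Rightarrow>\<^sub>0 int) set" where
  "tensor_map R M N M' N' f g = (\<lambda>t \<in> carrier (tensor_group R M N).
     \<Union>c\<in>t. tensor_kernel R M' N' #>\<^bsub>tensor_free M' N'\<^esub>
       frag_extend (\<lambda>(x, y). frag_of (f x, g y)) c)"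


section \<open>Modules over a Lie algebra of vector fields\<close>

text \<open>A module over a Lie algebra is a complex vector space (a library module over \<open>\<complex>\<close>) with an
  action of the Lie algebra.\<close>

record 'm lie_module = "(complex, 'm) Module.module" +
  act :: "vfield \<Rightarrow> 'm \<Rightarrow> 'm"

definition is_lie_module :: "vfield set \<Rightarrow> 'm lie_module \<Rightarrow> bool" where
  "is_lie_module L M \<longleftrightarrow> Module.module complex_field M \<and>
     (\<forall>x\<in>L. \<forall>v\<in>carrier M. act M x v \<in> carrier M) \<and>
     (\<forall>x\<in>L. \<forall>v\<in>carrier M. \<forall>w\<in>carrier M.
        act M x (v \<oplus>\<^bsub>M\<^esub> w) = act M x v \<oplus>\<^bsub>M\<^esub> act M x w) \<and>
     (\<forall>x\<in>L. \<forall>v\<in>carrier M. \<forall>c. act M x (c \<odot>\<^bsub>M\<^esub> v) = c \<odot>\<^bsub>M\<^esub> act M x v) \<and>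
     (\<forall>x\<in>L. \<forall>y\<in>L. \<forall>v\<in>carrier M. act M (x + y) v = act M x v \<oplus>\<^bsub>M\<^esub> act M y v) \<and>
     (\<forall>x\<in>L. \<forall>v\<in>carrier M. \<forall>c. act M (vscale c x) v = c \<odot>\<^bsub>M\<^esub> act M x v) \<and>
     (\<forall>x\<in>L. \<forall>y\<in>L. \<forall>v\<in>carrier M.
        act M (vbracket x y) v = act M x (act M y v) \<ominus>\<^bsub>M\<^esub> act M y (act M x v))"

definition lie_hom :: "vfield set \<Rightarrow> 'm lie_module \<Rightarrow> 'n lie_module \<Rightarrow> ('m \<Rightarrow> 'n) set" where
  "lie_hom L M N = {f \<in> mod_hom complex_field M N.
     \<forall>x\<in>L. \<forall>v\<in>carrier M. f (act M x v) = act N x (f v)}"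

definition lie_End :: "vfield set \<Rightarrow> 'm lie_module \<Rightarrow> ('m \<Rightarrow> 'm) ring" where
  "lie_End L M = \<lparr>carrier = lie_hom L M M,
     monoid.mult = (\<lambda>f g. compose (carrier M) f g), one = (\<lambda>v\<in>carrier M. v),
     ring.zero = (\<lambda>v\<in>carrier M. \<zero>\<^bsub>M\<^esub>), add = (\<lambda>f g. \<lambda>v\<in>carrier M. f v \<oplus>\<^bsub>M\<^esub> g v)\<rparr>"

text \<open>The Lie module \<open>M \<otimes>\<^sub>R N\<close> for a Lie module \<open>M\<close> with a commuting right \<open>R\<close>-module structure \<open>Mr\<close>
  on the same carrier: both the Lie algebra and \<open>\<complex>\<close> act on the left factor.\<close>

definition lie_tensor ::
  "('r, 'c) ring_scheme \<Rightarrow> 'm lie_module \<Rightarrow> ('r, 'm, 'd) module_scheme \<Rightarrow> ('r, 'n, 'e) module_scheme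
     \<Rightarrow> ('m \<times> 'n \<Rightarrow>\<^sub>0 int) set lie_module" where
  "lie_tensor R M Mr N =
     \<lparr>carrier = carrier (tensor_group R Mr N), monoid.mult = undefined, one = undefined,
      ring.zero = \<one>\<^bsub>tensor_group R Mr N\<^esub>, add = monoid.mult (tensor_group R Mr N),
      Module.module.smult = (\<lambda>c. tensor_map R Mr N Mr N (\<lambda>x. c \<odot>\<^bsub>M\<^esub> x) (\<lambda>y. y)),
      act = (\<lambda>x. tensor_map R Mr N Mr N (act M x) (\<lambda>y. y))\<rparr>"


section \<open>Universal enveloping algebras\<close>

text \<open>Words form the free monoid, so finitely supported functions from words to \<open>\<complex>\<close> with the
  convolution product form the free associative algebra.\<close>

datatype 'a free_word = Free_Word (letters: "'a list")

instantiation free_word :: (type) monoid_add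
begin
definition "0 = Free_Word []"
definition "u + v = Free_Word (letters u @ letters v)"
instance by standard (auto simp: zero_free_word_def plus_free_word_def)
end

type_synonym free_alg = "vfield free_word \<Rightarrow>\<^sub>0 complex"

definition free_assoc :: "vfield set \<Rightarrow> free_alg ring" where
  "free_assoc L = \<lparr>carrier = {f. Poly_Mapping.keys f \<subseteq> {w. set (letters w) \<subseteq> L}},
     monoid.mult = (*), one = 1, ring.zero = 0, add = (+)\<rparr>"

definition letter :: "vfield \<Rightarrow> free_alg" where
  "letter x = Poly_Mapping.single (Free_Word [x]) 1"

definition free_const :: "complex \<Rightarrow> free_alg" where
  "free_const c = Poly_Mapping.single 0 c"

text \<open>\<open>U(L)\<close> is the free associative algebra on the set \<open>L\<close> modulo the linear relations of \<open>L\<close> (which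
  cut it down to the tensor algebra) and the commutator relations.\<close>

definition env_ideal :: "vfield set \<Rightarrow> free_alg set" where
  "env_ideal L = genideal (free_assoc L)
     ({letter (x + y) - letter x - letter y | x y. x \<in> L \<and> y \<in> L} \<union>
      {letter (vscale c x) - free_const c * letter x | c x. x \<in> L} \<union>
      {letter x * letter y - letter y * letter x - letter (vbracket x y) | x y. x \<in> L \<and> y \<in> L})"

definition env :: "vfield set \<Rightarrow> free_alg set ring" where
  "env L = free_assoc L Quot env_ideal L"

definition env_of :: "vfield set \<Rightarrow> vfield \<Rightarrow> free_alg set" where
  "env_of L x = env_ideal L +>\<^bsub>free_assoc L\<^esub> letter x"

definition env_const :: "vfield set \<Rightarrow> complex \<Rightarrow> free_alg set" where
  "env_const L c = env_ideal L +>\<^bsub>free_assoc L\<^esub> free_const c"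

text \<open>For Lie subalgebras \<open>L \<subseteq> L'\<close>, the induced homomorphism \<open>U(L) \<rightarrow> U(L')\<close> sends the class of \<open>f\<close>
  to the class of \<open>f\<close>; on cosets, this is adding the larger ideal.\<close>

definition env_incl :: "vfield set \<Rightarrow> free_alg set \<Rightarrow> free_alg set" where
  "env_incl L' u = env_ideal L' <+>\<^bsub>free_assoc L'\<^esub> u"

text \<open>The algebra homomorphism \<open>U(L) \<rightarrow> \<complex>\<close> that extends a character \<open>\<phi>\<close> of \<open>L\<close>; all representatives
  of a class have the same value.\<close>

definition free_eval :: "(vfield \<Rightarrow> complex) \<Rightarrow> free_alg \<Rightarrow> complex" where
  "free_eval \<phi> f =
     (\<Sum>w\<in>Poly_Mapping.keys f. Poly_Mapping.lookup f w * prod_list (map \<phi> (letters w)))"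

definition env_character :: "(vfield \<Rightarrow> complex) \<Rightarrow> free_alg set \<Rightarrow> complex" where
  "env_character \<phi> u = the_elem (free_eval \<phi> ` u)"


section \<open>The modules \<open>Q\<^sub>1\<close> and the algebra \<open>H\<^sub>1\<close>\<close>

definition C1 :: "(free_alg set, complex) Module.module" where
  "C1 = \<lparr>carrier = UNIV, monoid.mult = undefined, one = undefined, ring.zero = 0, add = (+),
     Module.module.smult = (\<lambda>u z. env_character phi1 u * z)\<rparr>"

definition v1 :: complex where "v1 = 1"

definition US_lie :: "free_alg set lie_module" where
  "US_lie = \<lparr>carrier = carrier (env S2bar), monoid.mult = undefined, one = undefined,
     ring.zero = \<zero>\<^bsub>env S2bar\<^esub>, add = add (env S2bar),
     Module.module.smult = (\<lambda>c u. env_const S2bar c \<otimes>\<^bsub>env S2bar\<^esub> u),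
     act = (\<lambda>x u. env_of S2bar x \<otimes>\<^bsub>env S2bar\<^esub> u)\<rparr>"

definition US_right :: "(free_alg set, free_alg set) Module.module" where
  "US_right = \<lparr>carrier = carrier (env S2bar), monoid.mult = undefined, one = undefined,
     ring.zero = \<zero>\<^bsub>env S2bar\<^esub>, add = add (env S2bar),
     Module.module.smult = (\<lambda>r u. u \<otimes>\<^bsub>env S2bar\<^esub> env_incl S2bar r)\<rparr>"

type_synonym Qelem = "(free_alg set \<times> complex \<Rightarrow>\<^sub>0 int) set"

definition Q1 :: "Qelem lie_module" where
  "Q1 = lie_tensor (env Delta2) US_lie US_right C1"

definition Q1_tensor :: "free_alg set \<Rightarrow> Qelem" where
  "Q1_tensor u = pure_tensor (env Delta2) US_right C1 u v1"

definition hpow :: "nat \<times> nat \<Rightarrow> free_alg set" where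
  "hpow m = (env_of S2bar d1 [^]\<^bsub>env S2bar\<^esub> fst m) \<otimes>\<^bsub>env S2bar\<^esub>
            (env_of S2bar d2 [^]\<^bsub>env S2bar\<^esub> snd m)"

definition H1 :: "(Qelem \<Rightarrow> Qelem) ring" where
  "H1 = opposite_ring (lie_End S2bar Q1)"

definition Q1_right :: "(Qelem \<Rightarrow> Qelem, Qelem) Module.module" where
  "Q1_right = \<lparr>carrier = carrier Q1, monoid.mult = undefined, one = undefined,
     ring.zero = \<zero>\<^bsub>Q1\<^esub>, add = add Q1, Module.module.smult = (\<lambda>\<theta> q. \<theta> q)\<rparr>"


section \<open>The two categories and the two functors\<close>

text \<open>All categories here are concrete: a morphism is an extensional function on the carrier of its
  domain, and identities and composition are those of functions.\<close>

record ('o, 'x) concrete_category =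
  Ob :: "'o set"
  Und :: "'o \<Rightarrow> 'x set"
  Hom :: "'o \<Rightarrow> 'o \<Rightarrow> ('x \<Rightarrow> 'x) set"

definition is_functor ::
  "('o, 'x) concrete_category \<Rightarrow> ('p, 'y) concrete_category
     \<Rightarrow> ('o \<Rightarrow> 'p) \<Rightarrow> ('o \<Rightarrow> 'o \<Rightarrow> ('x \<Rightarrow> 'x) \<Rightarrow> 'y \<Rightarrow> 'y) \<Rightarrow> bool" where
  "is_functor C D F0 F1 \<longleftrightarrow>
     (\<forall>A\<in>Ob C. F0 A \<in> Ob D) \<and>
     (\<forall>A\<in>Ob C. \<forall>B\<in>Ob C. \<forall>f\<in>Hom C A B. F1 A B f \<in> Hom D (F0 A) (F0 B)) \<and>
     (\<forall>A\<in>Ob C. F1 A A (\<lambda>x\<in>Und C A. x) = (\<lambda>x\<in>Und D (F0 A). x)) \<and>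
     (\<forall>A\<in>Ob C. \<forall>A'\<in>Ob C. \<forall>A''\<in>Ob C. \<forall>f\<in>Hom C A A'. \<forall>g\<in>Hom C A' A''.
        F1 A A'' (compose (Und C A) g f) = compose (Und D (F0 A)) (F1 A' A'' g) (F1 A A' f))"

definition sub_vs :: "'m lie_module \<Rightarrow> 'm set \<Rightarrow> (complex, 'm) Module.module" where
  "sub_vs M W = \<lparr>carrier = W, monoid.mult = undefined, one = undefined,
     ring.zero = \<zero>\<^bsub>M\<^esub>, add = add M, Module.module.smult = Module.module.smult M\<rparr>"

definition locally_finite :: "vfield set \<Rightarrow> 'm lie_module \<Rightarrow> bool" where
  "locally_finite L M \<longleftrightarrow> (\<forall>v\<in>carrier M. \<exists>W. v \<in> W \<and> W \<subseteq> carrier M \<and>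
     fin_dim (sub_vs M W) \<and> (\<forall>x\<in>L. \<forall>w\<in>W. act M x w \<in> W))"

definition Wh :: "'m lie_module \<Rightarrow> 'm set" where
  "Wh M = {v \<in> carrier M. act M partial1 v = v \<and> act M partial2 v = v}"

definition Omega :: "('m lie_module, 'm) concrete_category" where
  "Omega = \<lparr>Ob = {M. is_lie_module S2bar M \<and> locally_finite Delta2 M \<and>
       (\<forall>v\<in>carrier M. \<forall>x\<in>Delta2. \<exists>k::nat.
          ((\<lambda>w. act M x w \<ominus>\<^bsub>M\<^esub> phi1 x \<odot>\<^bsub>M\<^esub> w) ^^ k) v = \<zero>\<^bsub>M\<^esub>) \<and>
       fin_dim (sub_vs M (Wh M))},
     Und = carrier, Hom = lie_hom S2bar\<rparr>"

text \<open>The complex vector space underlying an \<open>H\<^sub>1\<close>-module, via \<open>\<complex> \<rightarrow> H\<^sub>1\<close>.\<close>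

definition H1_const :: "complex \<Rightarrow> Qelem \<Rightarrow> Qelem" where
  "H1_const c = (\<lambda>q\<in>carrier Q1. c \<odot>\<^bsub>Q1\<^esub> q)"

definition H1_vector_space ::
  "(Qelem \<Rightarrow> Qelem, 'v) Module.module \<Rightarrow> (complex, 'v) Module.module" where
  "H1_vector_space V = \<lparr>carrier = carrier V, monoid.mult = undefined, one = undefined,
     ring.zero = \<zero>\<^bsub>V\<^esub>, add = add V, Module.module.smult = (\<lambda>c v. H1_const c \<odot>\<^bsub>V\<^esub> v)\<rparr>"

definition H1_fmod :: "((Qelem \<Rightarrow> Qelem, 'v) Module.module, 'v) concrete_category" where
  "H1_fmod = \<lparr>Ob = {V. left_module H1 V \<and> fin_dim (H1_vector_space V)},
     Und = carrier, Hom = mod_hom H1\<rparr>"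

text \<open>\<open>whittaker_hom M\<close> is the inverse of \<open>Hom(Q\<^sub>1, M) \<rightarrow> Wh(M)\<close>, \<open>\<psi> \<mapsto> \<psi>(1 \<otimes> v\<^sub>1)\<close>. Since \<open>H\<^sub>1\<close> is the
  opposite of the endomorphism ring, \<open>\<theta> \<in> H\<^sub>1\<close> acts on \<open>Hom(Q\<^sub>1, M)\<close> from the left by \<open>\<psi> \<mapsto> \<psi> \<circ> \<theta>\<close>.\<close>

definition whittaker_hom :: "'m lie_module \<Rightarrow> 'm \<Rightarrow> Qelem \<Rightarrow> 'm" where
  "whittaker_hom M =
     the_inv_into (lie_hom S2bar Q1 M) (\<lambda>\<psi>. \<psi> (Q1_tensor \<one>\<^bsub>env S2bar\<^esub>))"

definition Wh_ob :: "'m lie_module \<Rightarrow> (Qelem \<Rightarrow> Qelem, 'm) Module.module" where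
  "Wh_ob M = \<lparr>carrier = Wh M, monoid.mult = undefined, one = undefined,
     ring.zero = \<zero>\<^bsub>M\<^esub>, add = add M,
     Module.module.smult = (\<lambda>\<theta> w.
       compose (carrier Q1) (whittaker_hom M w) \<theta> (Q1_tensor \<one>\<^bsub>env S2bar\<^esub>))\<rparr>"

definition Wh_map :: "'m lie_module \<Rightarrow> 'm lie_module \<Rightarrow> ('m \<Rightarrow> 'm) \<Rightarrow> 'm \<Rightarrow> 'm" where
  "Wh_map M N f = restrict f (Wh M)"

definition QH_ob ::
  "(Qelem \<Rightarrow> Qelem, 'v) Module.module \<Rightarrow> (Qelem \<times> 'v \<Rightarrow>\<^sub>0 int) set lie_module" where
  "QH_ob V = lie_tensor H1 Q1 Q1_right V"

definition QH_map ::
  "(Qelem \<Rightarrow> Qelem, 'v) Module.module \<Rightarrow> (Qelem \<Rightarrow> Qelem, 'v) Module.module \<Rightarrow> ('v \<Rightarrow> 'v)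
     \<Rightarrow> (Qelem \<times> 'v \<Rightarrow>\<^sub>0 int) set \<Rightarrow> (Qelem \<times> 'v \<Rightarrow>\<^sub>0 int) set" where
  "QH_map V W f = tensor_map H1 Q1_right V Q1_right W (\<lambda>q. q) f"

text \<open>The carrier of \<open>Q\<^sub>1 \<otimes> V\<close> has another type than that of \<open>V\<close>. A composite of the two functors
  therefore lands in the same category over another type of elements, and the components of a
  natural isomorphism to the identity are isomorphisms between modules over different types.\<close>

definition lie_iso :: "vfield set \<Rightarrow> 'm lie_module \<Rightarrow> 'n lie_module \<Rightarrow> ('m \<Rightarrow> 'n) set" where
  "lie_iso L M N = {f \<in> lie_hom L M N. \<exists>g\<in>lie_hom L N M.
     compose (carrier M) g f = (\<lambda>x\<in>carrier M. x) \<and> compose (carrier N) f g = (\<lambda>y\<in>carrier N. y)}"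

definition mod_iso ::
  "('r, 'c) ring_scheme \<Rightarrow> ('r, 'm, 'd) module_scheme \<Rightarrow> ('r, 'n, 'e) module_scheme \<Rightarrow> ('m \<Rightarrow> 'n) set"
where
  "mod_iso R M N = {f \<in> mod_hom R M N. \<exists>g\<in>mod_hom R N M.
     compose (carrier M) g f = (\<lambda>x\<in>carrier M. x) \<and> compose (carrier N) f g = (\<lambda>y\<in>carrier N. y)}"

end

theory Submission
  imports Defs
begin

text \<open>
  Put \<open>D\<^sub>i = \<partial>\<^sub>i - 1\<close>. Since \<open>[\<partial>\<^sub>i, d\<^sub>i] = \<partial>\<^sub>i\<close>, one has \<open>D\<^sub>i d\<^sub>i = d\<^sub>i D\<^sub>i + D\<^sub>i + 1\<close>, so the \<open>d\<^sub>i\<close> act like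
  creation operators for the annihilation operators \<open>D\<^sub>i\<close>; the two pairs commute with each other.
  On any module \<open>M\<close> on which \<open>D\<^sub>1\<close> and \<open>D\<^sub>2\<close> are locally nilpotent, this makes every vector a unique
  combination \<open>\<Sum> d\<^sub>1\<^sup>a d\<^sub>2\<^sup>b w\<^sub>a\<^sub>b\<close> with Whittaker vectors \<open>w\<^sub>a\<^sub>b\<close> (lemmas \<open>whittaker_induct\<close> and
  \<open>monomials_independent\<close>): the operator \<open>D\<^sub>1\<^sup>k D\<^sub>2\<^sup>l\<close> maps \<open>d\<^sub>1\<^sup>k d\<^sub>2\<^sup>l w\<close> to \<open>k! l! w\<close> and kills the monomials
  that do not have at least this bidegree. In particular \<open>M\<close> is the direct sum of \<open>Wh M\<close> and
  \<open>d\<^sub>1 M + d\<^sub>2 M\<close>, and the projection to \<open>Wh M\<close> commutes with all homomorphisms (\<open>lie_hom_proj\<close>).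

  The module \<open>Q\<^sub>1\<close> is of this kind: its generator \<open>1 \<otimes> v\<^sub>1\<close> is a Whittaker vector, and local nilpotency
  passes from \<open>q\<close> to \<open>x q\<close> because \<open>ad \<partial>\<^sub>i\<close> is locally nilpotent on polynomial vector fields
  (\<open>nilpotent_at_act\<close>). By Frobenius reciprocity (\<open>Q1_universal\<close>, \<open>lie_hom_Q1_unique\<close>), homomorphisms
  \<open>Q\<^sub>1 \<rightarrow> M\<close> correspond to Whittaker vectors of \<open>M\<close>. Hence the Whittaker vectors of \<open>Q\<^sub>1\<close> are the values
  \<open>\<theta>(1 \<otimes> v\<^sub>1)\<close> for \<open>\<theta>\<close> in \<open>H\<^sub>1\<close>, and \<open>h\<^sup>m \<theta>(1 \<otimes> v\<^sub>1) = \<theta>(h\<^sup>m \<otimes> v\<^sub>1)\<close>; so the decomposition above says exactly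
  that the \<open>h\<^sup>m \<otimes> v\<^sub>1\<close> form a basis of \<open>Q\<^sub>1\<close> over \<open>H\<^sub>1\<close>.

  For an \<open>H\<^sub>1\<close>-module \<open>V\<close>, the operators \<open>D\<^sub>i\<close> are locally nilpotent on \<open>T = Q\<^sub>1 \<otimes> V\<close> as well. The
  decomposition of \<open>Q\<^sub>1\<close> shows \<open>T = \<eta>(V) + d\<^sub>1 T + d\<^sub>2 T\<close> for \<open>\<eta>(v) = (1 \<otimes> v\<^sub>1) \<otimes> v\<close>, which gives
  \<open>Wh T = \<eta>(V)\<close>; and \<open>\<eta>\<close> is injective because the coefficient of \<open>q\<close> at \<open>1 \<otimes> v\<^sub>1\<close> is a right
  \<open>H\<^sub>1\<close>-linear function of \<open>q\<close>. So \<open>\<eta>\<close> is an isomorphism from \<open>V\<close> to \<open>Wh (Q\<^sub>1 \<otimes> V)\<close>. Conversely, the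
  evaluation \<open>Q\<^sub>1 \<otimes> Wh M \<rightarrow> M\<close> is surjective because \<open>M\<close> is spanned by monomials applied to Whittaker
  vectors. It is injective because it is so on the Whittaker vectors \<open>\<eta>(w)\<close>, which it maps to \<open>w\<close>: a
  nonzero kernel would be stable under \<open>D\<^sub>1\<close> and \<open>D\<^sub>2\<close> and hence contain a nonzero Whittaker vector
  (\<open>lie_hom_injective_of_Wh\<close>).

  Finally, local nilpotency of \<open>D\<^sub>1\<close> and \<open>D\<^sub>2\<close> yields all conditions on \<open>\<Delta>\<^sub>2\<close> in the definition of the
  category (\<open>Omega_iff\<close>): the vectors \<open>D\<^sub>1\<^sup>a D\<^sub>2\<^sup>b v\<close> span a finite-dimensional stable subspace, and
  \<open>x - \<phi>\<^sub>1(x)\<close> is a linear combination of the commuting operators \<open>D\<^sub>1\<close> and \<open>D\<^sub>2\<close>.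
\<close>

section \<open>Complex vector spaces of finite dimension\<close>

lemma complex_field_simps [simp]:
  "carrier complex_field = UNIV" "a \<oplus>\<^bsub>complex_field\<^esub> b = a + b"
  "a \<otimes>\<^bsub>complex_field\<^esub> b = a * b" "\<zero>\<^bsub>complex_field\<^esub> = 0" "\<one>\<^bsub>complex_field\<^esub> = 1"
  by (simp_all add: ring_of_type_algebra_def)

locale complex_space = module complex_field K for K (structure)
begin

lemma scale_closed [simp, intro]: "x \<in> carrier K \<Longrightarrow> c \<odot> x \<in> carrier K"
  by (rule smult_closed) simp_all

lemma scale_add_left: "x \<in> carrier K \<Longrightarrow> (a + b) \<odot> x = a \<odot> x \<oplus> b \<odot> x"
  using smult_l_distr[of a b x] by simp

lemma scale_add_right: "x \<in> carrier K \<Longrightarrow> y \<in> carrier K \<Longrightarrow> a \<odot> (x \<oplus> y) = a \<odot> x \<oplus> a \<odot> y"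
  using smult_r_distr[of a x y] by simp

lemma scale_scale: "x \<in> carrier K \<Longrightarrow> a \<odot> (b \<odot> x) = (a * b) \<odot> x"
  using smult_assoc1[of a b x] by simp

lemma scale_one [simp]: "x \<in> carrier K \<Longrightarrow> 1 \<odot> x = x"
  using smult_one[of x] by simp

lemma scale_zero_left [simp]: "x \<in> carrier K \<Longrightarrow> 0 \<odot> x = \<zero>"
  using smult_l_null[of x] by simp

lemma scale_zero_right [simp]: "a \<odot> \<zero> = \<zero>"
  using smult_r_null[of a] by simp

lemma minus_one_scale: "x \<in> carrier K \<Longrightarrow> (-1) \<odot> x = \<ominus> x"
proof -
  assume x: "x \<in> carrier K"
  have "(-1) \<odot> x \<oplus> x = (-1 + 1) \<odot> x"
    unfolding scale_add_left[OF x] using x by simp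
  then have "(-1) \<odot> x \<oplus> x = \<zero>"
    using x by simp
  then show ?thesis
    using x by (metis M.minus_equality scale_closed)
qed

lemma minus_scale: "x \<in> carrier K \<Longrightarrow> y \<in> carrier K \<Longrightarrow> x \<ominus> y = x \<oplus> (-1) \<odot> y"
  by (simp add: M.minus_eq minus_one_scale)

lemma scale_eq_zero_iff: "x \<in> carrier K \<Longrightarrow> c \<odot> x = \<zero> \<longleftrightarrow> c = 0 \<or> x = \<zero>"
proof -
  assume x: "x \<in> carrier K"
  have "x = \<zero>" if "c \<odot> x = \<zero>" "c \<noteq> 0"
    using scale_scale[OF x, of "1 / c" c] that x by simp
  then show ?thesis using x by auto
qed

lemma add_minus_cancel: "x \<in> carrier K \<Longrightarrow> y \<in> carrier K \<Longrightarrow> (x \<oplus> y) \<ominus> y = x"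
  by (simp add: M.minus_eq M.a_assoc M.r_neg)

lemma minus_add_cancel': "x \<in> carrier K \<Longrightarrow> y \<in> carrier K \<Longrightarrow> (x \<ominus> y) \<oplus> y = x"
  by (simp add: M.minus_eq M.a_assoc M.l_neg)

lemma minus_eq_zero_iff: "x \<in> carrier K \<Longrightarrow> y \<in> carrier K \<Longrightarrow> x \<ominus> y = \<zero> \<longleftrightarrow> x = y"
  by (metis M.minus_closed minus_add_cancel' M.l_zero M.minus_eq M.r_neg)

end

text \<open>Negatives exist because \<open>(-1) x + x = 0 x\<close>.\<close>

lemma complex_spaceI:
  fixes K (structure)
  assumes "\<And>x y. x \<in> carrier K \<Longrightarrow> y \<in> carrier K \<Longrightarrow> x \<oplus> y \<in> carrier K" "\<zero> \<in> carrier K"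
    and "\<And>c x. x \<in> carrier K \<Longrightarrow> c \<odot> x \<in> carrier K"
    and "\<And>x y z. x \<in> carrier K \<Longrightarrow> y \<in> carrier K \<Longrightarrow> z \<in> carrier K \<Longrightarrow> (x \<oplus> y) \<oplus> z = x \<oplus> (y \<oplus> z)"
    and "\<And>x y. x \<in> carrier K \<Longrightarrow> y \<in> carrier K \<Longrightarrow> x \<oplus> y = y \<oplus> x"
    and "\<And>x. x \<in> carrier K \<Longrightarrow> \<zero> \<oplus> x = x" "\<And>x. x \<in> carrier K \<Longrightarrow> 0 \<odot> x = \<zero>"
    and "\<And>a b x. x \<in> carrier K \<Longrightarrow> (a + b) \<odot> x = a \<odot> x \<oplus> b \<odot> x"
    and "\<And>a x y. x \<in> carrier K \<Longrightarrow> y \<in> carrier K \<Longrightarrow> a \<odot> (x \<oplus> y) = a \<odot> x \<oplus> a \<odot> y"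
    and "\<And>a b x. x \<in> carrier K \<Longrightarrow> (a * b) \<odot> x = a \<odot> (b \<odot> x)"
    and "\<And>x. x \<in> carrier K \<Longrightarrow> 1 \<odot> x = x"
  shows "complex_space K"
  unfolding complex_space_def
proof (rule moduleI)
  show "cring complex_field" by (fact cring_from_type_algebra)
  show "abelian_group K"
  proof (rule abelian_groupI)
    fix x assume x: "x \<in> carrier K"
    have "(-1) \<odot> x \<oplus> 1 \<odot> x = (-1 + 1) \<odot> x"
      by (rule assms(8)[OF x, symmetric])
    then have "(-1) \<odot> x \<oplus> x = \<zero>"
      using assms(7)[OF x] assms(11)[OF x] by (simp only: add.left_inverse)
    then show "\<exists>y\<in>carrier K. y \<oplus> x = \<zero>"
      using assms(3)[OF x] by blast
  next
    show "x \<oplus> y \<in> carrier K" if "x \<in> carrier K" "y \<in> carrier K" for x y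
      using assms(1)[OF that] .
    show "\<zero> \<in> carrier K" using assms(2) .
    show "(x \<oplus> y) \<oplus> z = x \<oplus> (y \<oplus> z)"
      if "x \<in> carrier K" "y \<in> carrier K" "z \<in> carrier K" for x y z
      using assms(4)[OF that] .
    show "x \<oplus> y = y \<oplus> x" if "x \<in> carrier K" "y \<in> carrier K" for x y
      using assms(5)[OF that] .
    show "\<zero> \<oplus> x = x" if "x \<in> carrier K" for x
      using assms(6)[OF that] .
  qed
next
  show "a \<odot> x \<in> carrier K" if "x \<in> carrier K" for a x
    using assms(3)[OF that] .
  show "(a \<oplus>\<^bsub>complex_field\<^esub> b) \<odot> x = a \<odot> x \<oplus> b \<odot> x" if "x \<in> carrier K" for a b x
    unfolding complex_field_simps using assms(8)[OF that] .
  show "a \<odot> (x \<oplus> y) = a \<odot> x \<oplus> a \<odot> y" if "x \<in> carrier K" "y \<in> carrier K" for a x y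
    using assms(9)[OF that] .
  show "(a \<otimes>\<^bsub>complex_field\<^esub> b) \<odot> x = a \<odot> (b \<odot> x)" if "x \<in> carrier K" for a b x
    unfolding complex_field_simps using assms(10)[OF that] .
  show "\<one>\<^bsub>complex_field\<^esub> \<odot> x = x" if "x \<in> carrier K" for x
    unfolding complex_field_simps using assms(11)[OF that] .
qed

lemma sub_vs_simps [simp]:
  "carrier (sub_vs M W) = W" "add (sub_vs M W) = add M" "zero (sub_vs M W) = zero M"
  "Module.smult (sub_vs M W) = Module.smult M"
  by (simp_all add: sub_vs_def)

definition subspace :: "(complex, 'm, 'd) module_scheme \<Rightarrow> 'm set \<Rightarrow> bool" where
  "subspace K S \<longleftrightarrow> S \<subseteq> carrier K \<and> \<zero>\<^bsub>K\<^esub> \<in> S \<and> (\<forall>u\<in>S. \<forall>v\<in>S. u \<oplus>\<^bsub>K\<^esub> v \<in> S) \<and>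
     (\<forall>c. \<forall>u\<in>S. c \<odot>\<^bsub>K\<^esub> u \<in> S)"

text \<open>Spanning is expressed by subspaces instead of linear combinations: in this form it passes to images
  and to submodules without any manipulation of finite sums.\<close>

definition spans :: "(complex, 'm, 'd) module_scheme \<Rightarrow> 'm set \<Rightarrow> bool" where
  "spans K A \<longleftrightarrow> A \<subseteq> carrier K \<and> (\<forall>S. subspace K S \<and> A \<subseteq> S \<longrightarrow> carrier K \<subseteq> S)"

lemma subspaceI:
  assumes "S \<subseteq> carrier K" "\<zero>\<^bsub>K\<^esub> \<in> S" "\<And>u v. u \<in> S \<Longrightarrow> v \<in> S \<Longrightarrow> u \<oplus>\<^bsub>K\<^esub> v \<in> S"
    "\<And>c u. u \<in> S \<Longrightarrow> c \<odot>\<^bsub>K\<^esub> u \<in> S"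
  shows "subspace K S"
  using assms by (auto simp: subspace_def)

lemma sub_vs_complex_space:
  assumes "complex_space M" "subspace M W"
  shows "complex_space (sub_vs M W)"
proof -
  interpret complex_space M by fact
  show ?thesis
  proof (rule complex_spaceI)
    show "\<And>x y. x \<in> carrier (sub_vs M W) \<Longrightarrow> y \<in> carrier (sub_vs M W) \<Longrightarrow>
        x \<oplus>\<^bsub>sub_vs M W\<^esub> y = y \<oplus>\<^bsub>sub_vs M W\<^esub> x"
      using assms(2) unfolding subspace_def by (auto intro!: M.a_comm)
  qed (use assms(2) in \<open>auto simp: subspace_def scale_add_left scale_add_right
        scale_scale M.a_assoc subsetD\<close>)
qed

context complex_space
begin

lemma subspace_finsum:
  assumes "subspace K S" "f \<in> A \<rightarrow> S"
  shows "finsum K f A \<in> S"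
  using assms(2)
proof (induction A rule: infinite_finite_induct)
  case (insert a A)
  then have "f a \<in> S" "finsum K f A \<in> S" "f \<in> A \<rightarrow> carrier K" "f a \<in> carrier K"
    using assms(1) by (auto simp: subspace_def)
  then show ?case using insert.hyps assms(1) by (simp add: subspace_def)
qed (use assms(1) in \<open>auto simp: subspace_def\<close>)

lemma subspace_lin_combs:
  assumes "B \<subseteq> carrier K" "finite B"
  shows "subspace K {\<Oplus>b\<in>B. a b \<odot> b | a. True}"
proof (rule subspaceI)
  show "{\<Oplus>b\<in>B. a b \<odot> b |a. True} \<subseteq> carrier K"
    using assms by (auto intro!: M.finsum_closed)
  have "(\<Oplus>b\<in>B. 0 \<odot> b) = \<zero>"
    using assms by (intro M.add.finprod_one_eqI) auto
  then show "\<zero> \<in> {\<Oplus>b\<in>B. a b \<odot> b |a. True}"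
    by (intro CollectI exI[of _ "\<lambda>_. 0"]) simp
next
  fix u v assume "u \<in> {\<Oplus>b\<in>B. a b \<odot> b |a. True}" "v \<in> {\<Oplus>b\<in>B. a b \<odot> b |a. True}"
  then obtain a c where "u = (\<Oplus>b\<in>B. a b \<odot> b)" "v = (\<Oplus>b\<in>B. c b \<odot> b)" by auto
  moreover have "(\<Oplus>b\<in>B. a b \<odot> b) \<oplus> (\<Oplus>b\<in>B. c b \<odot> b) = (\<Oplus>b\<in>B. a b \<odot> b \<oplus> c b \<odot> b)"
    using assms by (intro M.finsum_addf[symmetric]) auto
  moreover have "\<dots> = (\<Oplus>b\<in>B. (a b + c b) \<odot> b)"
    using assms by (intro M.finsum_cong') (auto simp: scale_add_left)
  ultimately show "u \<oplus> v \<in> {\<Oplus>b\<in>B. a b \<odot> b |a. True}"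
    by (intro CollectI exI[of _ "\<lambda>b. a b + c b"]) simp
next
  fix c u assume "u \<in> {\<Oplus>b\<in>B. a b \<odot> b |a. True}"
  then obtain a where "u = (\<Oplus>b\<in>B. a b \<odot> b)" by auto
  moreover have "c \<odot> (\<Oplus>b\<in>B. a b \<odot> b) = (\<Oplus>b\<in>B. c \<odot> (a b \<odot> b))"
    using assms by (intro finsum_smult_ldistr) auto
  moreover have "\<dots> = (\<Oplus>b\<in>B. (c * a b) \<odot> b)"
    using assms by (intro M.finsum_cong') (auto simp: scale_scale)
  ultimately show "c \<odot> u \<in> {\<Oplus>b\<in>B. a b \<odot> b |a. True}"
    by (intro CollectI exI[of _ "\<lambda>b. c * a b"]) simp
qed

lemma mem_lin_combs:
  assumes "B \<subseteq> carrier K" "finite B" "b \<in> B"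
  shows "b = (\<Oplus>x\<in>B. (if b = x then 1 else 0) \<odot> x)"
proof -
  have "(\<Oplus>x\<in>B. (if b = x then 1 else 0) \<odot> x) = (\<Oplus>x\<in>B. if b = x then x else \<zero>)"
    using assms by (intro M.finsum_cong') auto
  also have "\<dots> = b"
    using assms by (intro M.finsum_singleton) auto
  finally show ?thesis by simp
qed

text \<open>A minimal finite spanning set is a basis: a nontrivial linear relation would express one of
  its elements by the others.\<close>

lemma fin_dim_iff_finite_spanning: "fin_dim K \<longleftrightarrow> (\<exists>A. finite A \<and> spans K A)"
proof
  assume "fin_dim K"
  then obtain B where B: "finite B" "module_basis complex_field K B"
    unfolding fin_dim_def by auto
  have "carrier K \<subseteq> S" if S: "subspace K S" "B \<subseteq> S" for S
  proof
    fix x assume "x \<in> carrier K"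
    moreover have "\<forall>x\<in>carrier K. \<exists>A a. finite A \<and> A \<subseteq> B \<and> a \<in> A \<rightarrow> carrier complex_field \<and>
        x = (\<Oplus>b\<in>A. a b \<odot> b)"
      using B(2) unfolding module_basis_def by (elim conjE)
    ultimately obtain A a where "A \<subseteq> B" "x = (\<Oplus>b\<in>A. a b \<odot> b)"
      by meson
    moreover have "(\<lambda>b. a b \<odot> b) \<in> A \<rightarrow> S"
      using S \<open>A \<subseteq> B\<close> by (auto simp: subspace_def)
    ultimately show "x \<in> S"
      using subspace_finsum[OF S(1), of "\<lambda>b. a b \<odot> b" A] by simp
  qed
  moreover have "B \<subseteq> carrier K" using B(2) by (simp add: module_basis_def)
  ultimately have "spans K B" by (simp add: spans_def)
  then show "\<exists>A. finite A \<and> spans K A" using B(1) by blast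
next
  assume "\<exists>A. finite A \<and> spans K A"
  then obtain A0 where A0: "finite A0 \<and> spans K A0" by blast
  obtain A where A: "finite A" "spans K A"
    and min: "\<And>A'. finite A' \<and> spans K A' \<Longrightarrow> card A \<le> card A'"
    using ex_has_least_nat[of "\<lambda>A. finite A \<and> spans K A" A0 card, OF A0] by auto
  have AK: "A \<subseteq> carrier K" using A(2) by (simp add: spans_def)
  have "module_basis complex_field K A"
    unfolding module_basis_def
  proof (intro conjI ballI allI impI)
    fix x assume x: "x \<in> carrier K"
    have "A \<subseteq> {\<Oplus>b\<in>A. a b \<odot> b | a. True}"
    proof
      fix b assume "b \<in> A"
      from mem_lin_combs[OF AK A(1) this] show "b \<in> {\<Oplus>b\<in>A. a b \<odot> b | a. True}"
        by (intro CollectI exI[of _ "\<lambda>x. if b = x then 1 else 0"]) simp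
    qed
    then have "carrier K \<subseteq> {\<Oplus>b\<in>A. a b \<odot> b | a. True}"
      using A(2) subspace_lin_combs[OF AK A(1)] unfolding spans_def by (metis (no_types, lifting))
    then obtain a where "x = (\<Oplus>b\<in>A. a b \<odot> b)"
      using x by (blast dest: subsetD)
    then show "\<exists>A' a. finite A' \<and> A' \<subseteq> A \<and> a \<in> A' \<rightarrow> carrier complex_field \<and> x = (\<Oplus>b\<in>A'. a b \<odot> b)"
      using A(1) by (intro exI[of _ A] exI[of _ a]) simp
  next
    fix A' a b assume asm: "finite A' \<and> A' \<subseteq> A \<and> a \<in> A' \<rightarrow> carrier complex_field \<and>
      (\<Oplus>b\<in>A'. a b \<odot> b) = \<zero>" and b: "b \<in> A'"
    show "a b = \<zero>\<^bsub>complex_field\<^esub>"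
    proof (rule ccontr)
      assume nz: "a b \<noteq> \<zero>\<^bsub>complex_field\<^esub>"
      have "spans K (A - {b})"
        unfolding spans_def
      proof (intro conjI allI impI)
        fix S assume S: "subspace K S \<and> A - {b} \<subseteq> S"
        define r where "r = (\<Oplus>x\<in>A' - {b}. a x \<odot> x)"
        have r: "r \<in> S"
          unfolding r_def using S asm by (intro subspace_finsum) (auto simp: subspace_def)
        have bK: "b \<in> carrier K" "r \<in> carrier K"
          using b asm AK S r by (auto simp: subspace_def)
        have "(\<Oplus>x\<in>insert b (A' - {b}). a x \<odot> x) = a b \<odot> b \<oplus> r"
          unfolding r_def using asm AK b by (intro M.finsum_insert) auto
        then have "a b \<odot> b \<oplus> r = \<zero>"
          using asm b by (simp add: insert_absorb)
        then have "a b \<odot> b = \<ominus> r"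
          using bK by (metis M.minus_equality scale_closed)
        then have "(1 / a b) \<odot> (a b \<odot> b) = (1 / a b) \<odot> ((-1) \<odot> r)"
          using bK by (simp add: minus_one_scale)
        then have "b = (1 / a b * -1) \<odot> r"
          using nz bK(1) unfolding scale_scale[OF bK(1)] scale_scale[OF bK(2)] by simp
        then have "b \<in> S" using r S unfolding subspace_def by metis
        then have "A \<subseteq> S" using S by auto
        then show "carrier K \<subseteq> S"
          using S A(2) unfolding spans_def by simp
      qed (use AK in auto)
      then have "card A \<le> card (A - {b})" using min A(1) by blast
      then show False using asm b A(1) by (metis card_Diff1_less leD subsetD)
    qed
  qed (use AK in auto)
  then show "fin_dim K"
    unfolding fin_dim_def using A(1) module_axioms by blast
qed

end

lemma fin_dim_surjective_image:
  assumes K: "complex_space K" and K': "complex_space K'" and "fin_dim K"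
    and f: "f \<in> carrier K \<rightarrow> carrier K'" "carrier K' \<subseteq> f ` carrier K"
    and add: "\<And>x y. x \<in> carrier K \<Longrightarrow> y \<in> carrier K \<Longrightarrow> f (x \<oplus>\<^bsub>K\<^esub> y) = f x \<oplus>\<^bsub>K'\<^esub> f y"
    and smult: "\<And>c x. x \<in> carrier K \<Longrightarrow> f (c \<odot>\<^bsub>K\<^esub> x) = c \<odot>\<^bsub>K'\<^esub> f x"
  shows "fin_dim K'"
proof -
  interpret K: complex_space K by fact
  interpret K': complex_space K' by fact
  obtain A where A: "finite A" "spans K A"
    using assms(3) K.fin_dim_iff_finite_spanning by auto
  have f0: "f \<zero>\<^bsub>K\<^esub> = \<zero>\<^bsub>K'\<^esub>"
    using smult[of "\<zero>\<^bsub>K\<^esub>" 0] K'.scale_zero_left[of "f \<zero>\<^bsub>K\<^esub>"] funcset_mem[OF f(1)] by simp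
  have "spans K' (f ` A)"
    unfolding spans_def
  proof (intro conjI allI impI)
    show "f ` A \<subseteq> carrier K'" using A(2) f(1) by (auto simp: spans_def)
    fix S assume S: "subspace K' S \<and> f ` A \<subseteq> S"
    have "subspace K {x \<in> carrier K. f x \<in> S}"
      by (rule subspaceI) (use S f0 in \<open>auto simp: add smult subspace_def\<close>)
    then have "carrier K \<subseteq> {x \<in> carrier K. f x \<in> S}"
      using A(2) S unfolding spans_def by blast
    then show "carrier K' \<subseteq> S" using f(2) by blast
  qed
  then show ?thesis
    using A(1) K'.fin_dim_iff_finite_spanning by blast
qed

lemma fin_dim_span_of_finite:
  assumes M: "complex_space M" and A: "finite A" "A \<subseteq> carrier M"
    and W: "W = \<Inter>{S. subspace M S \<and> A \<subseteq> S}"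
  shows "subspace M W" "A \<subseteq> W" "fin_dim (sub_vs M W)"
proof -
  interpret complex_space M by fact
  have "subspace M (carrier M)" by (rule subspaceI) auto
  then show s: "subspace M W"
    using A(2) unfolding W subspace_def by blast
  show "A \<subseteq> W" unfolding W by blast
  interpret W: complex_space "sub_vs M W"
    by (rule sub_vs_complex_space[OF M s])
  have "spans (sub_vs M W) A"
    using s W unfolding spans_def subspace_def by auto
  then show "fin_dim (sub_vs M W)"
    using A(1) W.fin_dim_iff_finite_spanning by blast
qed

section \<open>Polynomial vector fields with constant divergence\<close>

lemma pd1_coeff: "Polynomial.coeff (pd1 p) n = Polynomial.pderiv (Polynomial.coeff p n)"
  by (simp add: pd1_def coeff_map_poly)

lemma pd1_add: "pd1 (p + q) = pd1 p + pd1 q"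
  by (simp add: poly_eq_iff pd1_coeff pderiv_add)

lemma pd1_diff: "pd1 (p - q) = pd1 p - pd1 q"
  by (simp add: poly_eq_iff pd1_coeff pderiv_diff)

lemma pderiv_sum: "Polynomial.pderiv (sum f A) = (\<Sum>i\<in>A. Polynomial.pderiv (f i))"
  by (induction A rule: infinite_finite_induct) (simp_all add: pderiv_add)

lemma pd1_mult: "pd1 (p * q) = pd1 p * q + p * pd1 q"
proof -
  have "Polynomial.pderiv (a * b) = Polynomial.pderiv a * b + a * Polynomial.pderiv b"
    for a b :: "complex poly"
    by (simp add: pderiv_mult mult.commute add.commute)
  then have "Polynomial.coeff (pd1 (p * q)) n = Polynomial.coeff (pd1 p * q + p * pd1 q) n" for n
    by (simp add: pd1_coeff coeff_mult pderiv_sum sum.distrib)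
  then show ?thesis by (rule poly_eqI)
qed

lemma pd2_mult: "pd2 (p * q) = pd2 p * q + p * pd2 q"
  by (simp add: pd2_def pderiv_mult add.commute mult.commute)

lemma pd2_add: "pd2 (p + q) = pd2 p + pd2 q"
  by (simp add: pd2_def pderiv_add)

lemma pd2_diff: "pd2 (p - q) = pd2 p - pd2 q"
  by (simp add: pd2_def pderiv_diff)

lemma pd1_const2 [simp]: "pd1 (const2 c) = 0"
  by (simp add: poly_eq_iff pd1_coeff const2_def coeff_pCons split: nat.split)

lemma pd2_const2 [simp]: "pd2 (const2 c) = 0"
  by (simp add: pd2_def const2_def pderiv_pCons)

lemma const2_simps [simp]: "const2 0 = 0" "const2 1 = 1"
  "const2 a + const2 b = const2 (a + b)" "const2 a * const2 b = const2 (a * b)"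
  by (simp_all add: const2_def one_pCons)

lemma pd_basic [simp]: "pd1 0 = 0" "pd1 1 = 0" "pd2 0 = 0" "pd2 1 = 0"
  "pd1 t1 = 1" "pd1 t2 = 0" "pd2 t1 = 0" "pd2 t2 = 1"
proof -
  show "pd1 t1 = 1" "pd1 t2 = 0"
    by (simp_all add: poly_eq_iff pd1_coeff t1_def t2_def coeff_pCons one_pCons pderiv_pCons
        split: nat.split)
next
  show "pd1 1 = 0"
    using pd1_const2[of 1] by simp
qed (simp_all add: pd1_def pd2_def t1_def t2_def pderiv_pCons)

lemma pd1_pd2: "pd1 (pd2 p) = pd2 (pd1 p)"
  by (rule poly_eqI) (simp add: pd1_coeff pd2_def coeff_pderiv pderiv_mult
      pderiv_of_nat del: of_nat_Suc)

lemma pd1_funpow_coeff: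
  "Polynomial.coeff ((pd1 ^^ n) p) k = (Polynomial.pderiv ^^ n) (Polynomial.coeff p k)"
  by (induction n) (simp_all add: pd1_coeff)

lemma pderiv_funpow_eq_0:
  fixes p :: "'a :: {comm_semiring_1, semiring_no_zero_divisors, semiring_char_0} poly"
  shows "degree p < n \<Longrightarrow> (Polynomial.pderiv ^^ n) p = 0"
proof (induction n arbitrary: p)
  case (Suc n)
  then show ?case
  proof (cases "degree p = 0")
    case True
    then have "Polynomial.pderiv p = 0"
      by (simp add: pderiv_eq_0_iff)
    moreover have "(Polynomial.pderiv ^^ n) (0 :: 'a poly) = 0"
      by (induction n) auto
    ultimately show ?thesis by (simp add: funpow_Suc_right del: funpow.simps)
  next
    case False
    then have "degree (Polynomial.pderiv p) < n"
      using Suc.prems by (simp add: degree_pderiv)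
    then show ?thesis
      using Suc.IH by (simp add: funpow_Suc_right del: funpow.simps)
  qed
qed simp

lemma pd1_nilpotent: "\<exists>n. (pd1 ^^ n) p = 0"
proof -
  define n where "n = Suc (\<Sum>k\<le>degree p. degree (Polynomial.coeff p k))"
  have "degree (Polynomial.coeff p k) < n" for k
  proof (cases "k \<le> degree p")
    case True
    then have "degree (Polynomial.coeff p k) \<le> (\<Sum>k\<le>degree p. degree (Polynomial.coeff p k))"
      by (intro member_le_sum) auto
    then show ?thesis by (simp add: n_def)
  qed (simp add: n_def coeff_eq_0)
  then have "(pd1 ^^ n) p = 0"
    by (intro poly_eqI) (simp add: pd1_funpow_coeff pderiv_funpow_eq_0)
  then show ?thesis ..
qed

lemma pd2_nilpotent: "\<exists>n. (pd2 ^^ n) p = 0"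
  using pderiv_funpow_eq_0[of p "Suc (degree p)"] unfolding pd2_def by (metis lessI)

lemma funpow_eq_0_mono:
  fixes f :: "'a \<Rightarrow> 'a :: zero"
  assumes "(f ^^ n) x = 0" "f 0 = 0" "n \<le> m"
  shows "(f ^^ m) x = 0"
proof -
  have "(f ^^ k) 0 = 0" for k
    using assms(2) by (induction k) auto
  then have "(f ^^ (m - n + n)) x = 0"
    unfolding funpow_add comp_def assms(1) .
  then show ?thesis using assms(3) by simp
qed

lemma S2bar_add: "x \<in> S2bar \<Longrightarrow> y \<in> S2bar \<Longrightarrow> x + y \<in> S2bar"
proof -
  assume "x \<in> S2bar" "y \<in> S2bar"
  then obtain a b where "pd1 (fst x) + pd2 (snd x) = const2 a" "pd1 (fst y) + pd2 (snd y) = const2 b"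
    unfolding S2bar_def by auto
  then have "pd1 (fst (x + y)) + pd2 (snd (x + y)) = const2 (a + b)"
    unfolding const2_simps(3)[symmetric] by (simp add: pd1_add pd2_add algebra_simps)
  then show ?thesis unfolding S2bar_def by blast
qed

lemma S2bar_vscale: "x \<in> S2bar \<Longrightarrow> vscale c x \<in> S2bar"
proof -
  assume "x \<in> S2bar"
  then obtain a where "pd1 (fst x) + pd2 (snd x) = const2 a"
    unfolding S2bar_def by auto
  then have "pd1 (fst (vscale c x)) + pd2 (snd (vscale c x)) = const2 (c * a)"
    unfolding const2_simps(4)[symmetric]
    by (simp add: vscale_def pd1_mult pd2_mult distrib_left[symmetric])
  then show ?thesis unfolding S2bar_def by blast
qed

text \<open>The divergence of \<open>[x, y]\<close> is \<open>x(div y) - y(div x)\<close>, and vector fields kill constants.\<close>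

lemma S2bar_vbracket:
  assumes "x \<in> S2bar" "y \<in> S2bar"
  shows "vbracket x y \<in> S2bar"
proof -
  obtain a b where a: "pd1 (fst x) + pd2 (snd x) = const2 a"
    and b: "pd1 (fst y) + pd2 (snd y) = const2 b"
    using assms unfolding S2bar_def by auto
  have x: "pd2 (snd x) = const2 a - pd1 (fst x)"
    and y: "pd2 (snd y) = const2 b - pd1 (fst y)"
    using a b by (simp_all add: algebra_simps)
  have "pd2 (pd2 (snd x)) = - pd1 (pd2 (fst x))" "pd1 (pd2 (snd x)) = - pd1 (pd1 (fst x))"
    "pd2 (pd2 (snd y)) = - pd1 (pd2 (fst y))" "pd1 (pd2 (snd y)) = - pd1 (pd1 (fst y))"
    by (simp_all add: x y pd1_diff pd2_diff pd1_pd2)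
  then have "pd1 (fst (vbracket x y)) + pd2 (snd (vbracket x y)) = 0"
    by (simp add: vbracket_def vapply_def pd1_diff pd2_diff pd1_add pd2_add pd1_mult pd2_mult
        pd1_pd2[symmetric] x y)
  then have "pd1 (fst (vbracket x y)) + pd2 (snd (vbracket x y)) = const2 0"
    by simp
  then show ?thesis unfolding S2bar_def by blast
qed

lemma vfields_in_S2bar [simp]: "partial1 \<in> S2bar" "partial2 \<in> S2bar" "d1 \<in> S2bar" "d2 \<in> S2bar"
  unfolding S2bar_def partial1_def partial2_def d1_def d2_def
  by (simp_all, (metis const2_simps)+)

lemma Delta2_subset_S2bar: "Delta2 \<subseteq> S2bar"
  unfolding Delta2_def by (auto intro!: S2bar_add S2bar_vscale)

lemma Delta2_pair: "Delta2 = {(const2 a, const2 b) | a b. True}"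
  by (simp add: Delta2_def vscale_def partial1_def partial2_def)

lemma Delta2_closed:
  shows "x \<in> Delta2 \<Longrightarrow> y \<in> Delta2 \<Longrightarrow> x + y \<in> Delta2"
    and "x \<in> Delta2 \<Longrightarrow> vscale c x \<in> Delta2"
    and "x \<in> Delta2 \<Longrightarrow> y \<in> Delta2 \<Longrightarrow> vbracket x y \<in> Delta2"
    and partials_in_Delta2: "partial1 \<in> Delta2" "partial2 \<in> Delta2"
proof -
  show "x \<in> Delta2 \<Longrightarrow> y \<in> Delta2 \<Longrightarrow> vbracket x y \<in> Delta2"
    by (auto simp: Delta2_pair vbracket_def vapply_def intro!: exI[of _ 0])
qed (auto simp: Delta2_pair vscale_def partial1_def partial2_def intro: const2_simps[symmetric],
    (metis const2_simps)+)

lemma vbracket_Delta2: "x \<in> Delta2 \<Longrightarrow> y \<in> Delta2 \<Longrightarrow> vbracket x y = 0"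
  by (auto simp: Delta2_pair vbracket_def vapply_def zero_prod_def)

lemma vbracket_partial1: "vbracket partial1 x = (pd1 (fst x), pd1 (snd x))"
  and vbracket_partial2: "vbracket partial2 x = (pd2 (fst x), pd2 (snd x))"
  by (simp_all add: vbracket_def vapply_def partial1_def partial2_def)

lemma componentwise_nilpotent:
  fixes f :: "poly2 \<Rightarrow> poly2" and g :: "vfield \<Rightarrow> vfield"
  assumes g: "\<And>x. g x = (f (fst x), f (snd x))" and f0: "f 0 = 0" and fn: "\<And>p. \<exists>n. (f ^^ n) p = 0"
  shows "\<exists>n. (g ^^ n) x = 0"
proof -
  obtain k where k: "(f ^^ k) (fst x) = 0" using fn by blast
  obtain l where l: "(f ^^ l) (snd x) = 0" using fn by blast
  have "(f ^^ (k + l)) (fst x) = 0" "(f ^^ (k + l)) (snd x) = 0"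
    using funpow_eq_0_mono[OF k f0, of "k + l"] funpow_eq_0_mono[OF l f0, of "k + l"] by simp_all
  moreover have "(g ^^ n) x = ((f ^^ n) (fst x), (f ^^ n) (snd x))" for n
    by (induction n) (simp_all add: g)
  ultimately have "(g ^^ (k + l)) x = 0"
    by (simp add: zero_prod_def)
  then show ?thesis ..
qed

text \<open>Polynomials are killed by high derivatives; this is what makes \<open>\<partial>\<^sub>i - 1\<close> locally nilpotent on the
  induced module.\<close>

lemma ad_partial_nilpotent:
  assumes "e = partial1 \<or> e = partial2"
  shows "\<exists>n. (vbracket e ^^ n) x = 0"
proof -
  have "\<exists>n. (vbracket partial1 ^^ n) x = 0"
    by (rule componentwise_nilpotent[where f = pd1])
      (simp_all add: vbracket_partial1 pd1_nilpotent)
  moreover have "\<exists>n. (vbracket partial2 ^^ n) x = 0"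
    by (rule componentwise_nilpotent[where f = pd2])
      (simp_all add: vbracket_partial2 pd2_nilpotent)
  ultimately show ?thesis using assms by blast
qed

lemma vbracket_partials_d:
  "vbracket partial1 d1 = partial1" "vbracket partial2 d2 = partial2"
  "vbracket partial1 d2 = 0" "vbracket partial2 d1 = 0"
  "vbracket partial1 partial2 = 0" "vbracket d1 d2 = 0"
  by (simp_all add: vbracket_def vapply_def partial1_def partial2_def d1_def d2_def zero_prod_def)

lemma phi1_Delta2:
  shows phi1_add: "phi1 (x + y) = phi1 x + phi1 y"
    and phi1_vscale: "phi1 (vscale c x) = c * phi1 x"
    and phi1_partials: "phi1 partial1 = 1" "phi1 partial2 = 1" "phi1 0 = 0"
  by (simp_all add: phi1_def vscale_def const2_def partial1_def partial2_def distrib_left)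

section \<open>Tensor products over noncommutative rings\<close>

locale tensor_factors =
  fixes R :: "('r, 'c) ring_scheme" and M :: "('r, 'm, 'd) module_scheme"
    and N :: "('r, 'n, 'e) module_scheme"
  assumes abelian_M: "abelian_group M" and abelian_N: "abelian_group N"
    and smult_M: "\<And>r x. r \<in> carrier R \<Longrightarrow> x \<in> carrier M \<Longrightarrow> r \<odot>\<^bsub>M\<^esub> x \<in> carrier M"
    and smult_N: "\<And>r y. r \<in> carrier R \<Longrightarrow> y \<in> carrier N \<Longrightarrow> r \<odot>\<^bsub>N\<^esub> y \<in> carrier N"
begin

abbreviation "F \<equiv> tensor_free M N"
abbreviation "K \<equiv> tensor_kernel R M N"
abbreviation "T \<equiv> tensor_group R M N"
abbreviation "pure \<equiv> pure_tensor R M N"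

sublocale M: abelian_group M by (rule abelian_M)
sublocale N: abelian_group N by (rule abelian_N)

lemma free_simps [simp]: "x \<otimes>\<^bsub>F\<^esub> y = x + y" "\<one>\<^bsub>F\<^esub> = 0"
  "x \<in> carrier F \<longleftrightarrow> Poly_Mapping.keys x \<subseteq> carrier M \<times> carrier N"
  by (simp_all add: tensor_free_def)

sublocale F: comm_group F
  unfolding tensor_free_def by (rule abelian_free_Abelian_group)

lemma free_minus_closed:
  "x \<in> carrier F \<Longrightarrow> y \<in> carrier F \<Longrightarrow> x - y \<in> carrier F"
  using keys_diff[of x y] by auto

lemma rels_subset: "tensor_rels R M N \<subseteq> carrier F"
  unfolding tensor_rels_def
  by (safe; intro free_minus_closed) (auto simp: smult_M smult_N)

lemma kernel_subgroup: "subgroup K F"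
  unfolding tensor_kernel_def by (rule F.generate_is_subgroup[OF rels_subset])

lemma kernel_normal: "K \<lhd> F"
  using kernel_subgroup by (simp add: F.normal_iff_subgroup)

sublocale T: comm_group T
  unfolding tensor_group_def by (rule F.abelian_FactGroup[OF kernel_subgroup])

lemma carrier_T: "carrier T = (\<lambda>c. K #>\<^bsub>F\<^esub> c) ` carrier F"
  unfolding tensor_group_def by (rule carrier_FactGroup)

lemma coset_mult: "c \<in> carrier F \<Longrightarrow> c' \<in> carrier F \<Longrightarrow>
    (K #>\<^bsub>F\<^esub> c) \<otimes>\<^bsub>T\<^esub> (K #>\<^bsub>F\<^esub> c') = K #>\<^bsub>F\<^esub> (c + c')"
  using normal.rcos_sum[OF kernel_normal, of c c'] by (simp add: tensor_group_def)

lemma coset_eqI: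
  assumes "c \<in> carrier F" "c' \<in> carrier F" "c - c' \<in> K"
  shows "K #>\<^bsub>F\<^esub> c = K #>\<^bsub>F\<^esub> c'"
proof -
  have "c = (c - c') \<otimes>\<^bsub>F\<^esub> c'" by simp
  then have "c \<in> K #>\<^bsub>F\<^esub> c'"
    using assms(3) unfolding r_coset_def by blast
  then show ?thesis
    using F.repr_independence[OF _ assms(2) kernel_subgroup] by simp
qed

lemma rel_in_kernel: "c \<in> tensor_rels R M N \<Longrightarrow> c \<in> K"
  unfolding tensor_kernel_def by (rule generate.incl)

lemma pure_closed [simp, intro]: "x \<in> carrier M \<Longrightarrow> y \<in> carrier N \<Longrightarrow> pure x y \<in> carrier T"
  unfolding pure_tensor_def carrier_T by (intro imageI) simp

lemma pure_add_left:
  assumes "x \<in> carrier M" "x' \<in> carrier M" "y \<in> carrier N"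
  shows "pure (x \<oplus>\<^bsub>M\<^esub> x') y = pure x y \<otimes>\<^bsub>T\<^esub> pure x' y"
proof -
  have *: "frag_of (x, y) \<in> carrier F" "frag_of (x', y) \<in> carrier F"
    "frag_of (x \<oplus>\<^bsub>M\<^esub> x', y) \<in> carrier F" using assms by auto
  have "frag_of (x \<oplus>\<^bsub>M\<^esub> x', y) - (frag_of (x, y) + frag_of (x', y)) \<in> K"
    using assms by (intro rel_in_kernel) (auto simp: tensor_rels_def diff_diff_eq)
  then show ?thesis
    unfolding pure_tensor_def coset_mult[OF *(1,2)]
    using * F.m_closed[OF *(1,2)] by (intro coset_eqI) simp_all
qed

lemma pure_add_right:
  assumes "x \<in> carrier M" "y \<in> carrier N" "y' \<in> carrier N"
  shows "pure x (y \<oplus>\<^bsub>N\<^esub> y') = pure x y \<otimes>\<^bsub>T\<^esub> pure x y'"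
proof -
  have *: "frag_of (x, y) \<in> carrier F" "frag_of (x, y') \<in> carrier F"
    "frag_of (x, y \<oplus>\<^bsub>N\<^esub> y') \<in> carrier F" using assms by auto
  have "frag_of (x, y \<oplus>\<^bsub>N\<^esub> y') - (frag_of (x, y) + frag_of (x, y')) \<in> K"
    using assms by (intro rel_in_kernel) (auto simp: tensor_rels_def diff_diff_eq)
  then show ?thesis
    unfolding pure_tensor_def coset_mult[OF *(1,2)]
    using * F.m_closed[OF *(1,2)] by (intro coset_eqI) simp_all
qed

lemma pure_balanced:
  assumes "r \<in> carrier R" "x \<in> carrier M" "y \<in> carrier N"
  shows "pure (r \<odot>\<^bsub>M\<^esub> x) y = pure x (r \<odot>\<^bsub>N\<^esub> y)"
  unfolding pure_tensor_def
proof (rule coset_eqI)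
  show "frag_of (r \<odot>\<^bsub>M\<^esub> x, y) - frag_of (x, r \<odot>\<^bsub>N\<^esub> y) \<in> K"
    using assms by (intro rel_in_kernel) (auto simp: tensor_rels_def)
qed (use assms smult_M smult_N in auto)

lemma pure_zero_left: "y \<in> carrier N \<Longrightarrow> pure \<zero>\<^bsub>M\<^esub> y = \<one>\<^bsub>T\<^esub>"
  using pure_add_left[of "\<zero>\<^bsub>M\<^esub>" "\<zero>\<^bsub>M\<^esub>" y] pure_closed[of "\<zero>\<^bsub>M\<^esub>" y]
  by (metis M.l_zero M.zero_closed T.r_cancel_one')

lemma pure_neg_left:
  assumes "x \<in> carrier M" "y \<in> carrier N"
  shows "pure (\<ominus>\<^bsub>M\<^esub> x) y = inv\<^bsub>T\<^esub> pure x y"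
  using pure_add_left[of "\<ominus>\<^bsub>M\<^esub> x" x y] pure_zero_left[of y] assms
  by (metis M.a_inv_closed M.l_neg T.inv_equality pure_closed)

lemma coset_minus:
  assumes "c \<in> carrier F"
  shows "K #>\<^bsub>F\<^esub> (- c) = inv\<^bsub>T\<^esub> (K #>\<^bsub>F\<^esub> c)"
proof -
  have "(K #>\<^bsub>F\<^esub> (- c)) \<otimes>\<^bsub>T\<^esub> (K #>\<^bsub>F\<^esub> c) = K #>\<^bsub>F\<^esub> 0"
    using assms by (subst coset_mult) auto
  also have "\<dots> = \<one>\<^bsub>T\<^esub>"
    using F.coset_mult_one[OF subgroup.subset[OF kernel_subgroup]]
    by (simp add: tensor_group_def)
  finally show ?thesis
    using assms by (intro T.inv_equality[symmetric]) (auto simp: carrier_T)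
qed

text \<open>The negative of a pure tensor is a pure tensor, so closure under sums suffices.\<close>

lemma tensor_induct [consumes 1, case_names pure add]:
  assumes "t \<in> carrier T"
    and pure: "\<And>x y. x \<in> carrier M \<Longrightarrow> y \<in> carrier N \<Longrightarrow> P (pure x y)"
    and add: "\<And>s t. s \<in> carrier T \<Longrightarrow> t \<in> carrier T \<Longrightarrow> P s \<Longrightarrow> P t \<Longrightarrow> P (s \<otimes>\<^bsub>T\<^esub> t)"
  shows "P t"
proof -
  have one: "P \<one>\<^bsub>T\<^esub>"
    using pure[of "\<zero>\<^bsub>M\<^esub>" "\<zero>\<^bsub>N\<^esub>"] pure_zero_left[of "\<zero>\<^bsub>N\<^esub>"] by simp
  have "c \<in> carrier F \<and> P (K #>\<^bsub>F\<^esub> c) \<and> P (inv\<^bsub>T\<^esub> (K #>\<^bsub>F\<^esub> c))"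
    if "Poly_Mapping.keys c \<subseteq> carrier M \<times> carrier N" for c
    using that
  proof (induction c rule: frag_induction)
    case zero
    have "K #>\<^bsub>F\<^esub> 0 = \<one>\<^bsub>T\<^esub>"
      using F.coset_mult_one[OF subgroup.subset[OF kernel_subgroup]]
      by (simp add: tensor_group_def)
    then show ?case using one by simp
  next
    case (one z)
    then obtain x y where z: "z = (x, y)" "x \<in> carrier M" "y \<in> carrier N" by auto
    then show ?case
      using pure[OF z(2,3)] pure[of "\<ominus>\<^bsub>M\<^esub> x" y] pure_neg_left[OF z(2,3)]
      by (simp add: pure_tensor_def)
  next
    case (diff a b)
    then have C: "K #>\<^bsub>F\<^esub> a \<in> carrier T" "K #>\<^bsub>F\<^esub> b \<in> carrier T"
      by (auto simp: carrier_T)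
    have "K #>\<^bsub>F\<^esub> (a - b) = (K #>\<^bsub>F\<^esub> a) \<otimes>\<^bsub>T\<^esub> inv\<^bsub>T\<^esub> (K #>\<^bsub>F\<^esub> b)"
      using coset_mult[of a "- b"] diff coset_minus[of b] by simp
    moreover have "inv\<^bsub>T\<^esub> ((K #>\<^bsub>F\<^esub> a) \<otimes>\<^bsub>T\<^esub> inv\<^bsub>T\<^esub> (K #>\<^bsub>F\<^esub> b)) =
        inv\<^bsub>T\<^esub> (K #>\<^bsub>F\<^esub> a) \<otimes>\<^bsub>T\<^esub> (K #>\<^bsub>F\<^esub> b)"
      using C by (simp add: T.inv_mult)
    ultimately show ?case
      using diff C add free_minus_closed[of a b] by auto
  qed
  then show ?thesis using assms(1) by (auto simp: carrier_T)
qed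

text \<open>A homomorphism out of the free group that is balanced on the generators kills the kernel, since
  it kills every relation.\<close>

lemma hom_kills_kernel:
  assumes G: "comm_group G" and h: "h \<in> hom F G"
    and val: "\<And>x y. x \<in> carrier M \<Longrightarrow> y \<in> carrier N \<Longrightarrow> h (frag_of (x, y)) = \<beta> x y"
    and addl: "\<And>x x' y. x \<in> carrier M \<Longrightarrow> x' \<in> carrier M \<Longrightarrow> y \<in> carrier N \<Longrightarrow>
      \<beta> (x \<oplus>\<^bsub>M\<^esub> x') y = \<beta> x y \<otimes>\<^bsub>G\<^esub> \<beta> x' y"
    and addr: "\<And>x y y'. x \<in> carrier M \<Longrightarrow> y \<in> carrier N \<Longrightarrow> y' \<in> carrier N \<Longrightarrow>
      \<beta> x (y \<oplus>\<^bsub>N\<^esub> y') = \<beta> x y \<otimes>\<^bsub>G\<^esub> \<beta> x y'"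
    and bal: "\<And>r x y. r \<in> carrier R \<Longrightarrow> x \<in> carrier M \<Longrightarrow> y \<in> carrier N \<Longrightarrow>
      \<beta> (r \<odot>\<^bsub>M\<^esub> x) y = \<beta> x (r \<odot>\<^bsub>N\<^esub> y)"
    and k: "k \<in> K"
  shows "h k = \<one>\<^bsub>G\<^esub>"
proof -
  interpret G: comm_group G by fact
  interpret h: group_hom F G h
    by (unfold_locales) (fact h)
  have hdiff: "h (a - b) = h a \<otimes>\<^bsub>G\<^esub> inv\<^bsub>G\<^esub> h b" if "a \<in> carrier F" "b \<in> carrier F" for a b
  proof -
    have "h (a - b) \<otimes>\<^bsub>G\<^esub> h b = h a"
      using h.hom_mult[of "a - b" b] that free_minus_closed[OF that] by simp
    then show ?thesis
      using that free_minus_closed[OF that] by (simp add: G.inv_solve_right' G.inv_solve_right)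
  qed
  have fr: "frag_of (x, y) \<in> carrier F" if "x \<in> carrier M" "y \<in> carrier N" for x y
    using that by simp
  have \<beta>: "\<beta> x y \<in> carrier G" if "x \<in> carrier M" "y \<in> carrier N" for x y
    using h.hom_closed[OF fr[OF that]] val[OF that] by simp
  have cancel: "p \<otimes>\<^bsub>G\<^esub> q \<otimes>\<^bsub>G\<^esub> inv\<^bsub>G\<^esub> p \<otimes>\<^bsub>G\<^esub> inv\<^bsub>G\<^esub> q = \<one>\<^bsub>G\<^esub>"
    if "p \<in> carrier G" "q \<in> carrier G" for p q
  proof -
    have "p \<otimes>\<^bsub>G\<^esub> q \<otimes>\<^bsub>G\<^esub> inv\<^bsub>G\<^esub> p = q"
      using that by (metis G.inv_closed G.inv_solve_right' G.m_closed G.m_comm)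
    then show ?thesis using that by simp
  qed
  have "tensor_rels R M N \<subseteq> kernel F G h"
    unfolding tensor_rels_def kernel_def
    by (safe; (intro free_minus_closed)?)
      (simp_all add: hdiff fr free_minus_closed val addl addr bal smult_M smult_N \<beta> G.m_assoc G.inv_mult
        G.m_comm G.m_lcomm del: free_simps(3), simp_all add: G.m_assoc[symmetric] \<beta> cancel)
  then have "K \<subseteq> kernel F G h"
    unfolding tensor_kernel_def by (rule F.generate_subgroup_incl[OF _ h.subgroup_kernel])
  then show ?thesis using k unfolding kernel_def by blast
qed

lemma tensor_universal:
  assumes G: "comm_group G"
    and closed: "\<And>x y. x \<in> carrier M \<Longrightarrow> y \<in> carrier N \<Longrightarrow> \<beta> x y \<in> carrier G"
    and addl: "\<And>x x' y. x \<in> carrier M \<Longrightarrow> x' \<in> carrier M \<Longrightarrow> y \<in> carrier N \<Longrightarrow>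
      \<beta> (x \<oplus>\<^bsub>M\<^esub> x') y = \<beta> x y \<otimes>\<^bsub>G\<^esub> \<beta> x' y"
    and addr: "\<And>x y y'. x \<in> carrier M \<Longrightarrow> y \<in> carrier N \<Longrightarrow> y' \<in> carrier N \<Longrightarrow>
      \<beta> x (y \<oplus>\<^bsub>N\<^esub> y') = \<beta> x y \<otimes>\<^bsub>G\<^esub> \<beta> x y'"
    and bal: "\<And>r x y. r \<in> carrier R \<Longrightarrow> x \<in> carrier M \<Longrightarrow> y \<in> carrier N \<Longrightarrow>
      \<beta> (r \<odot>\<^bsub>M\<^esub> x) y = \<beta> x (r \<odot>\<^bsub>N\<^esub> y)"
  obtains h where "h \<in> hom T G" "\<And>x y. x \<in> carrier M \<Longrightarrow> y \<in> carrier N \<Longrightarrow> h (pure x y) = \<beta> x y"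
proof -
  interpret G: comm_group G by fact
  obtain h where h: "h \<in> hom F G" "\<And>z. z \<in> carrier M \<times> carrier N \<Longrightarrow> h (frag_of z) = (case z of (x, y) \<Rightarrow> \<beta> x y)"
    unfolding tensor_free_def
    by (rule G.free_Abelian_group_universal[of "\<lambda>(x, y). \<beta> x y" "carrier M \<times> carrier N"])
      (use closed in auto)
  interpret h: group_hom F G h
    by (unfold_locales) (fact h(1))
  have "K \<subseteq> kernel F G h"
  proof
    fix k assume k: "k \<in> K"
    have "h k = \<one>\<^bsub>G\<^esub>"
      by (rule hom_kills_kernel[OF G h(1), of \<beta>]) (use h(2) addl addr bal k in auto)
    moreover have "k \<in> carrier F"
      using subgroup.subset[OF kernel_subgroup] k by blast
    ultimately show "k \<in> kernel F G h" by (simp add: kernel_def)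
  qed
  then obtain g where g: "g \<in> hom T G" "\<And>c. c \<in> carrier F \<Longrightarrow> g (K #>\<^bsub>F\<^esub> c) = h c"
    unfolding tensor_group_def using h.FactGroup_universal_kernel[OF kernel_normal] by blast
  show thesis
    by (rule that[OF g(1)]) (simp add: pure_tensor_def g(2) h(2))
qed

end

text \<open>All representatives of a class map to one class: the induced map of the free groups, followed by
  the projection, kills the relations.\<close>

lemma tensor_map_pure_hom:
  assumes "tensor_factors R M N" and "tensor_factors R M' N'"
    and f: "\<And>x. x \<in> carrier M \<Longrightarrow> f x \<in> carrier M'"
      "\<And>x y. x \<in> carrier M \<Longrightarrow> y \<in> carrier M \<Longrightarrow> f (x \<oplus>\<^bsub>M\<^esub> y) = f x \<oplus>\<^bsub>M'\<^esub> f y"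
      "\<And>r x. r \<in> carrier R \<Longrightarrow> x \<in> carrier M \<Longrightarrow> f (r \<odot>\<^bsub>M\<^esub> x) = r \<odot>\<^bsub>M'\<^esub> f x"
    and g: "\<And>x. x \<in> carrier N \<Longrightarrow> g x \<in> carrier N'"
      "\<And>x y. x \<in> carrier N \<Longrightarrow> y \<in> carrier N \<Longrightarrow> g (x \<oplus>\<^bsub>N\<^esub> y) = g x \<oplus>\<^bsub>N'\<^esub> g y"
      "\<And>r x. r \<in> carrier R \<Longrightarrow> x \<in> carrier N \<Longrightarrow> g (r \<odot>\<^bsub>N\<^esub> x) = r \<odot>\<^bsub>N'\<^esub> g x"
  defines "h \<equiv> tensor_map R M N M' N' f g"
  shows "h \<in> hom (tensor_group R M N) (tensor_group R M' N')"
    and "\<And>x y. x \<in> carrier M \<Longrightarrow> y \<in> carrier N \<Longrightarrow>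
      h (pure_tensor R M N x y) = pure_tensor R M' N' (f x) (g y)"
proof -
  interpret t: tensor_factors R M N by fact
  interpret t': tensor_factors R M' N' by fact
  define E where "E = frag_extend (\<lambda>(x, y). frag_of (f x, g y))"
  have Eadd: "E (a + b) = E a + E b" for a b
    by (simp add: E_def frag_extend_add)
  have EF: "E c \<in> carrier t'.F" if "c \<in> carrier t.F" for c
  proof -
    have "Poly_Mapping.keys (frag_of (f (fst z), g (snd z))) \<subseteq> carrier M' \<times> carrier N'"
      if "z \<in> Poly_Mapping.keys c" for z
      using \<open>c \<in> carrier t.F\<close> that f(1) g(1) by auto
    then show ?thesis
      using keys_frag_extend[of "\<lambda>(x, y). frag_of (f x, g y)" c]
      unfolding E_def t'.free_simps case_prod_beta by blast
  qed
  define \<Phi> where "\<Phi> c = t'.K #>\<^bsub>t'.F\<^esub> E c" for c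
  have \<Phi>: "\<Phi> \<in> hom t.F t'.T"
  proof (rule homI)
    show "\<Phi> c \<in> carrier t'.T" if "c \<in> carrier t.F" for c
      unfolding \<Phi>_def t'.carrier_T using EF[OF that] by (rule imageI)
    show "\<Phi> (c \<otimes>\<^bsub>t.F\<^esub> d) = \<Phi> c \<otimes>\<^bsub>t'.T\<^esub> \<Phi> d" if "c \<in> carrier t.F" "d \<in> carrier t.F" for c d
      unfolding \<Phi>_def t'.coset_mult[OF EF[OF that(1)] EF[OF that(2)]] by (simp add: Eadd)
  qed
  have \<Phi>K: "\<Phi> k = \<one>\<^bsub>t'.T\<^esub>" if "k \<in> t.K" for k
    by (rule t.hom_kills_kernel[OF t'.T.comm_group_axioms \<Phi>, of "\<lambda>x y. t'.pure (f x) (g y)"])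
      (use f g that in \<open>auto simp: \<Phi>_def E_def t'.pure_add_left t'.pure_add_right t'.pure_balanced
        pure_tensor_def[of R M' N', symmetric]\<close>)
  have hc: "h (t.K #>\<^bsub>t.F\<^esub> c) = \<Phi> c" if c: "c \<in> carrier t.F" for c
  proof -
    have "\<Phi> d = \<Phi> c" if "d \<in> t.K #>\<^bsub>t.F\<^esub> c" for d
    proof -
      obtain k where k: "k \<in> t.K" "d = k \<otimes>\<^bsub>t.F\<^esub> c"
        using \<open>d \<in> t.K #>\<^bsub>t.F\<^esub> c\<close> unfolding r_coset_def by auto
      then have "k \<in> carrier t.F" using subgroup.subset[OF t.kernel_subgroup] by blast
      then have "\<Phi> d = \<Phi> k \<otimes>\<^bsub>t'.T\<^esub> \<Phi> c"
        unfolding k(2) using c by (intro hom_mult[OF \<Phi>])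
      then show ?thesis
        using \<Phi>K[OF k(1)] hom_in_carrier[OF \<Phi> c] by simp
    qed
    moreover have "c \<in> t.K #>\<^bsub>t.F\<^esub> c"
      using t.F.rcos_self[OF c t.kernel_subgroup] .
    ultimately have "(\<Union>d\<in>t.K #>\<^bsub>t.F\<^esub> c. \<Phi> d) = \<Phi> c" by blast
    moreover have "t.K #>\<^bsub>t.F\<^esub> c \<in> carrier t.T" using c unfolding t.carrier_T by (rule imageI)
    ultimately show ?thesis
      unfolding h_def tensor_map_def \<Phi>_def E_def by simp
  qed
  show "h \<in> hom t.T t'.T"
  proof (rule homI)
    fix x assume "x \<in> carrier t.T"
    then show "h x \<in> carrier t'.T"
      using hc hom_in_carrier[OF \<Phi>] unfolding t.carrier_T by auto
  next
    fix x y assume "x \<in> carrier t.T" "y \<in> carrier t.T"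
    then obtain c d where *: "c \<in> carrier t.F" "d \<in> carrier t.F"
      "x = t.K #>\<^bsub>t.F\<^esub> c" "y = t.K #>\<^bsub>t.F\<^esub> d"
      unfolding t.carrier_T by blast
    have "c + d \<in> carrier t.F" using t.F.m_closed[OF *(1,2)] by simp
    then show "h (x \<otimes>\<^bsub>t.T\<^esub> y) = h x \<otimes>\<^bsub>t'.T\<^esub> h y"
      using hom_mult[OF \<Phi> *(1,2)] hc[OF *(1)] hc[OF *(2)] hc[of "c + d"] t.coset_mult[OF *(1,2)]
      by (simp only: *(3,4) t.free_simps(1))
  qed
  fix x y assume "x \<in> carrier M" "y \<in> carrier N"
  then show "h (t.pure x y) = t'.pure (f x) (g y)"
    using hc[of "frag_of (x, y)"] by (simp add: pure_tensor_def \<Phi>_def E_def)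
qed

section \<open>Lie modules, their endomorphisms and their tensor products\<close>

lemma (in complex_space) add_minus_add:
  assumes "a \<in> carrier K" "b \<in> carrier K" "c \<in> carrier K" "d \<in> carrier K"
  shows "(a \<oplus> b) \<ominus> (c \<oplus> d) = (a \<ominus> c) \<oplus> (b \<ominus> d)"
  using assms by (simp add: M.minus_eq M.minus_add M.a_ac)

locale lie_mod =
  fixes L :: "vfield set" and M :: "'m lie_module" (structure)
  assumes is_lie_module: "is_lie_module L M"
begin

sublocale complex_space M
  using is_lie_module by (simp add: is_lie_module_def complex_space_def)

lemma act_closed [simp, intro]: "x \<in> L \<Longrightarrow> v \<in> carrier M \<Longrightarrow> act M x v \<in> carrier M"
  and act_add: "x \<in> L \<Longrightarrow> v \<in> carrier M \<Longrightarrow> w \<in> carrier M \<Longrightarrow>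
    act M x (v \<oplus> w) = act M x v \<oplus> act M x w"
  and act_scale: "x \<in> L \<Longrightarrow> v \<in> carrier M \<Longrightarrow> act M x (c \<odot> v) = c \<odot> act M x v"
  and act_plus: "x \<in> L \<Longrightarrow> y \<in> L \<Longrightarrow> v \<in> carrier M \<Longrightarrow> act M (x + y) v = act M x v \<oplus> act M y v"
  and act_vscale: "x \<in> L \<Longrightarrow> v \<in> carrier M \<Longrightarrow> act M (vscale c x) v = c \<odot> act M x v"
  and act_vbracket: "x \<in> L \<Longrightarrow> y \<in> L \<Longrightarrow> v \<in> carrier M \<Longrightarrow>
    act M (vbracket x y) v = act M x (act M y v) \<ominus> act M y (act M x v)"
  using is_lie_module unfolding is_lie_module_def by blast+

lemma act_zero: "x \<in> L \<Longrightarrow> act M x \<zero> = \<zero>"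
  using act_scale[of x \<zero> 0] by simp

lemma act_zero_field: "x \<in> L \<Longrightarrow> v \<in> carrier M \<Longrightarrow> act M 0 v = \<zero>"
  using act_vscale[of x v 0] by (simp add: vscale_def zero_prod_def)

lemma act_swap:
  assumes "x \<in> L" "y \<in> L" "v \<in> carrier M"
  shows "act M x (act M y v) = act M (vbracket x y) v \<oplus> act M y (act M x v)"
  unfolding act_vbracket[OF assms] using assms by (simp add: minus_add_cancel')

end

lemma lie_homD:
  assumes "f \<in> lie_hom L M N"
  shows "f \<in> extensional (carrier M)"
    and "v \<in> carrier M \<Longrightarrow> f v \<in> carrier N"
    and "v \<in> carrier M \<Longrightarrow> w \<in> carrier M \<Longrightarrow> f (v \<oplus>\<^bsub>M\<^esub> w) = f v \<oplus>\<^bsub>N\<^esub> f w"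
    and "v \<in> carrier M \<Longrightarrow> f (c \<odot>\<^bsub>M\<^esub> v) = c \<odot>\<^bsub>N\<^esub> f v"
    and "x \<in> L \<Longrightarrow> v \<in> carrier M \<Longrightarrow> f (act M x v) = act N x (f v)"
  using assms unfolding lie_hom_def mod_hom_def PiE_def by auto

lemma lie_homI:
  assumes "f \<in> extensional (carrier M)" "\<And>v. v \<in> carrier M \<Longrightarrow> f v \<in> carrier N"
    and "\<And>v w. v \<in> carrier M \<Longrightarrow> w \<in> carrier M \<Longrightarrow> f (v \<oplus>\<^bsub>M\<^esub> w) = f v \<oplus>\<^bsub>N\<^esub> f w"
    and "\<And>c v. v \<in> carrier M \<Longrightarrow> f (c \<odot>\<^bsub>M\<^esub> v) = c \<odot>\<^bsub>N\<^esub> f v"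
    and "\<And>x v. x \<in> L \<Longrightarrow> v \<in> carrier M \<Longrightarrow> f (act M x v) = act N x (f v)"
  shows "f \<in> lie_hom L M N"
  using assms unfolding lie_hom_def mod_hom_def PiE_def by auto

lemma lie_hom_zero:
  assumes "lie_mod L M" "lie_mod L N" "f \<in> lie_hom L M N"
  shows "f \<zero>\<^bsub>M\<^esub> = \<zero>\<^bsub>N\<^esub>"
proof -
  interpret M: lie_mod L M by fact
  interpret N: lie_mod L N by fact
  have "f (0 \<odot>\<^bsub>M\<^esub> \<zero>\<^bsub>M\<^esub>) = 0 \<odot>\<^bsub>N\<^esub> f \<zero>\<^bsub>M\<^esub>"
    by (rule lie_homD(4)[OF assms(3)]) simp
  then show ?thesis
    using N.scale_zero_left[OF lie_homD(2)[OF assms(3) M.M.zero_closed]] by simp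
qed

lemma lie_hom_compose:
  assumes "f \<in> lie_hom L M N" "g \<in> lie_hom L N P" "is_lie_module L M"
  shows "compose (carrier M) g f \<in> lie_hom L M P"
proof -
  interpret M: lie_mod L M by unfold_locales fact
  show ?thesis
    by (rule lie_homI)
      (simp_all add: compose_def lie_homD[OF assms(1)] lie_homD[OF assms(2)])
qed

lemma lie_iso_of_bij:
  assumes M: "lie_mod L M" and f: "f \<in> lie_hom L M N" and b: "bij_betw f (carrier M) (carrier N)"
  shows "f \<in> lie_iso L M N"
proof -
  interpret M: lie_mod L M by fact
  define g where "g = restrict (inv_into (carrier M) f) (carrier N)"
  have fg: "f (g y) = y" "g y \<in> carrier M" if "y \<in> carrier N" for y
    using that b unfolding g_def bij_betw_def by (auto simp: f_inv_into_f inv_into_into)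
  have gf: "g (f x) = x" if "x \<in> carrier M" for x
    using that b lie_homD(2)[OF f] unfolding g_def bij_betw_def by (simp add: inv_into_f_f)
  have "g \<in> lie_hom L N M"
  proof (rule lie_homI)
    show "g \<in> extensional (carrier N)" by (simp add: g_def)
    show "g y \<in> carrier M" if "y \<in> carrier N" for y by (rule fg(2)[OF that])
    show "g (v \<oplus>\<^bsub>N\<^esub> w) = g v \<oplus>\<^bsub>M\<^esub> g w" if "v \<in> carrier N" "w \<in> carrier N" for v w
      using gf[of "g v \<oplus>\<^bsub>M\<^esub> g w"] lie_homD(3)[OF f, of "g v" "g w"] fg that by simp
    show "g (c \<odot>\<^bsub>N\<^esub> v) = c \<odot>\<^bsub>M\<^esub> g v" if "v \<in> carrier N" for c v
      using gf[of "c \<odot>\<^bsub>M\<^esub> g v"] lie_homD(4)[OF f, of "g v" c] fg that by simp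
    show "g (act N x v) = act M x (g v)" if "x \<in> L" "v \<in> carrier N" for x v
      using gf[of "act M x (g v)"] lie_homD(5)[OF f, of x "g v"] fg that by simp
  qed
  moreover have "compose (carrier M) g f = (\<lambda>x\<in>carrier M. x)"
    by (auto simp: compose_def gf)
  moreover have "compose (carrier N) f g = (\<lambda>y\<in>carrier N. y)"
    by (auto simp: compose_def fg)
  ultimately show ?thesis using f unfolding lie_iso_def by blast
qed

lemma mod_homD:
  assumes "f \<in> mod_hom R M N"
  shows "f \<in> extensional (carrier M)"
    and "v \<in> carrier M \<Longrightarrow> f v \<in> carrier N"
    and "v \<in> carrier M \<Longrightarrow> w \<in> carrier M \<Longrightarrow> f (v \<oplus>\<^bsub>M\<^esub> w) = f v \<oplus>\<^bsub>N\<^esub> f w"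
    and "r \<in> carrier R \<Longrightarrow> v \<in> carrier M \<Longrightarrow> f (r \<odot>\<^bsub>M\<^esub> v) = r \<odot>\<^bsub>N\<^esub> f v"
  using assms unfolding mod_hom_def PiE_def by auto

lemma mod_homI:
  assumes "f \<in> extensional (carrier M)" "\<And>v. v \<in> carrier M \<Longrightarrow> f v \<in> carrier N"
    and "\<And>v w. v \<in> carrier M \<Longrightarrow> w \<in> carrier M \<Longrightarrow> f (v \<oplus>\<^bsub>M\<^esub> w) = f v \<oplus>\<^bsub>N\<^esub> f w"
    and "\<And>r v. r \<in> carrier R \<Longrightarrow> v \<in> carrier M \<Longrightarrow> f (r \<odot>\<^bsub>M\<^esub> v) = r \<odot>\<^bsub>N\<^esub> f v"
  shows "f \<in> mod_hom R M N"
  using assms unfolding mod_hom_def PiE_def by auto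

lemma left_moduleD:
  assumes "left_module R M"
  shows "ring R" "abelian_group M"
    and "r \<in> carrier R \<Longrightarrow> x \<in> carrier M \<Longrightarrow> r \<odot>\<^bsub>M\<^esub> x \<in> carrier M"
    and "r \<in> carrier R \<Longrightarrow> x \<in> carrier M \<Longrightarrow> y \<in> carrier M \<Longrightarrow>
      r \<odot>\<^bsub>M\<^esub> (x \<oplus>\<^bsub>M\<^esub> y) = r \<odot>\<^bsub>M\<^esub> x \<oplus>\<^bsub>M\<^esub> r \<odot>\<^bsub>M\<^esub> y"
    and "r \<in> carrier R \<Longrightarrow> s \<in> carrier R \<Longrightarrow> x \<in> carrier M \<Longrightarrow>
      (r \<oplus>\<^bsub>R\<^esub> s) \<odot>\<^bsub>M\<^esub> x = r \<odot>\<^bsub>M\<^esub> x \<oplus>\<^bsub>M\<^esub> s \<odot>\<^bsub>M\<^esub> x"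
    and "r \<in> carrier R \<Longrightarrow> s \<in> carrier R \<Longrightarrow> x \<in> carrier M \<Longrightarrow>
      (r \<otimes>\<^bsub>R\<^esub> s) \<odot>\<^bsub>M\<^esub> x = r \<odot>\<^bsub>M\<^esub> (s \<odot>\<^bsub>M\<^esub> x)"
    and "x \<in> carrier M \<Longrightarrow> \<one>\<^bsub>R\<^esub> \<odot>\<^bsub>M\<^esub> x = x"
  using assms unfolding left_module_def by blast+

lemma mod_iso_of_bij:
  assumes M: "left_module R M" and f: "f \<in> mod_hom R M N" and b: "bij_betw f (carrier M) (carrier N)"
  shows "f \<in> mod_iso R M N"
proof -
  interpret M: abelian_group M by (rule left_moduleD(2)[OF M])
  define g where "g = restrict (inv_into (carrier M) f) (carrier N)"
  have fg: "f (g y) = y" "g y \<in> carrier M" if "y \<in> carrier N" for y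
    using that b unfolding g_def bij_betw_def by (auto simp: f_inv_into_f inv_into_into)
  have gf: "g (f x) = x" if "x \<in> carrier M" for x
    using that b mod_homD(2)[OF f] unfolding g_def bij_betw_def by (simp add: inv_into_f_f)
  have "g \<in> mod_hom R N M"
  proof (rule mod_homI)
    show "g \<in> extensional (carrier N)" by (simp add: g_def)
    show "g y \<in> carrier M" if "y \<in> carrier N" for y by (rule fg(2)[OF that])
    show "g (v \<oplus>\<^bsub>N\<^esub> w) = g v \<oplus>\<^bsub>M\<^esub> g w" if "v \<in> carrier N" "w \<in> carrier N" for v w
      using gf[of "g v \<oplus>\<^bsub>M\<^esub> g w"] mod_homD(3)[OF f, of "g v" "g w"] fg that by simp
    show "g (r \<odot>\<^bsub>N\<^esub> v) = r \<odot>\<^bsub>M\<^esub> g v" if "r \<in> carrier R" "v \<in> carrier N" for r v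
      using gf[of "r \<odot>\<^bsub>M\<^esub> g v"] mod_homD(4)[OF f, of r "g v"] left_moduleD(3)[OF M, of r "g v"]
        fg that by simp
  qed
  moreover have "compose (carrier M) g f = (\<lambda>x\<in>carrier M. x)"
    by (auto simp: compose_def gf)
  moreover have "compose (carrier N) f g = (\<lambda>y\<in>carrier N. y)"
    by (auto simp: compose_def fg)
  ultimately show ?thesis using f unfolding mod_iso_def by blast
qed

lemma lie_End_simps [simp]:
  "carrier (lie_End L M) = lie_hom L M M"
  "f \<otimes>\<^bsub>lie_End L M\<^esub> g = compose (carrier M) f g"
  "\<one>\<^bsub>lie_End L M\<^esub> = (\<lambda>v\<in>carrier M. v)" "\<zero>\<^bsub>lie_End L M\<^esub> = (\<lambda>v\<in>carrier M. \<zero>\<^bsub>M\<^esub>)"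
  "f \<oplus>\<^bsub>lie_End L M\<^esub> g = (\<lambda>v\<in>carrier M. f v \<oplus>\<^bsub>M\<^esub> g v)"
  by (simp_all add: lie_End_def)

lemma lie_hom_eqI:
  assumes "f \<in> lie_hom L M N" "g \<in> lie_hom L M N" "\<And>v. v \<in> carrier M \<Longrightarrow> f v = g v"
  shows "f = g"
  using assms(3) lie_homD(1)[OF assms(1)] lie_homD(1)[OF assms(2)] by (rule extensionalityI[rotated 2])

context lie_mod
begin

lemma lie_hom_add:
  assumes "f \<in> lie_hom L M M" "g \<in> lie_hom L M M"
  shows "(\<lambda>v\<in>carrier M. f v \<oplus> g v) \<in> lie_hom L M M"
  by (rule lie_homI)
    (simp_all add: lie_homD[OF assms(1)] lie_homD[OF assms(2)] M.a_ac scale_add_right act_add)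

lemma lie_hom_scale:
  assumes "f \<in> lie_hom L M M"
  shows "(\<lambda>v\<in>carrier M. c \<odot> f v) \<in> lie_hom L M M"
  by (rule lie_homI)
    (simp_all add: lie_homD[OF assms] scale_add_right act_scale scale_scale mult.commute)

lemma lie_hom_id: "(\<lambda>v\<in>carrier M. v) \<in> lie_hom L M M"
  by (rule lie_homI) simp_all

lemma lie_hom_0: "(\<lambda>v\<in>carrier M. \<zero>) \<in> lie_hom L M M"
  by (rule lie_homI) (simp_all add: act_zero)

lemma lie_End_ring: "ring (lie_End L M)"
proof (rule ringI)
  note hom = lie_homD(2) lie_homD(3) lie_homD(4)
  show "abelian_group (lie_End L M)"
  proof (rule abelian_groupI)
    fix f g h assume f: "f \<in> carrier (lie_End L M)" and g: "g \<in> carrier (lie_End L M)"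
      and h: "h \<in> carrier (lie_End L M)"
    show "f \<oplus>\<^bsub>lie_End L M\<^esub> g \<oplus>\<^bsub>lie_End L M\<^esub> h = f \<oplus>\<^bsub>lie_End L M\<^esub> (g \<oplus>\<^bsub>lie_End L M\<^esub> h)"
      using f g h by (auto simp: M.a_assoc hom intro!: restrict_ext)
  next
    fix f g assume f: "f \<in> carrier (lie_End L M)" and g: "g \<in> carrier (lie_End L M)"
    show "f \<oplus>\<^bsub>lie_End L M\<^esub> g \<in> carrier (lie_End L M)"
      using f g by (simp add: lie_hom_add)
    show "f \<oplus>\<^bsub>lie_End L M\<^esub> g = g \<oplus>\<^bsub>lie_End L M\<^esub> f"
      using f g by (auto simp: M.a_comm hom intro!: restrict_ext)
  next
    fix f assume f: "f \<in> carrier (lie_End L M)"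
    show "\<zero>\<^bsub>lie_End L M\<^esub> \<oplus>\<^bsub>lie_End L M\<^esub> f = f"
      using f by (intro extensionalityI[of _ "carrier M", OF _ lie_homD(1)]) (auto simp: hom)
    have "(\<lambda>v\<in>carrier M. (-1) \<odot> f v) \<in> carrier (lie_End L M)"
      using f by (simp add: lie_hom_scale)
    moreover have "(\<lambda>v\<in>carrier M. (-1) \<odot> f v) \<oplus>\<^bsub>lie_End L M\<^esub> f = \<zero>\<^bsub>lie_End L M\<^esub>"
      using f by (auto simp: hom minus_one_scale M.l_neg intro!: restrict_ext)
    ultimately show "\<exists>g\<in>carrier (lie_End L M). g \<oplus>\<^bsub>lie_End L M\<^esub> f = \<zero>\<^bsub>lie_End L M\<^esub>"
      by blast
  next
    show "\<zero>\<^bsub>lie_End L M\<^esub> \<in> carrier (lie_End L M)" by (simp add: lie_hom_0)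
  qed
  show "Group.monoid (lie_End L M)"
  proof (rule monoidI)
    fix f g assume f: "f \<in> carrier (lie_End L M)" and g: "g \<in> carrier (lie_End L M)"
    show "f \<otimes>\<^bsub>lie_End L M\<^esub> g \<in> carrier (lie_End L M)"
      using f g lie_hom_compose[OF _ _ is_lie_module] by simp
  next
    show "\<one>\<^bsub>lie_End L M\<^esub> \<in> carrier (lie_End L M)" by (simp add: lie_hom_id)
  next
    fix f g h assume f: "f \<in> carrier (lie_End L M)" and g: "g \<in> carrier (lie_End L M)"
      and h: "h \<in> carrier (lie_End L M)"
    show "f \<otimes>\<^bsub>lie_End L M\<^esub> g \<otimes>\<^bsub>lie_End L M\<^esub> h = f \<otimes>\<^bsub>lie_End L M\<^esub> (g \<otimes>\<^bsub>lie_End L M\<^esub> h)"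
      using f g h by (auto simp: compose_def hom intro!: restrict_ext)
  next
    fix f assume f: "f \<in> carrier (lie_End L M)"
    show "\<one>\<^bsub>lie_End L M\<^esub> \<otimes>\<^bsub>lie_End L M\<^esub> f = f" "f \<otimes>\<^bsub>lie_End L M\<^esub> \<one>\<^bsub>lie_End L M\<^esub> = f"
      using f by (intro extensionalityI[of _ "carrier M", OF _ lie_homD(1)];
          auto simp: compose_def hom)+
  qed
  fix f g h assume f: "f \<in> carrier (lie_End L M)" and g: "g \<in> carrier (lie_End L M)"
    and h: "h \<in> carrier (lie_End L M)"
  show "(f \<oplus>\<^bsub>lie_End L M\<^esub> g) \<otimes>\<^bsub>lie_End L M\<^esub> h = f \<otimes>\<^bsub>lie_End L M\<^esub> h \<oplus>\<^bsub>lie_End L M\<^esub> g \<otimes>\<^bsub>lie_End L M\<^esub> h"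
    "h \<otimes>\<^bsub>lie_End L M\<^esub> (f \<oplus>\<^bsub>lie_End L M\<^esub> g) = h \<otimes>\<^bsub>lie_End L M\<^esub> f \<oplus>\<^bsub>lie_End L M\<^esub> h \<otimes>\<^bsub>lie_End L M\<^esub> g"
    using f g h by (auto simp: compose_def hom intro!: restrict_ext)
qed

end

lemma opposite_ring_simps [simp]:
  "carrier (opposite_ring R) = carrier R" "add (opposite_ring R) = add R"
  "zero (opposite_ring R) = zero R" "one (opposite_ring R) = one R"
  "x \<otimes>\<^bsub>opposite_ring R\<^esub> y = y \<otimes>\<^bsub>R\<^esub> x"
  by (simp_all add: opposite_ring_def)

lemma opposite_ring_ring: "ring R \<Longrightarrow> ring (opposite_ring R)"
proof -
  assume "ring R"
  then interpret ring R .
  show ?thesis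
  proof (rule ringI)
    show "abelian_group (opposite_ring R)"
      by (rule abelian_groupI) (auto simp: a_ac intro: add.l_inv_ex)
    show "Group.monoid (opposite_ring R)"
      by (rule monoidI) (auto simp: m_assoc)
  qed (auto simp: l_distr r_distr)
qed

text \<open>The left and the right structure are two records on one carrier; \<open>same\<close> ties them together.\<close>

locale lie_bimodule = lie_mod L M
  for L and R :: "('r, 'c) ring_scheme" and M :: "'m lie_module"
    and Mr :: "('r, 'm, 'd) module_scheme" +
  assumes same: "carrier Mr = carrier M" "add Mr = add M" "zero Mr = zero M"
    and right_closed: "\<And>r u. r \<in> carrier R \<Longrightarrow> u \<in> carrier M \<Longrightarrow> r \<odot>\<^bsub>Mr\<^esub> u \<in> carrier M"
    and scale_right: "\<And>c r u. r \<in> carrier R \<Longrightarrow> u \<in> carrier M \<Longrightarrow>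
      c \<odot>\<^bsub>M\<^esub> (r \<odot>\<^bsub>Mr\<^esub> u) = r \<odot>\<^bsub>Mr\<^esub> (c \<odot>\<^bsub>M\<^esub> u)"
    and act_right: "\<And>x r u. x \<in> L \<Longrightarrow> r \<in> carrier R \<Longrightarrow> u \<in> carrier M \<Longrightarrow>
      act M x (r \<odot>\<^bsub>Mr\<^esub> u) = r \<odot>\<^bsub>Mr\<^esub> (act M x u)"
begin

lemma abelian_Mr: "abelian_group Mr"
  by (rule abelian_groupI) (auto simp: same M.a_assoc intro: M.a_comm M.add.l_inv_ex)

end

lemma lie_tensor_simps:
  "carrier (lie_tensor R M Mr N) = carrier (tensor_group R Mr N)"
  "zero (lie_tensor R M Mr N) = \<one>\<^bsub>tensor_group R Mr N\<^esub>"
  "add (lie_tensor R M Mr N) = monoid.mult (tensor_group R Mr N)"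
  by (simp_all add: lie_tensor_def)

locale lie_tensor_setup = lie_bimodule L R M Mr
  for L and R :: "('r, 'c) ring_scheme" and M :: "'m lie_module"
    and Mr :: "('r, 'm, 'd) module_scheme" and N :: "('r, 'n, 'e) module_scheme" +
  assumes abelian_N: "abelian_group N"
    and smult_N: "\<And>r y. r \<in> carrier R \<Longrightarrow> y \<in> carrier N \<Longrightarrow> r \<odot>\<^bsub>N\<^esub> y \<in> carrier N"
    and closed: "\<And>x y. x \<in> L \<Longrightarrow> y \<in> L \<Longrightarrow> x + y \<in> L" "\<And>c x. x \<in> L \<Longrightarrow> vscale c x \<in> L"
      "\<And>x y. x \<in> L \<Longrightarrow> y \<in> L \<Longrightarrow> vbracket x y \<in> L"
begin

abbreviation "Q \<equiv> lie_tensor R M Mr N"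
abbreviation tens (infixl \<open>\<^bold>\<otimes>\<close> 72) where "x \<^bold>\<otimes> y \<equiv> pure_tensor R Mr N x y"

sublocale tf: tensor_factors R Mr N
  by (rule tensor_factors.intro) (use abelian_Mr abelian_N right_closed smult_N same in auto)

sublocale Q: abelian_group Q
  by (rule abelian_groupI)
    (simp_all add: lie_tensor_simps tf.T.m_ac tf.T.l_inv_ex)

lemma tens_closed [simp, intro]: "x \<in> carrier M \<Longrightarrow> y \<in> carrier N \<Longrightarrow> x \<^bold>\<otimes> y \<in> carrier Q"
  using tf.pure_closed[of x y] by (simp add: lie_tensor_simps same)

lemma tens_add_left: "x \<in> carrier M \<Longrightarrow> x' \<in> carrier M \<Longrightarrow> y \<in> carrier N \<Longrightarrow>
    (x \<oplus>\<^bsub>M\<^esub> x') \<^bold>\<otimes> y = x \<^bold>\<otimes> y \<oplus>\<^bsub>Q\<^esub> x' \<^bold>\<otimes> y"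
  using tf.pure_add_left[of x x' y] by (simp add: lie_tensor_simps same)

lemma tens_add_right: "x \<in> carrier M \<Longrightarrow> y \<in> carrier N \<Longrightarrow> y' \<in> carrier N \<Longrightarrow>
    x \<^bold>\<otimes> (y \<oplus>\<^bsub>N\<^esub> y') = x \<^bold>\<otimes> y \<oplus>\<^bsub>Q\<^esub> x \<^bold>\<otimes> y'"
  using tf.pure_add_right[of x y y'] by (simp add: lie_tensor_simps same)

lemma tens_balanced: "r \<in> carrier R \<Longrightarrow> x \<in> carrier M \<Longrightarrow> y \<in> carrier N \<Longrightarrow>
    (r \<odot>\<^bsub>Mr\<^esub> x) \<^bold>\<otimes> y = x \<^bold>\<otimes> (r \<odot>\<^bsub>N\<^esub> y)"
  using tf.pure_balanced[of r x y] by (simp add: same)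

lemma Q_induct [consumes 1, case_names tens add]:
  assumes "t \<in> carrier Q"
    and "\<And>x y. x \<in> carrier M \<Longrightarrow> y \<in> carrier N \<Longrightarrow> P (x \<^bold>\<otimes> y)"
    and "\<And>s t. s \<in> carrier Q \<Longrightarrow> t \<in> carrier Q \<Longrightarrow> P s \<Longrightarrow> P t \<Longrightarrow> P (s \<oplus>\<^bsub>Q\<^esub> t)"
  shows "P t"
  using assms tf.tensor_induct[of t P] by (simp add: lie_tensor_simps same)

lemma left_factor_hom:
  assumes "\<And>x. x \<in> carrier M \<Longrightarrow> f x \<in> carrier M"
    and "\<And>x y. x \<in> carrier M \<Longrightarrow> y \<in> carrier M \<Longrightarrow> f (x \<oplus>\<^bsub>M\<^esub> y) = f x \<oplus>\<^bsub>M\<^esub> f y"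
    and "\<And>r x. r \<in> carrier R \<Longrightarrow> x \<in> carrier M \<Longrightarrow> f (r \<odot>\<^bsub>Mr\<^esub> x) = r \<odot>\<^bsub>Mr\<^esub> f x"
  defines "h \<equiv> tensor_map R Mr N Mr N f (\<lambda>y. y)"
  shows "x \<in> carrier M \<Longrightarrow> y \<in> carrier N \<Longrightarrow> h (x \<^bold>\<otimes> y) = f x \<^bold>\<otimes> y"
    and "s \<in> carrier Q \<Longrightarrow> h s \<in> carrier Q"
    and "s \<in> carrier Q \<Longrightarrow> t \<in> carrier Q \<Longrightarrow> h (s \<oplus>\<^bsub>Q\<^esub> t) = h s \<oplus>\<^bsub>Q\<^esub> h t"
proof -
  note * = tensor_map_pure_hom[OF tf.tensor_factors_axioms tf.tensor_factors_axioms,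
      of f "\<lambda>y. y", unfolded same, OF assms(1-3), folded h_def]
  show "x \<in> carrier M \<Longrightarrow> y \<in> carrier N \<Longrightarrow> h (x \<^bold>\<otimes> y) = f x \<^bold>\<otimes> y"
    using *(2) by simp
  have h: "h \<in> hom (tensor_group R Mr N) (tensor_group R Mr N)" using *(1) by simp
  show "s \<in> carrier Q \<Longrightarrow> h s \<in> carrier Q"
    using hom_in_carrier[OF h] by (simp add: lie_tensor_simps)
  show "s \<in> carrier Q \<Longrightarrow> t \<in> carrier Q \<Longrightarrow> h (s \<oplus>\<^bsub>Q\<^esub> t) = h s \<oplus>\<^bsub>Q\<^esub> h t"
    using hom_mult[OF h] by (simp add: lie_tensor_simps)
qed

lemma act_Q: "act Q x = tensor_map R Mr N Mr N (act M x) (\<lambda>y. y)"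
  and scale_Q: "Module.smult Q c = tensor_map R Mr N Mr N (\<lambda>u. c \<odot>\<^bsub>M\<^esub> u) (\<lambda>y. y)"
  by (simp_all add: lie_tensor_def)

lemmas act_tens = left_factor_hom(1)[of "act M x" for x, folded act_Q, OF act_closed act_add act_right]
lemmas act_Q_closed = left_factor_hom(2)[of "act M x" for x, folded act_Q, OF act_closed act_add act_right]
lemmas act_Q_add = left_factor_hom(3)[of "act M x" for x, folded act_Q, OF act_closed act_add act_right]
lemmas scale_tens = left_factor_hom(1)[of "\<lambda>u. c \<odot>\<^bsub>M\<^esub> u" for c, folded scale_Q, OF scale_closed scale_add_right scale_right]
lemmas scale_Q_closed = left_factor_hom(2)[of "\<lambda>u. c \<odot>\<^bsub>M\<^esub> u" for c, folded scale_Q, OF scale_closed scale_add_right scale_right]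
lemmas scale_Q_add = left_factor_hom(3)[of "\<lambda>u. c \<odot>\<^bsub>M\<^esub> u" for c, folded scale_Q, OF scale_closed scale_add_right scale_right]


text \<open>Each identity of a Lie module is additive in the tensor, hence holds because it holds on pure
  tensors.\<close>

lemma lie_tensor_is_lie_module: "is_lie_module L Q"
proof -
  have Q0: "0 \<odot>\<^bsub>Q\<^esub> t = \<zero>\<^bsub>Q\<^esub>" if "t \<in> carrier Q" for t
    using that
  proof (induction t rule: Q_induct)
    case (tens x y)
    then show ?case
      using tf.pure_zero_left[of y] by (simp add: scale_tens same lie_tensor_simps)
  qed (simp add: scale_Q_add)
  have "complex_space Q"
  proof (rule complex_spaceI)
    show "(a + b) \<odot>\<^bsub>Q\<^esub> t = a \<odot>\<^bsub>Q\<^esub> t \<oplus>\<^bsub>Q\<^esub> b \<odot>\<^bsub>Q\<^esub> t" if "t \<in> carrier Q" for a b t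
      using that
      by (induction t rule: Q_induct)
        (simp_all add: scale_tens scale_add_left tens_add_left scale_Q_add scale_Q_closed Q.a_ac)
    show "(a * b) \<odot>\<^bsub>Q\<^esub> t = a \<odot>\<^bsub>Q\<^esub> (b \<odot>\<^bsub>Q\<^esub> t)" if "t \<in> carrier Q" for a b t
      using that
      by (induction t rule: Q_induct)
        (simp_all add: scale_tens scale_scale scale_Q_add scale_Q_closed)
    show "1 \<odot>\<^bsub>Q\<^esub> t = t" if "t \<in> carrier Q" for t
      using that by (induction t rule: Q_induct) (simp_all add: scale_tens scale_Q_add)
  qed (simp_all add: scale_Q_closed scale_Q_add Q0 Q.a_ac)
  then interpret Qs: complex_space Q .
  have lin: "act Q x (c \<odot>\<^bsub>Q\<^esub> t) = c \<odot>\<^bsub>Q\<^esub> act Q x t" if "x \<in> L" "t \<in> carrier Q" for x c t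
    using that(2)
    by (induction t rule: Q_induct)
      (simp_all add: that(1) scale_tens act_tens act_scale scale_Q_add act_Q_add act_Q_closed
        scale_Q_closed)
  have "act Q (x + y) t = act Q x t \<oplus>\<^bsub>Q\<^esub> act Q y t" if "x \<in> L" "y \<in> L" "x + y \<in> L" "t \<in> carrier Q"
    for x y t
    using that(4)
    by (induction t rule: Q_induct)
      (simp_all add: that(1-3) act_tens act_plus act_Q_add act_Q_closed tens_add_left Q.a_ac)
  moreover have "act Q (vscale c x) t = c \<odot>\<^bsub>Q\<^esub> act Q x t"
    if "x \<in> L" "vscale c x \<in> L" "t \<in> carrier Q" for x c t
    using that(3)
    by (induction t rule: Q_induct)
      (simp_all add: that(1,2) act_tens act_vscale act_Q_add act_Q_closed scale_tens scale_Q_add)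
  moreover have "act Q (vbracket x y) t = act Q x (act Q y t) \<ominus>\<^bsub>Q\<^esub> act Q y (act Q x t)"
    if "x \<in> L" "y \<in> L" "vbracket x y \<in> L" "t \<in> carrier Q" for x y t
    using that(4)
  proof (induction t rule: Q_induct)
    case (tens u w)
    have "act Q (vbracket x y) (u \<^bold>\<otimes> w) = act M (vbracket x y) u \<^bold>\<otimes> w"
      using tens that(3) by (simp add: act_tens)
    also have "\<dots> = act M x (act M y u) \<^bold>\<otimes> w \<oplus>\<^bsub>Q\<^esub> ((-1) \<odot>\<^bsub>M\<^esub> act M y (act M x u)) \<^bold>\<otimes> w"
      using tens that(1,2) by (simp add: act_vbracket minus_scale tens_add_left)
    also have "\<dots> = act Q x (act Q y (u \<^bold>\<otimes> w)) \<oplus>\<^bsub>Q\<^esub> (-1) \<odot>\<^bsub>Q\<^esub> act Q y (act Q x (u \<^bold>\<otimes> w))"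
      using tens that(1,2) by (simp add: act_tens scale_tens)
    also have "\<dots> = act Q x (act Q y (u \<^bold>\<otimes> w)) \<ominus>\<^bsub>Q\<^esub> act Q y (act Q x (u \<^bold>\<otimes> w))"
      using tens that(1,2) by (intro Qs.minus_scale[symmetric] act_Q_closed tens_closed)
    finally show ?case .
  next
    case (add s t)
    have *: "act Q x (act Q y s) \<in> carrier Q" "act Q y (act Q x s) \<in> carrier Q"
      "act Q x (act Q y t) \<in> carrier Q" "act Q y (act Q x t) \<in> carrier Q"
      using add.hyps that(1,2) by (simp_all add: act_Q_closed)
    have "act Q (vbracket x y) (s \<oplus>\<^bsub>Q\<^esub> t) =
        (act Q x (act Q y s) \<ominus>\<^bsub>Q\<^esub> act Q y (act Q x s)) \<oplus>\<^bsub>Q\<^esub> (act Q x (act Q y t) \<ominus>\<^bsub>Q\<^esub> act Q y (act Q x t))"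
      using add that(3) by (simp only: act_Q_add)
    also have "\<dots> = (act Q x (act Q y s) \<oplus>\<^bsub>Q\<^esub> act Q x (act Q y t)) \<ominus>\<^bsub>Q\<^esub>
        (act Q y (act Q x s) \<oplus>\<^bsub>Q\<^esub> act Q y (act Q x t))"
      by (rule Qs.add_minus_add[OF *(1,3,2,4), symmetric])
    also have "\<dots> = act Q x (act Q y (s \<oplus>\<^bsub>Q\<^esub> t)) \<ominus>\<^bsub>Q\<^esub> act Q y (act Q x (s \<oplus>\<^bsub>Q\<^esub> t))"
      using add.hyps that(1,2) by (simp add: act_Q_add act_Q_closed)
    finally show ?case .
  qed
  ultimately show ?thesis
    unfolding is_lie_module_def
    by (intro conjI ballI allI Qs.module_axioms act_Q_closed act_Q_add lin) (simp_all add: closed)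
qed

end

section \<open>Universal enveloping algebras and their actions\<close>

lemma letters_simps [simp]: "letters 0 = []" "letters (u + v) = letters u @ letters v"
  by (simp_all add: zero_free_word_def plus_free_word_def)

lemma free_assoc_carrier:
  "f \<in> carrier (free_assoc L) \<longleftrightarrow> (\<forall>w\<in>Poly_Mapping.keys f. set (letters w) \<subseteq> L)"
  by (auto simp: free_assoc_def)

lemma free_assoc_simps [simp]:
  "f \<otimes>\<^bsub>free_assoc L\<^esub> g = f * g" "f \<oplus>\<^bsub>free_assoc L\<^esub> g = f + g"
  "\<one>\<^bsub>free_assoc L\<^esub> = 1" "\<zero>\<^bsub>free_assoc L\<^esub> = 0"
  by (auto simp: free_assoc_def)

lemma free_assoc_closed:
  assumes "f \<in> carrier (free_assoc L)" "g \<in> carrier (free_assoc L)"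
  shows "f + g \<in> carrier (free_assoc L)" "f * g \<in> carrier (free_assoc L)"
    "- f \<in> carrier (free_assoc L)" "f - g \<in> carrier (free_assoc L)"
proof -
  show "f + g \<in> carrier (free_assoc L)"
    using assms keys_add[of f g] by (auto simp: free_assoc_carrier)
  show "f * g \<in> carrier (free_assoc L)"
    unfolding free_assoc_carrier
  proof
    fix w assume "w \<in> Poly_Mapping.keys (f * g)"
    then obtain a b where "w = a + b" "a \<in> Poly_Mapping.keys f" "b \<in> Poly_Mapping.keys g"
      using keys_mult[of f g] by blast
    then show "set (letters w) \<subseteq> L" using assms by (auto simp: free_assoc_carrier)
  qed
  show "- f \<in> carrier (free_assoc L)"
    using assms by (simp add: free_assoc_carrier)
  show "f - g \<in> carrier (free_assoc L)"
    using assms keys_diff[of f g] by (auto simp: free_assoc_carrier)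
qed

lemma free_assoc_letter [simp]: "letter x \<in> carrier (free_assoc L) \<longleftrightarrow> x \<in> L"
  by (simp add: letter_def free_assoc_carrier)

lemma free_assoc_const: "free_const c \<in> carrier (free_assoc L)"
  by (simp add: free_const_def free_assoc_carrier)

lemma free_assoc_one: "1 \<in> carrier (free_assoc L)"
  by (simp add: free_assoc_carrier)

lemma free_assoc_zero: "0 \<in> carrier (free_assoc L)"
  by (simp add: free_assoc_carrier)

lemma free_assoc_single: "set (letters w) \<subseteq> L \<Longrightarrow> Poly_Mapping.single w c \<in> carrier (free_assoc L)"
  by (simp add: free_assoc_carrier)

lemma free_assoc_ring: "ring (free_assoc L)"
proof (rule ringI)
  show "abelian_group (free_assoc L)"
  proof (rule abelian_groupI)
    fix f assume "f \<in> carrier (free_assoc L)"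
    then show "\<exists>g\<in>carrier (free_assoc L). g \<oplus>\<^bsub>free_assoc L\<^esub> f = \<zero>\<^bsub>free_assoc L\<^esub>"
      using free_assoc_closed(3) by (intro bexI[of _ "- f"]) simp_all
  qed (simp_all add: free_assoc_closed add.assoc add.commute free_assoc_zero)
  show "Group.monoid (free_assoc L)"
    by (rule monoidI) (simp_all add: free_assoc_closed free_assoc_one mult.assoc)
qed (simp_all add: distrib_left distrib_right)

lemma free_assoc_minus: "f \<in> carrier (free_assoc L) \<Longrightarrow> \<ominus>\<^bsub>free_assoc L\<^esub> f = - f"
proof -
  assume f: "f \<in> carrier (free_assoc L)"
  interpret ring "free_assoc L" by (rule free_assoc_ring)
  show ?thesis
    using f free_assoc_closed(3)[OF f f] by (intro minus_equality) (simp_all)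
qed

lemma free_const_single: "free_const c * Poly_Mapping.single w 1 = Poly_Mapping.single w c"
  by (simp add: free_const_def mult_single)

lemma free_const_commute: "free_const c * f = f * free_const c"
proof -
  have *: "f = (\<Sum>k\<in>Poly_Mapping.keys f. Poly_Mapping.single k (Poly_Mapping.lookup f k))"
    by (rule poly_mapping_eqI)
      (simp add: lookup_sum lookup_single when_def in_keys_iff)
  show ?thesis
    by (subst *, subst (2) *)
      (simp add: free_const_def sum_distrib_left sum_distrib_right mult_single mult.commute)
qed

lemma free_single_induct [consumes 1, case_names single add]:
  assumes f: "f \<in> carrier (free_assoc L)"
    and single: "\<And>w c. set (letters w) \<subseteq> L \<Longrightarrow> P (Poly_Mapping.single w c)"
    and add: "\<And>f g. f \<in> carrier (free_assoc L) \<Longrightarrow> g \<in> carrier (free_assoc L) \<Longrightarrow> P f \<Longrightarrow> P g \<Longrightarrow> P (f + g)"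
  shows "P f"
proof -
  have *: "f = (\<Sum>k\<in>Poly_Mapping.keys f. Poly_Mapping.single k (Poly_Mapping.lookup f k))"
    by (rule poly_mapping_eqI)
      (simp add: lookup_sum lookup_single when_def in_keys_iff)
  have "P (\<Sum>k\<in>A. Poly_Mapping.single k (Poly_Mapping.lookup f k)) \<and>
      (\<Sum>k\<in>A. Poly_Mapping.single k (Poly_Mapping.lookup f k)) \<in> carrier (free_assoc L)"
    if "A \<subseteq> Poly_Mapping.keys f" for A
    using finite_subset[OF that finite_keys] that
  proof (induction A rule: finite_induct)
    case empty
    show ?case using single[of 0 0] by (simp add: free_assoc_carrier)
  next
    case (insert k A)
    have k: "set (letters k) \<subseteq> L" using f insert.prems by (auto simp: free_assoc_carrier)
    have k': "Poly_Mapping.single k (Poly_Mapping.lookup f k) \<in> carrier (free_assoc L)"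
      using k by (rule free_assoc_single)
    have IH: "P (\<Sum>k\<in>A. Poly_Mapping.single k (Poly_Mapping.lookup f k))"
      "(\<Sum>k\<in>A. Poly_Mapping.single k (Poly_Mapping.lookup f k)) \<in> carrier (free_assoc L)"
      using insert.IH insert.prems by auto
    show ?case
      unfolding sum.insert[OF insert.hyps]
      using add[OF k' IH(2) single[OF k] IH(1)] free_assoc_closed(1)[OF k' IH(2)] by blast
  qed
  from this[OF subset_refl] show ?thesis using * by simp
qed

text \<open>Words grow by multiplication with a letter from the left, which is how the action on a module
  unfolds.\<close>

lemma free_induct [consumes 1, case_names one const letter add]:
  assumes f: "f \<in> carrier (free_assoc L)" and one: "P 1"
    and const: "\<And>c f. f \<in> carrier (free_assoc L) \<Longrightarrow> P f \<Longrightarrow> P (free_const c * f)"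
    and letter: "\<And>x f. x \<in> L \<Longrightarrow> f \<in> carrier (free_assoc L) \<Longrightarrow> P f \<Longrightarrow> P (letter x * f)"
    and add: "\<And>f g. f \<in> carrier (free_assoc L) \<Longrightarrow> g \<in> carrier (free_assoc L) \<Longrightarrow> P f \<Longrightarrow> P g \<Longrightarrow> P (f + g)"
  shows "P f"
  using f
proof (induction f rule: free_single_induct)
  case (single w c)
  have "P (Poly_Mapping.single (Free_Word xs) 1)" if "set xs \<subseteq> L" for xs
    using that
  proof (induction xs)
    case Nil
    then show ?case using one by (simp flip: zero_free_word_def)
  next
    case (Cons x xs)
    have "Poly_Mapping.single (Free_Word (x # xs)) 1 = letter x * Poly_Mapping.single (Free_Word xs) 1"
      by (simp add: letter_def mult_single plus_free_word_def)
    then show ?case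
      using Cons letter[of x "Poly_Mapping.single (Free_Word xs) 1"] by (simp add: free_assoc_single)
  qed
  from this[of "letters w"] single show ?case
    using const[of "Poly_Mapping.single w 1" c] by (simp add: free_const_single free_assoc_single)
qed (fact add)

definition free_act :: "'m lie_module \<Rightarrow> free_alg \<Rightarrow> 'm \<Rightarrow> 'm" where
  "free_act M f v = (\<Oplus>\<^bsub>M\<^esub>w\<in>Poly_Mapping.keys f. Poly_Mapping.lookup f w \<odot>\<^bsub>M\<^esub> foldr (act M) (letters w) v)"

context lie_mod
begin

lemma word_act_closed: "set xs \<subseteq> L \<Longrightarrow> v \<in> carrier M \<Longrightarrow> foldr (act M) xs v \<in> carrier M"
  by (induction xs) auto

lemma free_act_superset:
  assumes "finite U" "Poly_Mapping.keys f \<subseteq> U" "\<And>w. w \<in> U \<Longrightarrow> set (letters w) \<subseteq> L" "v \<in> carrier M"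
  shows "free_act M f v = (\<Oplus>w\<in>U. Poly_Mapping.lookup f w \<odot> foldr (act M) (letters w) v)"
  unfolding free_act_def
  by (rule M.add.finprod_mono_neutral_cong_left)
    (use assms word_act_closed in \<open>auto simp: in_keys_iff\<close>)

lemma free_act_single:
  "set (letters w) \<subseteq> L \<Longrightarrow> v \<in> carrier M \<Longrightarrow>
    free_act M (Poly_Mapping.single w c) v = c \<odot> foldr (act M) (letters w) v"
  using word_act_closed[of "letters w" v] by (simp add: free_act_def)

lemma free_act_closed:
  "f \<in> carrier (free_assoc L) \<Longrightarrow> v \<in> carrier M \<Longrightarrow> free_act M f v \<in> carrier M"
  unfolding free_act_def by (intro M.finsum_closed) (auto intro!: word_act_closed simp: free_assoc_carrier)

lemma free_act_add:
  assumes f: "f \<in> carrier (free_assoc L)" and g: "g \<in> carrier (free_assoc L)" and v: "v \<in> carrier M"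
  shows "free_act M (f + g) v = free_act M f v \<oplus> free_act M g v"
proof -
  define U where "U = Poly_Mapping.keys f \<union> Poly_Mapping.keys g"
  have U: "finite U" "Poly_Mapping.keys f \<subseteq> U" "Poly_Mapping.keys g \<subseteq> U"
      "Poly_Mapping.keys (f + g) \<subseteq> U" "\<And>w. w \<in> U \<Longrightarrow> set (letters w) \<subseteq> L"
    using f g keys_add[of f g] by (auto simp: U_def free_assoc_carrier)
  have c: "foldr (act M) (letters w) v \<in> carrier M" if "w \<in> U" for w
    using U(5)[OF that] v by (rule word_act_closed)
  have "free_act M (f + g) v = (\<Oplus>w\<in>U. Poly_Mapping.lookup f w \<odot> foldr (act M) (letters w) v \<oplus>
      Poly_Mapping.lookup g w \<odot> foldr (act M) (letters w) v)"
    by (subst free_act_superset[OF U(1,4) _ v]; (intro M.finsum_cong')?)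
      (auto simp: c lookup_add scale_add_left dest: subsetD[OF U(5)])
  also have "\<dots> = free_act M f v \<oplus> free_act M g v"
    using free_act_superset[OF U(1,2) U(5) v] free_act_superset[OF U(1,3) U(5) v]
    by (subst M.finsum_addf) (auto simp: c)
  finally show ?thesis .
qed

lemma free_act_one: "v \<in> carrier M \<Longrightarrow> free_act M 1 v = v"
  using free_act_single[of 0 v 1] by simp

lemma free_act_letter_mult:
  assumes "f \<in> carrier (free_assoc L)" "x \<in> L" "v \<in> carrier M"
  shows "free_act M (letter x * f) v = act M x (free_act M f v)"
  using assms(1)
proof (induction f rule: free_single_induct)
  case (single w c)
  have "letter x * Poly_Mapping.single w c = Poly_Mapping.single (Free_Word (x # letters w)) c"
    by (simp add: letter_def mult_single plus_free_word_def)
  then show ?case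
    using single assms(2,3) by (simp add: free_act_single act_scale word_act_closed)
next
  case (add f g)
  have x: "letter x \<in> carrier (free_assoc L)" using assms(2) by simp
  show ?case
    unfolding distrib_left
    using add assms(2,3) free_assoc_closed(2)[OF x add.hyps(1)] free_assoc_closed(2)[OF x add.hyps(2)]
    by (simp add: free_act_add act_add free_act_closed)
qed

lemma free_act_const_mult:
  assumes "f \<in> carrier (free_assoc L)" "v \<in> carrier M"
  shows "free_act M (free_const c * f) v = c \<odot> free_act M f v"
  using assms(1)
proof (induction f rule: free_single_induct)
  case (single w b)
  then show ?case
    using assms(2) by (simp add: free_const_def mult_single free_act_single scale_scale word_act_closed)
next
  case (add f g)
  show ?case
    unfolding distrib_left
    using add assms(2) free_assoc_closed(2)[OF free_assoc_const add.hyps(1)]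
      free_assoc_closed(2)[OF free_assoc_const add.hyps(2)]
    by (simp add: free_act_add scale_add_right free_act_closed)
qed

lemma free_act_const: "v \<in> carrier M \<Longrightarrow> free_act M (free_const c) v = c \<odot> v"
  using free_act_const_mult[OF free_assoc_one, of v c] by (simp add: free_act_one)

lemma free_act_letter: "x \<in> L \<Longrightarrow> v \<in> carrier M \<Longrightarrow> free_act M (letter x) v = act M x v"
  using free_act_letter_mult[OF free_assoc_one, of x v] by (simp add: free_act_one)

lemma free_act_mult:
  assumes "f \<in> carrier (free_assoc L)" and g: "g \<in> carrier (free_assoc L)" and v: "v \<in> carrier M"
  shows "free_act M (f * g) v = free_act M f (free_act M g v)"
  using assms(1)
proof (induction f rule: free_induct)
  case one
  then show ?case using g v by (simp add: free_act_one free_act_closed)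
next
  case (const c f)
  then show ?case
    using g v by (simp add: mult.assoc free_act_const_mult free_assoc_closed free_act_closed)
next
  case (letter x f)
  then show ?case
    using g v by (simp add: mult.assoc free_act_letter_mult free_assoc_closed free_act_closed)
next
  case (add f h)
  then show ?case
    using g v by (simp add: distrib_right free_act_add free_assoc_closed free_act_closed)
qed

lemma free_act_linear:
  assumes f: "f \<in> carrier (free_assoc L)" and v: "v \<in> carrier M"
  shows "free_act M f (c \<odot> v) = c \<odot> free_act M f v"
  using free_act_mult[OF f free_assoc_const v] free_act_const_mult[OF f v]
  by (simp add: free_act_const v free_const_commute)

lemma free_act_minus:
  assumes f: "f \<in> carrier (free_assoc L)" and v: "v \<in> carrier M"
  shows "free_act M (- f) v = \<ominus> free_act M f v"
proof -
  have "free_const (-1) = - 1"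
    by (simp add: free_const_def single_uminus)
  then have "free_act M (- f) v = free_act M (free_const (-1) * f) v"
    by simp
  also have "\<dots> = \<ominus> free_act M f v"
    unfolding free_act_const_mult[OF f v] using free_act_closed[OF f v] by (rule minus_one_scale)
  finally show ?thesis .
qed

text \<open>To see that the defining ideal of the enveloping algebra acts by zero, it then suffices to check its
  generators.\<close>

lemma free_act_annihilator_ideal:
  "ideal {f \<in> carrier (free_assoc L). \<forall>v\<in>carrier M. free_act M f v = \<zero>} (free_assoc L)"
proof (rule idealI)
  show "ring (free_assoc L)" by (rule free_assoc_ring)
  then interpret FA: ring "free_assoc L" .
  have z: "free_act M f \<zero> = \<zero>" if "f \<in> carrier (free_assoc L)" for f
    using free_act_linear[OF that, of \<zero> 0] free_act_closed[OF that] by simp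
  show "subgroup {f \<in> carrier (free_assoc L). \<forall>v\<in>carrier M. free_act M f v = \<zero>} (add_monoid (free_assoc L))"
  proof (rule FA.add.subgroupI)
    have "0 \<in> {f \<in> carrier (free_assoc L). \<forall>v\<in>carrier M. free_act M f v = \<zero>}"
      by (auto simp: free_act_def free_assoc_carrier)
    then show "{f \<in> carrier (free_assoc L). \<forall>v\<in>carrier M. free_act M f v = \<zero>} \<noteq> {}"
      by blast
  next
    fix f assume f: "f \<in> {f \<in> carrier (free_assoc L). \<forall>v\<in>carrier M. free_act M f v = \<zero>}"
    then have "\<ominus>\<^bsub>free_assoc L\<^esub> f = - f" using free_assoc_minus by blast
    then show "\<ominus>\<^bsub>free_assoc L\<^esub> f \<in> {f \<in> carrier (free_assoc L). \<forall>v\<in>carrier M. free_act M f v = \<zero>}"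
      using f free_assoc_closed(3)[of f L f] by (simp add: free_act_minus)
  next
    fix f g assume "f \<in> {f \<in> carrier (free_assoc L). \<forall>v\<in>carrier M. free_act M f v = \<zero>}"
      "g \<in> {f \<in> carrier (free_assoc L). \<forall>v\<in>carrier M. free_act M f v = \<zero>}"
    then show "f \<oplus>\<^bsub>free_assoc L\<^esub> g \<in> {f \<in> carrier (free_assoc L). \<forall>v\<in>carrier M. free_act M f v = \<zero>}"
      using free_assoc_closed(1) by (simp add: free_act_add)
  qed auto
  fix f g assume f: "f \<in> {f \<in> carrier (free_assoc L). \<forall>v\<in>carrier M. free_act M f v = \<zero>}"
    and g: "g \<in> carrier (free_assoc L)"
  show "g \<otimes>\<^bsub>free_assoc L\<^esub> f \<in> {f \<in> carrier (free_assoc L). \<forall>v\<in>carrier M. free_act M f v = \<zero>}"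
    "f \<otimes>\<^bsub>free_assoc L\<^esub> g \<in> {f \<in> carrier (free_assoc L). \<forall>v\<in>carrier M. free_act M f v = \<zero>}"
    using f g free_assoc_closed(2) z
    by (simp_all add: free_act_mult free_act_closed)
qed

end

locale vfield_algebra =
  fixes L :: "vfield set"
  assumes add_closed: "\<And>x y. x \<in> L \<Longrightarrow> y \<in> L \<Longrightarrow> x + y \<in> L"
    and vscale_closed: "\<And>c x. x \<in> L \<Longrightarrow> vscale c x \<in> L"
    and vbracket_closed: "\<And>x y. x \<in> L \<Longrightarrow> y \<in> L \<Longrightarrow> vbracket x y \<in> L"
begin

sublocale FA: ring "free_assoc L" by (rule free_assoc_ring)

definition "env_rels =
  {letter (x + y) - letter x - letter y | x y. x \<in> L \<and> y \<in> L} \<union>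
  {letter (vscale c x) - free_const c * letter x | c x. x \<in> L} \<union>
  {letter x * letter y - letter y * letter x - letter (vbracket x y) | x y. x \<in> L \<and> y \<in> L}"

lemma env_ideal_eq: "env_ideal L = genideal (free_assoc L) env_rels"
  by (simp add: env_ideal_def env_rels_def)

lemma env_rels_closed: "env_rels \<subseteq> carrier (free_assoc L)"
proof
  fix f assume "f \<in> env_rels"
  then consider x y where "f = letter (x + y) - letter x - letter y" "x \<in> L" "y \<in> L"
    | c x where "f = letter (vscale c x) - free_const c * letter x" "x \<in> L"
    | x y where "f = letter x * letter y - letter y * letter x - letter (vbracket x y)" "x \<in> L" "y \<in> L"
    unfolding env_rels_def by blast
  then show "f \<in> carrier (free_assoc L)"
    by cases (simp_all only: free_assoc_closed free_assoc_const free_assoc_letter add_closed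
        vscale_closed vbracket_closed)
qed

lemma env_ideal_is_ideal: "ideal (env_ideal L) (free_assoc L)"
  unfolding env_ideal_eq by (rule FA.genideal_ideal[OF env_rels_closed])

lemma env_ideal_closed:
  shows env_ideal_carrier: "i \<in> env_ideal L \<Longrightarrow> i \<in> carrier (free_assoc L)"
    and "0 \<in> env_ideal L" "i \<in> env_ideal L \<Longrightarrow> j \<in> env_ideal L \<Longrightarrow> i + j \<in> env_ideal L"
    and "i \<in> env_ideal L \<Longrightarrow> - i \<in> env_ideal L"
    and "i \<in> env_ideal L \<Longrightarrow> f \<in> carrier (free_assoc L) \<Longrightarrow> f * i \<in> env_ideal L"
    and "i \<in> env_ideal L \<Longrightarrow> f \<in> carrier (free_assoc L) \<Longrightarrow> i * f \<in> env_ideal L"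
proof -
  interpret I: ideal "env_ideal L" "free_assoc L" by (rule env_ideal_is_ideal)
  show *: "i \<in> env_ideal L \<Longrightarrow> i \<in> carrier (free_assoc L)" by (rule I.a_Hcarr)
  show "0 \<in> env_ideal L" using I.zero_closed by simp
  show "i \<in> env_ideal L \<Longrightarrow> j \<in> env_ideal L \<Longrightarrow> i + j \<in> env_ideal L"
    using I.a_closed[of i j] by simp
  show "i \<in> env_ideal L \<Longrightarrow> - i \<in> env_ideal L"
    using I.a_inv_closed[of i] free_assoc_minus[OF *] by simp
  show "i \<in> env_ideal L \<Longrightarrow> f \<in> carrier (free_assoc L) \<Longrightarrow> f * i \<in> env_ideal L"
    using I.I_l_closed[of i f] by simp
  show "i \<in> env_ideal L \<Longrightarrow> f \<in> carrier (free_assoc L) \<Longrightarrow> i * f \<in> env_ideal L"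
    using I.I_r_closed[of i f] by simp
qed

sublocale U: ring "env L"
  unfolding env_def by (rule ideal.quotient_is_ring[OF env_ideal_is_ideal])

abbreviation cl :: "free_alg \<Rightarrow> free_alg set" where "cl f \<equiv> env_ideal L +>\<^bsub>free_assoc L\<^esub> f"

lemma env_rel_in_ideal: "f \<in> env_rels \<Longrightarrow> f \<in> env_ideal L"
  unfolding env_ideal_eq using FA.genideal_self[OF env_rels_closed] by blast

lemma env_ideal_minimal: "ideal J (free_assoc L) \<Longrightarrow> env_rels \<subseteq> J \<Longrightarrow> env_ideal L \<subseteq> J"
  unfolding env_ideal_eq by (rule FA.genideal_minimal)

lemma cl_hom: "cl \<in> ring_hom (free_assoc L) (env L)"
  unfolding env_def by (rule ideal.rcos_ring_hom[OF env_ideal_is_ideal])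

lemma cl_closed [simp]: "f \<in> carrier (free_assoc L) \<Longrightarrow> cl f \<in> carrier (env L)"
  by (rule ring_hom_closed[OF cl_hom])

lemma carrier_env: "carrier (env L) = cl ` carrier (free_assoc L)"
  unfolding env_def FactRing_def by (auto simp: A_RCOSETS_def')

lemma cl_simps:
  "f \<in> carrier (free_assoc L) \<Longrightarrow> g \<in> carrier (free_assoc L) \<Longrightarrow> cl (f + g) = cl f \<oplus>\<^bsub>env L\<^esub> cl g"
  "f \<in> carrier (free_assoc L) \<Longrightarrow> g \<in> carrier (free_assoc L) \<Longrightarrow> cl (f * g) = cl f \<otimes>\<^bsub>env L\<^esub> cl g"
  "cl 1 = \<one>\<^bsub>env L\<^esub>"
  using ring_hom_add[OF cl_hom, of f g] ring_hom_mult[OF cl_hom, of f g] ring_hom_one[OF cl_hom]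
  by simp_all

lemma mem_cl: "g \<in> cl f \<longleftrightarrow> (\<exists>i\<in>env_ideal L. g = i + f)"
  by (auto simp: a_r_coset_def')

lemma cl_eqI:
  assumes "f \<in> carrier (free_assoc L)" "g \<in> carrier (free_assoc L)" "f - g \<in> env_ideal L"
  shows "cl f = cl g"
proof -
  have "f \<in> cl g" unfolding mem_cl by (rule bexI[OF _ assms(3)]) simp
  then show ?thesis using FA.a_repr_independence[OF _ assms(2)
      additive_subgroup.a_subgroup[OF ideal.axioms(1)[OF env_ideal_is_ideal]], of f] by simp
qed

lemma env_of_closed [simp]: "x \<in> L \<Longrightarrow> env_of L x \<in> carrier (env L)"
  and env_const_closed [simp]: "env_const L c \<in> carrier (env L)"
  unfolding env_of_def env_const_def by (simp_all add: free_assoc_const)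

lemma env_induct [consumes 1, case_names one const letter add]:
  assumes "u \<in> carrier (env L)" "P \<one>\<^bsub>env L\<^esub>"
    and "\<And>c u. u \<in> carrier (env L) \<Longrightarrow> P u \<Longrightarrow> P (env_const L c \<otimes>\<^bsub>env L\<^esub> u)"
    and "\<And>x u. x \<in> L \<Longrightarrow> u \<in> carrier (env L) \<Longrightarrow> P u \<Longrightarrow> P (env_of L x \<otimes>\<^bsub>env L\<^esub> u)"
    and "\<And>u v. u \<in> carrier (env L) \<Longrightarrow> v \<in> carrier (env L) \<Longrightarrow> P u \<Longrightarrow> P v \<Longrightarrow> P (u \<oplus>\<^bsub>env L\<^esub> v)"
  shows "P u"
proof -
  have "P (cl f)" if "f \<in> carrier (free_assoc L)" for f
    using that
  proof (induction f rule: free_induct)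
    case one
    then show ?case using assms(2) by (simp add: cl_simps)
  next
    case (const c f)
    then show ?case
      using assms(3)[of "cl f" c] cl_simps(2)[OF free_assoc_const, of f c]
      by (simp add: env_const_def)
  next
    case (letter x f)
    then show ?case
      using assms(4)[of x "cl f"] cl_simps(2)[of "letter x" f]
      by (simp add: env_of_def)
  next
    case (add f g)
    then show ?case
      using assms(5)[of "cl f" "cl g"] by (simp add: cl_simps)
  qed
  then show ?thesis using assms(1) unfolding carrier_env by blast
qed

lemma env_const_simps:
  "env_const L (a + b) = env_const L a \<oplus>\<^bsub>env L\<^esub> env_const L b"
  "env_const L (a * b) = env_const L a \<otimes>\<^bsub>env L\<^esub> env_const L b"
  "env_const L 1 = \<one>\<^bsub>env L\<^esub>" "env_const L 0 = \<zero>\<^bsub>env L\<^esub>"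
proof -
  have "free_const (a + b) = free_const a + free_const b" "free_const (a * b) = free_const a * free_const b"
    by (simp_all add: free_const_def single_add mult_single)
  then show "env_const L (a + b) = env_const L a \<oplus>\<^bsub>env L\<^esub> env_const L b"
    "env_const L (a * b) = env_const L a \<otimes>\<^bsub>env L\<^esub> env_const L b"
    unfolding env_const_def by (simp_all add: cl_simps free_assoc_const)
  show "env_const L 1 = \<one>\<^bsub>env L\<^esub>"
    by (simp add: env_const_def free_const_def cl_simps)
  show "env_const L 0 = \<zero>\<^bsub>env L\<^esub>"
    using ring_hom_zero[OF cl_hom free_assoc_ring U.ring_axioms] by (simp add: env_const_def free_const_def)
qed

lemma env_const_central:
  assumes "u \<in> carrier (env L)"
  shows "env_const L c \<otimes>\<^bsub>env L\<^esub> u = u \<otimes>\<^bsub>env L\<^esub> env_const L c"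
proof -
  obtain f where f: "f \<in> carrier (free_assoc L)" "u = cl f"
    using assms unfolding carrier_env by (elim imageE)
  have "cl (free_const c) \<otimes>\<^bsub>env L\<^esub> cl f = cl (free_const c * f)"
    by (rule cl_simps(2)[OF free_assoc_const f(1), symmetric])
  also have "\<dots> = cl (f * free_const c)"
    by (rule arg_cong[OF free_const_commute])
  also have "\<dots> = cl f \<otimes>\<^bsub>env L\<^esub> cl (free_const c)"
    by (rule cl_simps(2)[OF f(1) free_assoc_const])
  finally show ?thesis by (simp only: f(2) env_const_def)
qed

lemma env_of_add:
  assumes "x \<in> L" "y \<in> L"
  shows "env_of L (x + y) = env_of L x \<oplus>\<^bsub>env L\<^esub> env_of L y"
proof -
  have c: "letter x \<in> carrier (free_assoc L)" "letter y \<in> carrier (free_assoc L)"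
    "letter (x + y) \<in> carrier (free_assoc L)"
    using assms add_closed by (simp_all only: free_assoc_letter)
  have "letter (x + y) - letter x - letter y \<in> env_ideal L"
    by (rule env_rel_in_ideal) (use assms in \<open>unfold env_rels_def, blast\<close>)
  then have "cl (letter (x + y)) = cl (letter x + letter y)"
    by (intro cl_eqI[OF c(3) free_assoc_closed(1)[OF c(1,2)]]) (simp only: diff_diff_eq)
  then show ?thesis
    unfolding env_of_def cl_simps(1)[OF c(1,2)] .
qed

lemma env_of_vscale:
  assumes "x \<in> L"
  shows "env_of L (vscale c x) = env_const L c \<otimes>\<^bsub>env L\<^esub> env_of L x"
proof -
  have c: "letter x \<in> carrier (free_assoc L)" "letter (vscale c x) \<in> carrier (free_assoc L)"
    using assms vscale_closed by (simp_all only: free_assoc_letter)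
  have "letter (vscale c x) - free_const c * letter x \<in> env_ideal L"
    by (rule env_rel_in_ideal) (use assms in \<open>unfold env_rels_def, blast\<close>)
  then have "cl (letter (vscale c x)) = cl (free_const c * letter x)"
    by (rule cl_eqI[OF c(2) free_assoc_closed(2)[OF free_assoc_const c(1)]])
  then show ?thesis
    unfolding env_of_def env_const_def cl_simps(2)[OF free_assoc_const c(1)] .
qed

lemma env_of_vbracket:
  assumes "x \<in> L" "y \<in> L"
  shows "env_of L x \<otimes>\<^bsub>env L\<^esub> env_of L y =
    env_of L (vbracket x y) \<oplus>\<^bsub>env L\<^esub> env_of L y \<otimes>\<^bsub>env L\<^esub> env_of L x"
proof -
  have c: "letter x \<in> carrier (free_assoc L)" "letter y \<in> carrier (free_assoc L)"
    "letter (vbracket x y) \<in> carrier (free_assoc L)"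
    using assms vbracket_closed by (simp_all only: free_assoc_letter)
  note m = free_assoc_closed(2)[OF c(1,2)] free_assoc_closed(2)[OF c(2,1)]
  have "letter x * letter y - letter y * letter x - letter (vbracket x y) \<in> env_ideal L"
    by (rule env_rel_in_ideal) (use assms in \<open>unfold env_rels_def, blast\<close>)
  moreover have "letter x * letter y - (letter (vbracket x y) + letter y * letter x) =
      letter x * letter y - letter y * letter x - letter (vbracket x y)"
    by (simp only: diff_diff_eq add.commute)
  ultimately have "cl (letter x * letter y) = cl (letter (vbracket x y) + letter y * letter x)"
    by (intro cl_eqI[OF m(1) free_assoc_closed(1)[OF c(3) m(2)]]) (simp only:)
  then show ?thesis
    unfolding env_of_def cl_simps(1)[OF c(3) m(2)] cl_simps(2)[OF c(1,2)] cl_simps(2)[OF c(2,1)] .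
qed

end

section \<open>Ladder operators and the decomposition of Whittaker modules\<close>

text \<open>The situation of \<open>D = e - 1\<close> and \<open>d\<close> for operators with \<open>[e, d] = e\<close>.\<close>

locale ladder = complex_space K for K (structure) +
  fixes D d :: "'a \<Rightarrow> 'a"
  assumes D_closed [simp]: "v \<in> carrier K \<Longrightarrow> D v \<in> carrier K"
    and d_closed [simp]: "v \<in> carrier K \<Longrightarrow> d v \<in> carrier K"
    and D_add: "v \<in> carrier K \<Longrightarrow> w \<in> carrier K \<Longrightarrow> D (v \<oplus> w) = D v \<oplus> D w"
    and d_add: "v \<in> carrier K \<Longrightarrow> w \<in> carrier K \<Longrightarrow> d (v \<oplus> w) = d v \<oplus> d w"
    and D_scale: "v \<in> carrier K \<Longrightarrow> D (c \<odot> v) = c \<odot> D v"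
    and d_scale: "v \<in> carrier K \<Longrightarrow> d (c \<odot> v) = c \<odot> d v"
    and D_d: "v \<in> carrier K \<Longrightarrow> D (d v) = d (D v) \<oplus> (D v \<oplus> v)"
begin

lemma D_zero [simp]: "D \<zero> = \<zero>" and d_zero [simp]: "d \<zero> = \<zero>"
  using D_scale[of \<zero> 0] d_scale[of \<zero> 0] by simp_all

lemma Dpow_closed [simp]: "v \<in> carrier K \<Longrightarrow> (D ^^ n) v \<in> carrier K"
  and dpow_closed [simp]: "v \<in> carrier K \<Longrightarrow> (d ^^ n) v \<in> carrier K"
  by (induction n) auto

lemma Dpow_add: "v \<in> carrier K \<Longrightarrow> w \<in> carrier K \<Longrightarrow> (D ^^ n) (v \<oplus> w) = (D ^^ n) v \<oplus> (D ^^ n) w"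
  and dpow_add: "v \<in> carrier K \<Longrightarrow> w \<in> carrier K \<Longrightarrow> (d ^^ n) (v \<oplus> w) = (d ^^ n) v \<oplus> (d ^^ n) w"
  by (induction n) (auto simp: D_add d_add)

lemma Dpow_scale: "v \<in> carrier K \<Longrightarrow> (D ^^ n) (c \<odot> v) = c \<odot> (D ^^ n) v"
  by (induction n) (auto simp: D_scale)

lemma Dpow_zero [simp]: "(D ^^ n) \<zero> = \<zero>" and dpow_zero [simp]: "(d ^^ n) \<zero> = \<zero>"
  by (induction n) auto

lemma Dpow_mono: "(D ^^ n) v = \<zero> \<Longrightarrow> n \<le> m \<Longrightarrow> (D ^^ m) v = \<zero>"
  using Dpow_zero[of "m - n"] funpow_add[of "m - n" n D] by simp

lemma Dpow_d:
  assumes v: "v \<in> carrier K"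
  shows "(D ^^ n) (d v) = d ((D ^^ n) v) \<oplus> (of_nat n \<odot> (D ^^ n) v \<oplus> of_nat n \<odot> (D ^^ (n - 1)) v)"
proof (induction n)
  case 0
  then show ?case using v by simp
next
  case (Suc n)
  define x where "x = (D ^^ n) v"
  define y where "y = (D ^^ (n - 1)) v"
  have c: "x \<in> carrier K" "y \<in> carrier K" using v by (simp_all add: x_def y_def)
  have y: "of_nat n \<odot> D y = of_nat n \<odot> x"
    using c by (cases n) (simp_all add: x_def y_def)
  have "(D ^^ Suc n) (d v) = D (d x \<oplus> (of_nat n \<odot> x \<oplus> of_nat n \<odot> y))"
    using Suc by (simp add: x_def y_def)
  also have "\<dots> = (d (D x) \<oplus> (D x \<oplus> x)) \<oplus> (of_nat n \<odot> D x \<oplus> of_nat n \<odot> x)"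
    using c y by (simp add: D_add D_scale D_d)
  also have "\<dots> = d (D x) \<oplus> (of_nat (Suc n) \<odot> D x \<oplus> of_nat (Suc n) \<odot> x)"
    using c by (simp add: scale_add_left M.a_ac)
  finally show ?case by (simp add: x_def)
qed

lemma Dpow_dpow:
  assumes w: "w \<in> carrier K" "D w = \<zero>"
  shows "(D ^^ n) ((d ^^ n) w) = fact n \<odot> w \<and> (D ^^ Suc n) ((d ^^ n) w) = \<zero>"
proof (induction n)
  case 0
  then show ?case using w by simp
next
  case (Suc n)
  define x where "x = (d ^^ n) w"
  have x: "x \<in> carrier K" using w by (simp add: x_def)
  have *: "(D ^^ n) x = fact n \<odot> w" "(D ^^ Suc n) x = \<zero>" "(D ^^ Suc (Suc n)) x = \<zero>"
    using Suc w by (simp_all add: x_def D_scale)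
  have "(D ^^ Suc n) (d x) = of_nat (Suc n) \<odot> (fact n \<odot> w)"
    unfolding Dpow_d[OF x, of "Suc n"] *(2) using *(1) w by simp
  moreover have "(D ^^ Suc (Suc n)) (d x) = \<zero>"
    unfolding Dpow_d[OF x, of "Suc (Suc n)"] *(3) using *(2) by simp
  ultimately show ?case
    using w by (simp add: x_def scale_scale del: of_nat_Suc)
qed

lemma Dpow_dpow_greater:
  "w \<in> carrier K \<Longrightarrow> D w = \<zero> \<Longrightarrow> n < m \<Longrightarrow> (D ^^ m) ((d ^^ n) w) = \<zero>"
  by (rule Dpow_mono[of "Suc n"]) (simp_all only: Dpow_dpow Suc_leI)

text \<open>If \<open>D\<^sup>n\<^sup>+\<^sup>1 v = 0\<close>, then \<open>w = D\<^sup>n v / n!\<close> is in the kernel of \<open>D\<close>, and \<open>D\<^sup>n\<close> kills \<open>v - d\<^sup>n w\<close>.\<close>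

lemma ladder_induct:
  assumes "v \<in> carrier K" "(D ^^ k) v = \<zero>"
    and gen: "\<And>n w. w \<in> carrier K \<Longrightarrow> D w = \<zero> \<Longrightarrow> P ((d ^^ n) w)"
    and add: "\<And>u v. u \<in> carrier K \<Longrightarrow> v \<in> carrier K \<Longrightarrow> P u \<Longrightarrow> P v \<Longrightarrow> P (u \<oplus> v)"
  shows "P v"
  using assms(1,2)
proof (induction k arbitrary: v)
  case 0
  then show ?case using gen[of \<zero> 0] by simp
next
  case (Suc n)
  define w where "w = (1 / fact n) \<odot> (D ^^ n) v"
  have w: "w \<in> carrier K" "D w = \<zero>" "fact n \<odot> w = (D ^^ n) v"
    using Suc.prems by (simp_all add: w_def D_scale scale_scale)
  define u where "u = v \<ominus> (d ^^ n) w"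
  have u: "u \<in> carrier K" using Suc.prems w by (simp add: u_def)
  have "(D ^^ n) u = (D ^^ n) v \<ominus> fact n \<odot> w"
    using Suc.prems w Dpow_dpow[OF w(1,2), of n]
    by (simp add: u_def minus_scale Dpow_add Dpow_scale)
  then have "(D ^^ n) u = \<zero>"
    using Suc.prems w by (simp add: minus_eq_zero_iff)
  then have "P u" using Suc.IH u by blast
  then have "P (u \<oplus> (d ^^ n) w)"
    using add[OF u _ _ gen[OF w(1,2), of n]] w by simp
  then show ?case using Suc.prems w by (simp add: u_def minus_add_cancel')
qed

text \<open>If \<open>D\<^sup>n\<^sup>+\<^sup>1 u = 0\<close>, then \<open>D\<^sup>n\<^sup>+\<^sup>1 d u = (n + 1) D\<^sup>n u\<close>; the left-hand side vanishes with \<open>D d u\<close>.\<close>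

lemma d_kernel_trivial:
  assumes "u \<in> carrier K" "(D ^^ k) u = \<zero>" "D (d u) = \<zero>"
  shows "u = \<zero>"
  using assms(2)
proof (induction k)
  case 0
  then show ?case by simp
next
  case (Suc n)
  have "(D ^^ Suc n) (d u) = (D ^^ n) \<zero>"
    unfolding funpow_Suc_right comp_def assms(3) ..
  moreover have "(D ^^ Suc n) (d u) = of_nat (Suc n) \<odot> (D ^^ n) u"
    unfolding Dpow_d[OF assms(1), of "Suc n"] Suc.prems using assms(1) by (simp del: of_nat_Suc)
  ultimately have "(D ^^ n) u = \<zero>"
    using assms(1) scale_eq_zero_iff[of "(D ^^ n) u" "of_nat (Suc n)"] by (simp del: of_nat_Suc)
  then show ?case by (rule Suc.IH)
qed

end

definition shifted :: "'m lie_module \<Rightarrow> vfield \<Rightarrow> 'm \<Rightarrow> 'm" where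
  "shifted M x v = act M x v \<ominus>\<^bsub>M\<^esub> v"

definition nilpotent_at :: "'m lie_module \<Rightarrow> vfield \<Rightarrow> 'm \<Rightarrow> bool" where
  "nilpotent_at M x v \<longleftrightarrow> (\<exists>k. (shifted M x ^^ k) v = \<zero>\<^bsub>M\<^esub>)"

lemma funpow_commute_on:
  assumes "\<And>v. v \<in> C \<Longrightarrow> f v \<in> C" "\<And>v. v \<in> C \<Longrightarrow> g v \<in> C" "\<And>v. v \<in> C \<Longrightarrow> f (g v) = g (f v)" "v \<in> C"
  shows "(f ^^ m) ((g ^^ n) v) = (g ^^ n) ((f ^^ m) v)"
proof -
  have gC: "(g ^^ n) v \<in> C" if "v \<in> C" for n v using that assms(2) by (induction n) auto
  have fC: "(f ^^ m) v \<in> C" for m using assms(1,4) by (induction m) auto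
  have fg: "f ((g ^^ n) v) = (g ^^ n) (f v)" if "v \<in> C" for n v
    using that by (induction n) (simp_all add: assms(3) gC)
  show ?thesis
    by (induction m) (simp_all add: fg fC)
qed

locale S2bar_mod = lie_mod S2bar M for M :: "'m lie_module" (structure)
begin

lemma shifted_closed [simp]: "x \<in> S2bar \<Longrightarrow> v \<in> carrier M \<Longrightarrow> shifted M x v \<in> carrier M"
  and shifted_add: "x \<in> S2bar \<Longrightarrow> v \<in> carrier M \<Longrightarrow> w \<in> carrier M \<Longrightarrow>
    shifted M x (v \<oplus> w) = shifted M x v \<oplus> shifted M x w"
  and shifted_scale: "x \<in> S2bar \<Longrightarrow> v \<in> carrier M \<Longrightarrow> shifted M x (c \<odot> v) = c \<odot> shifted M x v"
  and act_eq_shifted: "x \<in> S2bar \<Longrightarrow> v \<in> carrier M \<Longrightarrow> act M x v = shifted M x v \<oplus> v"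
     apply (simp add: shifted_def)
    apply (simp add: shifted_def act_add add_minus_add)
   apply (simp add: shifted_def act_scale minus_scale scale_add_right scale_scale mult.commute)
  apply (simp add: shifted_def minus_add_cancel')
  done

lemma shifted_pow_closed [simp]: "x \<in> S2bar \<Longrightarrow> v \<in> carrier M \<Longrightarrow> (shifted M x ^^ n) v \<in> carrier M"
  by (induction n) auto

lemma shifted_zero: "x \<in> S2bar \<Longrightarrow> (shifted M x ^^ n) \<zero> = \<zero>"
proof (induction n)
  case (Suc n)
  then show ?case using shifted_scale[of x \<zero> 0] by simp
qed simp

lemma shifted_pow_add: "x \<in> S2bar \<Longrightarrow> v \<in> carrier M \<Longrightarrow> w \<in> carrier M \<Longrightarrow>
    (shifted M x ^^ n) (v \<oplus> w) = (shifted M x ^^ n) v \<oplus> (shifted M x ^^ n) w"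
  by (induction n) (auto simp: shifted_add)

lemma shifted_pow_scale: "x \<in> S2bar \<Longrightarrow> v \<in> carrier M \<Longrightarrow>
    (shifted M x ^^ n) (c \<odot> v) = c \<odot> (shifted M x ^^ n) v"
  by (induction n) (auto simp: shifted_scale)

lemma shifted_pow_mono:
  assumes "x \<in> S2bar" "(shifted M x ^^ n) v = \<zero>" "n \<le> m"
  shows "(shifted M x ^^ m) v = \<zero>"
  using shifted_zero[OF assms(1), of "m - n"] funpow_add[of "m - n" n "shifted M x"] assms(2,3) by simp

lemma nilpotent_at_add:
  assumes x: "x \<in> S2bar" and v: "v \<in> carrier M" "w \<in> carrier M"
    and "nilpotent_at M x v" "nilpotent_at M x w"
  shows "nilpotent_at M x (v \<oplus> w)"
proof -
  obtain k l where k: "(shifted M x ^^ k) v = \<zero>" "(shifted M x ^^ l) w = \<zero>"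
    using assms(4,5) unfolding nilpotent_at_def by blast
  have "(shifted M x ^^ (k + l)) v = \<zero>" "(shifted M x ^^ (k + l)) w = \<zero>"
    using shifted_pow_mono[OF x k(1), of "k + l"] shifted_pow_mono[OF x k(2), of "k + l"] by simp_all
  then have "(shifted M x ^^ (k + l)) (v \<oplus> w) = \<zero>"
    using x v by (simp add: shifted_pow_add)
  then show ?thesis unfolding nilpotent_at_def ..
qed

lemma nilpotent_at_scale:
  assumes x: "x \<in> S2bar" and v: "v \<in> carrier M" and "nilpotent_at M x v"
  shows "nilpotent_at M x (c \<odot> v)"
proof -
  obtain k where "(shifted M x ^^ k) v = \<zero>"
    using assms(3) unfolding nilpotent_at_def by blast
  then have "(shifted M x ^^ k) (c \<odot> v) = \<zero>"
    using x v by (simp add: shifted_pow_scale)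
  then show ?thesis unfolding nilpotent_at_def ..
qed

lemma shifted_act:
  assumes "e \<in> S2bar" "x \<in> S2bar" "v \<in> carrier M"
  shows "shifted M e (act M x v) = act M (vbracket e x) v \<oplus> act M x (shifted M e v)"
proof -
  have b: "vbracket e x \<in> S2bar" using assms by (simp add: S2bar_vbracket)
  have "shifted M e (act M x v) = (act M (vbracket e x) v \<oplus> act M x (shifted M e v \<oplus> v)) \<ominus> act M x v"
    using assms by (simp add: shifted_def[of M e "act M x v"] act_swap[of e x v] act_eq_shifted[of e v])
  also have "\<dots> = (act M (vbracket e x) v \<oplus> act M x (shifted M e v)) \<oplus> act M x v \<ominus> act M x v"
    using assms b by (simp add: act_add M.a_assoc)
  also have "\<dots> = act M (vbracket e x) v \<oplus> act M x (shifted M e v)"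
    using assms b by (intro add_minus_cancel) simp_all
  finally show ?thesis .
qed

text \<open>\<open>D = e - 1\<close> satisfies \<open>D x = [e, x] + x D\<close>, so a power of \<open>D\<close> on \<open>x v\<close> is distributed between
  powers of \<open>ad e\<close> on \<open>x\<close> and powers of \<open>D\<close> on \<open>v\<close>.\<close>

lemma shifted_pow_act:
  assumes e: "e \<in> S2bar"
  shows "x \<in> S2bar \<Longrightarrow> v \<in> carrier M \<Longrightarrow> (vbracket e ^^ n) x = 0 \<Longrightarrow> (shifted M e ^^ k) v = \<zero> \<Longrightarrow>
    (shifted M e ^^ (n + k)) (act M x v) = \<zero>"
proof (induction "n + k" arbitrary: n k x v)
  case 0
  then show ?case by (simp add: act_zero)
next
  case (Suc m)
  show ?case
  proof (cases "n = 0 \<or> k = 0")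
    case True
    then have "act M x v = \<zero>"
      using Suc.prems by (auto simp: act_zero act_zero_field)
    then show ?thesis using e by (simp add: shifted_zero)
  next
    case False
    then obtain n' k' where nk: "n = Suc n'" "k = Suc k'" by (metis not0_implies_Suc)
    have b: "vbracket e x \<in> S2bar" using e Suc.prems by (simp add: S2bar_vbracket)
    have "(shifted M e ^^ m) (act M (vbracket e x) v) = \<zero>"
      using Suc.hyps(1)[of n' k "vbracket e x" v] Suc.hyps(2) Suc.prems b nk
      by (simp add: funpow_Suc_right del: funpow.simps)
    moreover have "(shifted M e ^^ m) (act M x (shifted M e v)) = \<zero>"
      using Suc.hyps(1)[of n k' x "shifted M e v"] Suc.hyps(2) Suc.prems e nk
      by (simp add: funpow_Suc_right del: funpow.simps)
    ultimately have "(shifted M e ^^ m) (shifted M e (act M x v)) = \<zero>"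
      using e Suc.prems b by (simp add: shifted_act shifted_pow_add)
    then show ?thesis
      unfolding Suc.hyps(2)[symmetric] by (simp add: funpow_Suc_right del: funpow.simps)
  qed
qed

lemma nilpotent_at_act:
  assumes "e = partial1 \<or> e = partial2" "x \<in> S2bar" "v \<in> carrier M" "nilpotent_at M e v"
  shows "nilpotent_at M e (act M x v)"
proof -
  have e: "e \<in> S2bar" using assms(1) by auto
  obtain n where "(vbracket e ^^ n) x = 0" using ad_partial_nilpotent[OF assms(1)] by blast
  moreover obtain k where "(shifted M e ^^ k) v = \<zero>"
    using assms(4) unfolding nilpotent_at_def by blast
  ultimately show ?thesis
    using shifted_pow_act[OF e assms(2,3)] unfolding nilpotent_at_def by blast
qed

lemma act_commute: "x \<in> S2bar \<Longrightarrow> y \<in> S2bar \<Longrightarrow> vbracket x y = 0 \<Longrightarrow> v \<in> carrier M \<Longrightarrow>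
    act M x (act M y v) = act M y (act M x v)"
  using act_swap[of x y v] by (simp add: act_zero_field)

lemma shifted_act_commute: "x \<in> S2bar \<Longrightarrow> y \<in> S2bar \<Longrightarrow> vbracket x y = 0 \<Longrightarrow> v \<in> carrier M \<Longrightarrow>
    shifted M x (act M y v) = act M y (shifted M x v)"
  using shifted_act[of x y v] by (simp add: act_zero_field)

lemma shifted_commute: "x \<in> S2bar \<Longrightarrow> y \<in> S2bar \<Longrightarrow> vbracket x y = 0 \<Longrightarrow> v \<in> carrier M \<Longrightarrow>
    shifted M x (shifted M y v) = shifted M y (shifted M x v)"
  unfolding shifted_def[of M y]
  by (simp add: minus_scale shifted_add shifted_scale shifted_act_commute)

lemma Wh_iff: "v \<in> Wh M \<longleftrightarrow> v \<in> carrier M \<and> shifted M partial1 v = \<zero> \<and> shifted M partial2 v = \<zero>"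
  by (auto simp: Wh_def shifted_def minus_eq_zero_iff)

lemma Wh_carrier: "v \<in> Wh M \<Longrightarrow> v \<in> carrier M"
  by (simp add: Wh_def)

lemma Wh_subspace: "subspace M (Wh M)"
  by (rule subspaceI) (auto simp: Wh_def act_zero act_add act_scale)

lemma ladder_of_bracket:
  assumes "e \<in> S2bar" "x \<in> S2bar" "vbracket e x = e"
  shows "ladder M (shifted M e) (act M x)"
proof
  fix v assume v: "v \<in> carrier M"
  show "shifted M e (act M x v) = act M x (shifted M e v) \<oplus> (shifted M e v \<oplus> v)"
    using v assms by (simp add: shifted_act act_eq_shifted[of e v] M.a_ac)
qed (use assms in \<open>simp_all add: shifted_add shifted_scale act_add act_scale\<close>)

sublocale l1: ladder M "shifted M partial1" "act M d1"
  by (rule ladder_of_bracket) (simp_all add: vbracket_partials_d)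

sublocale l2: ladder M "shifted M partial2" "act M d2"
  by (rule ladder_of_bracket) (simp_all add: vbracket_partials_d)

end

text \<open>The modules of the category without the bound on the Whittaker vectors, so that \<open>Q\<^sub>1\<close> is among them.\<close>

locale whittaker_mod = S2bar_mod +
  assumes nilpotent: "v \<in> carrier M \<Longrightarrow> nilpotent_at M partial1 v"
    "v \<in> carrier M \<Longrightarrow> nilpotent_at M partial2 v"
begin

abbreviation "D\<^sub>1 \<equiv> shifted M partial1"
abbreviation "D\<^sub>2 \<equiv> shifted M partial2"
abbreviation "dd\<^sub>1 \<equiv> act M d1"
abbreviation "dd\<^sub>2 \<equiv> act M d2"

lemma nilpotent_powers:
  assumes "v \<in> carrier M"
  obtains k l where "(D\<^sub>1 ^^ k) v = \<zero>" "(D\<^sub>2 ^^ l) v = \<zero>"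
  using nilpotent[OF assms] unfolding nilpotent_at_def by blast

lemma commutations:
  assumes "v \<in> carrier M"
  shows "D\<^sub>1 (D\<^sub>2 v) = D\<^sub>2 (D\<^sub>1 v)" "D\<^sub>1 (dd\<^sub>2 v) = dd\<^sub>2 (D\<^sub>1 v)"
    "D\<^sub>2 (dd\<^sub>1 v) = dd\<^sub>1 (D\<^sub>2 v)" "dd\<^sub>1 (dd\<^sub>2 v) = dd\<^sub>2 (dd\<^sub>1 v)"
  by (rule shifted_commute shifted_act_commute act_commute;
      simp add: vbracket_partials_d assms)+

definition kernel1 :: "'a set" where "kernel1 = {v \<in> carrier M. D\<^sub>1 v = \<zero>}"

lemma kernel1_ladder: "ladder (sub_vs M kernel1) D\<^sub>2 dd\<^sub>2"
proof -
  have s: "subspace M kernel1"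
    by (rule subspaceI) (auto simp: kernel1_def l1.D_add l1.D_scale)
  interpret K: complex_space "sub_vs M kernel1"
    by (rule sub_vs_complex_space[OF complex_space_axioms s])
  show ?thesis
    by unfold_locales
      (auto simp: kernel1_def commutations l2.D_add l2.d_add l2.D_scale l2.d_scale l2.D_d)
qed

text \<open>The ladder \<open>(D\<^sub>1, d\<^sub>1)\<close> reduces the claim to the kernel of \<open>D\<^sub>1\<close>, on which \<open>(D\<^sub>2, d\<^sub>2)\<close> is again a
  ladder because the two pairs commute.\<close>

lemma whittaker_induct [consumes 1, case_names gen add]:
  assumes v: "v \<in> carrier M"
    and gen: "\<And>a b w. w \<in> Wh M \<Longrightarrow> P ((dd\<^sub>1 ^^ a) ((dd\<^sub>2 ^^ b) w))"
    and add: "\<And>u v. u \<in> carrier M \<Longrightarrow> v \<in> carrier M \<Longrightarrow> P u \<Longrightarrow> P v \<Longrightarrow> P (u \<oplus> v)"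
  shows "P v"
proof -
  interpret K: ladder "sub_vs M kernel1" D\<^sub>2 dd\<^sub>2 by (rule kernel1_ladder)
  have *: "P ((dd\<^sub>1 ^^ a) u)" if u: "u \<in> carrier M" "D\<^sub>1 u = \<zero>" for a u
  proof -
    obtain l where l: "(D\<^sub>2 ^^ l) u = \<zero>" using nilpotent_powers[OF u(1)] by blast
    show ?thesis
    proof (rule K.ladder_induct[of u l "\<lambda>u. P ((dd\<^sub>1 ^^ a) u)"])
      fix n w assume "w \<in> carrier (sub_vs M kernel1)" "D\<^sub>2 w = \<zero>\<^bsub>sub_vs M kernel1\<^esub>"
      then show "P ((dd\<^sub>1 ^^ a) ((dd\<^sub>2 ^^ n) w))"
        by (intro gen) (simp add: kernel1_def Wh_iff)
    next
      fix u v assume "u \<in> carrier (sub_vs M kernel1)" "v \<in> carrier (sub_vs M kernel1)"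
        "P ((dd\<^sub>1 ^^ a) u)" "P ((dd\<^sub>1 ^^ a) v)"
      then show "P ((dd\<^sub>1 ^^ a) (u \<oplus>\<^bsub>sub_vs M kernel1\<^esub> v))"
        by (simp add: kernel1_def l1.dpow_add add)
    qed (use u l in \<open>simp_all add: kernel1_def\<close>)
  qed
  obtain k where k: "(D\<^sub>1 ^^ k) v = \<zero>" using nilpotent_powers[OF v] by blast
  show ?thesis by (rule l1.ladder_induct[of v k P, OF v k *]) (use add in auto)
qed

lemma Dpow_monomial:
  assumes w: "w \<in> Wh M"
  shows "(D\<^sub>1 ^^ k) ((D\<^sub>2 ^^ l) ((dd\<^sub>1 ^^ a) ((dd\<^sub>2 ^^ b) w))) =
    (D\<^sub>1 ^^ k) ((dd\<^sub>1 ^^ a) ((D\<^sub>2 ^^ l) ((dd\<^sub>2 ^^ b) w)))"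
  using Wh_carrier[OF w]
  by (subst funpow_commute_on[of "carrier M" D\<^sub>2 dd\<^sub>1]) (simp_all add: commutations)

lemma Dpow_monomial_same:
  assumes w: "w \<in> Wh M"
  shows "(D\<^sub>1 ^^ a) ((D\<^sub>2 ^^ b) ((dd\<^sub>1 ^^ a) ((dd\<^sub>2 ^^ b) w))) = (fact a * fact b) \<odot> w"
proof -
  have w': "w \<in> carrier M" "D\<^sub>1 w = \<zero>" "D\<^sub>2 w = \<zero>" using w by (simp_all add: Wh_iff)
  have "(D\<^sub>1 ^^ a) ((dd\<^sub>1 ^^ a) (fact b \<odot> w)) = fact a \<odot> (fact b \<odot> w)"
    using l1.Dpow_dpow[of "fact b \<odot> w" a] w' by (simp add: l1.D_scale)
  then show ?thesis
    unfolding Dpow_monomial[OF w] using l2.Dpow_dpow[OF w'(1,3), of b] w' by (simp add: scale_scale)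
qed

lemma Dpow_monomial_other:
  assumes w: "w \<in> Wh M" and "a < k \<or> b < l"
  shows "(D\<^sub>1 ^^ k) ((D\<^sub>2 ^^ l) ((dd\<^sub>1 ^^ a) ((dd\<^sub>2 ^^ b) w))) = \<zero>"
proof -
  have w': "w \<in> carrier M" "D\<^sub>1 w = \<zero>" "D\<^sub>2 w = \<zero>" using w by (simp_all add: Wh_iff)
  show ?thesis
  proof (cases "b < l")
    case True
    then show ?thesis
      unfolding Dpow_monomial[OF w] using l2.Dpow_dpow_greater[OF w'(1,3) True] by simp
  next
    case False
    define u where "u = (D\<^sub>2 ^^ l) ((dd\<^sub>2 ^^ b) w)"
    have "D\<^sub>1 ((D\<^sub>2 ^^ l) ((dd\<^sub>2 ^^ b) w)) = (D\<^sub>2 ^^ l) (D\<^sub>1 ((dd\<^sub>2 ^^ b) w))"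
      using funpow_commute_on[of "carrier M" D\<^sub>1 D\<^sub>2 "(dd\<^sub>2 ^^ b) w" 1 l] w' by (simp add: commutations)
    also have "D\<^sub>1 ((dd\<^sub>2 ^^ b) w) = (dd\<^sub>2 ^^ b) (D\<^sub>1 w)"
      using funpow_commute_on[of "carrier M" D\<^sub>1 dd\<^sub>2 w 1 b] w' by (simp add: commutations)
    finally have "D\<^sub>1 u = \<zero>" using w' by (simp add: u_def)
    moreover have "u \<in> carrier M" using w' by (simp add: u_def)
    moreover have "a < k" using assms(2) False by simp
    ultimately show ?thesis
      unfolding Dpow_monomial[OF w] u_def[symmetric] by (intro l1.Dpow_dpow_greater)
  qed
qed

text \<open>Among the exponents with nonzero coefficient, take one, \<open>(k, l)\<close>, of maximal total degree: then
  \<open>D\<^sub>1\<^sup>k D\<^sub>2\<^sup>l\<close> kills all other terms.\<close>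

lemma monomials_independent:
  assumes A: "finite A" and w: "\<And>m. m \<in> A \<Longrightarrow> w m \<in> Wh M"
    and sum: "(\<Oplus>m\<in>A. (dd\<^sub>1 ^^ fst m) ((dd\<^sub>2 ^^ snd m) (w m))) = \<zero>" and "m \<in> A"
  shows "w m = \<zero>"
proof (rule ccontr)
  assume "w m \<noteq> \<zero>"
  define B where "B = {m \<in> A. w m \<noteq> \<zero>}"
  have B: "finite B" "m \<in> B" using A \<open>m \<in> A\<close> \<open>w m \<noteq> \<zero>\<close> by (simp_all add: B_def)
  obtain n where n: "n \<in> B" and max: "\<And>p. p \<in> B \<Longrightarrow> fst p + snd p \<le> fst n + snd n"
  proof -
    let ?f = "\<lambda>p. fst p + snd p"
    have "Max (?f ` B) \<in> ?f ` B" using B by (intro Max_in) auto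
    then obtain n where "n \<in> B" "?f n = Max (?f ` B)" by auto
    then show thesis using B(1) by (intro that[of n]) auto
  qed
  define k where "k = fst n"
  define l where "l = snd n"
  define h where "h p = (dd\<^sub>1 ^^ fst p) ((dd\<^sub>2 ^^ snd p) (w p))" for p
  define \<Phi> where "\<Phi> v = (D\<^sub>1 ^^ k) ((D\<^sub>2 ^^ l) v)" for v
  have hc: "h p \<in> carrier M" if "p \<in> A" for p
    using Wh_carrier[OF w[OF that]] by (simp add: h_def)
  have \<Phi>: "\<Phi> \<zero> = \<zero>" "\<And>u v. u \<in> carrier M \<Longrightarrow> v \<in> carrier M \<Longrightarrow> \<Phi> (u \<oplus> v) = \<Phi> u \<oplus> \<Phi> v"
    "\<And>v. v \<in> carrier M \<Longrightarrow> \<Phi> v \<in> carrier M"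
    by (simp_all add: \<Phi>_def l1.Dpow_add l2.Dpow_add)
  have \<Phi>sum: "\<Phi> (\<Oplus>p\<in>C. h p) = (\<Oplus>p\<in>C. \<Phi> (h p))" if "C \<subseteq> A" for C
    using finite_subset[OF that A] that
  proof (induction C rule: finite_induct)
    case empty
    then show ?case by (simp add: \<Phi>)
  next
    case (insert p C)
    then have "h p \<in> carrier M" "h \<in> C \<rightarrow> carrier M" "(\<lambda>p. \<Phi> (h p)) \<in> C \<rightarrow> carrier M"
      using hc \<Phi>(3) by auto
    then show ?case using insert by (simp add: \<Phi>)
  qed
  have h0: "\<Phi> (h p) = \<zero>" if p: "p \<in> A" "p \<noteq> n" for p
  proof (cases "p \<in> B")
    case True
    have "fst p < k \<or> snd p < l"
      using max[OF True] p(2) by (auto simp: k_def l_def prod_eq_iff)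
    then show ?thesis
      unfolding \<Phi>_def h_def by (rule Dpow_monomial_other[OF w[OF p(1)]])
  next
    case False
    then have "h p = \<zero>" using p by (simp add: B_def h_def)
    then show ?thesis by (simp add: \<Phi>)
  qed
  have nA: "n \<in> A" using n by (simp add: B_def)
  have "\<zero> = (\<Oplus>p\<in>A. \<Phi> (h p))"
    using \<Phi>sum[OF subset_refl] sum by (simp add: \<Phi> h_def)
  also have "\<dots> = (\<Oplus>p\<in>A. if n = p then \<Phi> (h p) else \<zero>)"
    by (rule M.finsum_cong') (use h0 hc \<Phi>(3) in auto)
  also have "\<dots> = \<Phi> (h n)"
    by (rule M.finsum_singleton[OF nA A]) (use hc \<Phi>(3) in auto)
  also have "\<dots> = (fact k * fact l) \<odot> w n"
    unfolding \<Phi>_def h_def k_def l_def by (rule Dpow_monomial_same[OF w[OF nA]])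
  finally have "w n = \<zero>"
    using scale_eq_zero_iff[OF Wh_carrier[OF w[OF nA]], of "fact k * fact l"] by simp
  then show False using n by (simp add: B_def)
qed

text \<open>All monomials except the trivial one lie in \<open>d\<^sub>1 M + d\<^sub>2 M\<close>.\<close>

lemma coinvariants_decomp:
  assumes "v \<in> carrier M"
  obtains w p q where "w \<in> Wh M" "p \<in> carrier M" "q \<in> carrier M" "v = w \<oplus> (dd\<^sub>1 p \<oplus> dd\<^sub>2 q)"
proof -
  have "\<exists>w\<in>Wh M. \<exists>p\<in>carrier M. \<exists>q\<in>carrier M. v = w \<oplus> (dd\<^sub>1 p \<oplus> dd\<^sub>2 q)"
    using assms
  proof (induction v rule: whittaker_induct)
    case (gen a b w)
    have w: "w \<in> carrier M" using gen by (rule Wh_carrier)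
    have z: "\<zero> \<in> Wh M" by (simp add: Wh_iff)
    consider "a = 0" "b = 0" | b' where "a = 0" "b = Suc b'" | a' where "a = Suc a'"
      by (metis not0_implies_Suc)
    then show ?case
    proof cases
      case 1
      then show ?thesis
        using gen w by (intro bexI[of _ w] bexI[of _ \<zero>]) simp_all
    next
      case 2
      then show ?thesis
        using z w by (intro bexI[of _ \<zero>] bexI[of _ "(dd\<^sub>2 ^^ b') w"]) simp_all
    next
      case 3
      then show ?thesis
        using z w
        by (intro bexI[of _ \<zero>] bexI[of _ "(dd\<^sub>1 ^^ a') ((dd\<^sub>2 ^^ b) w)"] bexI[of _ \<zero>]) simp_all
    qed
  next
    case (add u v)
    then obtain w p q w' p' q' where *: "w \<in> Wh M" "p \<in> carrier M" "q \<in> carrier M"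
      "u = w \<oplus> (dd\<^sub>1 p \<oplus> dd\<^sub>2 q)" "w' \<in> Wh M" "p' \<in> carrier M" "q' \<in> carrier M"
      "v = w' \<oplus> (dd\<^sub>1 p' \<oplus> dd\<^sub>2 q')" by blast
    have "u \<oplus> v = (w \<oplus> w') \<oplus> (dd\<^sub>1 (p \<oplus> p') \<oplus> dd\<^sub>2 (q \<oplus> q'))"
      using * Wh_carrier[OF *(1)] Wh_carrier[OF *(5)] by (simp add: act_add M.a_ac)
    moreover have "w \<oplus> w' \<in> Wh M"
      using Wh_subspace *(1,5) by (simp add: subspace_def)
    ultimately show ?case
      using *(2,3,6,7) by (intro bexI[of _ "w \<oplus> w'"] bexI[of _ "p \<oplus> p'"] bexI[of _ "q \<oplus> q'"]) simp_all
  qed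
  then show thesis using that by blast
qed

text \<open>The pair \<open>(p, q)\<close> may be replaced by \<open>(p + d\<^sub>2 z, q - d\<^sub>1 z)\<close>, and thus \<open>q\<close> by a vector \<open>r\<close> in the
  kernel of \<open>D\<^sub>1\<close>. Applying \<open>D\<^sub>1\<close> to \<open>w = d\<^sub>1 y + d\<^sub>2 r\<close> then forces \<open>y = 0\<close>, and applying \<open>D\<^sub>2\<close> forces
  \<open>r = 0\<close>.\<close>

lemma coinvariants_Wh_trivial:
  assumes w: "w \<in> Wh M" and p: "p \<in> carrier M" and q: "q \<in> carrier M"
    and eq: "w = dd\<^sub>1 p \<oplus> dd\<^sub>2 q"
  shows "w = \<zero>"
proof -
  have w': "w \<in> carrier M" "D\<^sub>1 w = \<zero>" "D\<^sub>2 w = \<zero>" using w by (simp_all add: Wh_iff)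
  obtain k where k: "(D\<^sub>1 ^^ k) q = \<zero>" using nilpotent_powers[OF q] by blast
  have "\<exists>r\<in>carrier M. \<exists>z\<in>carrier M. D\<^sub>1 r = \<zero> \<and> q = r \<oplus> dd\<^sub>1 z"
  proof (rule l1.ladder_induct[OF q k])
    fix n u assume u: "u \<in> carrier M" "D\<^sub>1 u = \<zero>"
    show "\<exists>r\<in>carrier M. \<exists>z\<in>carrier M. D\<^sub>1 r = \<zero> \<and> (dd\<^sub>1 ^^ n) u = r \<oplus> dd\<^sub>1 z"
    proof (cases n)
      case 0
      then show ?thesis using u by (intro bexI[of _ u] bexI[of _ \<zero>]) simp_all
    next
      case (Suc m)
      then show ?thesis using u by (intro bexI[of _ \<zero>] bexI[of _ "(dd\<^sub>1 ^^ m) u"]) simp_all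
    qed
  next
    fix u v assume "\<exists>r\<in>carrier M. \<exists>z\<in>carrier M. D\<^sub>1 r = \<zero> \<and> u = r \<oplus> dd\<^sub>1 z"
      "\<exists>r\<in>carrier M. \<exists>z\<in>carrier M. D\<^sub>1 r = \<zero> \<and> v = r \<oplus> dd\<^sub>1 z"
    then obtain r z r' z' where *: "r \<in> carrier M" "z \<in> carrier M" "D\<^sub>1 r = \<zero>" "u = r \<oplus> dd\<^sub>1 z"
      "r' \<in> carrier M" "z' \<in> carrier M" "D\<^sub>1 r' = \<zero>" "v = r' \<oplus> dd\<^sub>1 z'" by blast
    then have "u \<oplus> v = (r \<oplus> r') \<oplus> dd\<^sub>1 (z \<oplus> z')" by (simp add: act_add M.a_ac)
    then show "\<exists>r\<in>carrier M. \<exists>z\<in>carrier M. D\<^sub>1 r = \<zero> \<and> u \<oplus> v = r \<oplus> dd\<^sub>1 z"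
      using * by (intro bexI[of _ "r \<oplus> r'"] bexI[of _ "z \<oplus> z'"]) (simp_all add: l1.D_add)
  qed
  then obtain r z where r: "r \<in> carrier M" "z \<in> carrier M" "D\<^sub>1 r = \<zero>" "q = r \<oplus> dd\<^sub>1 z" by blast
  define y where "y = p \<oplus> dd\<^sub>2 z"
  have y: "y \<in> carrier M" using p r by (simp add: y_def)
  have wy: "w = dd\<^sub>1 y \<oplus> dd\<^sub>2 r"
    using p r eq by (simp add: y_def act_add commutations M.a_ac)
  have "D\<^sub>1 w = D\<^sub>1 (dd\<^sub>1 y) \<oplus> D\<^sub>1 (dd\<^sub>2 r)"
    unfolding wy using y r by (simp add: l1.D_add)
  then have "D\<^sub>1 (dd\<^sub>1 y) = \<zero>"
    using w' r y by (simp add: commutations)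
  moreover obtain k' where "(D\<^sub>1 ^^ k') y = \<zero>" using nilpotent_powers[OF y] by blast
  ultimately have "y = \<zero>" using l1.d_kernel_trivial[OF y] by blast
  then have wr: "w = dd\<^sub>2 r" using wy r by simp
  obtain l where "(D\<^sub>2 ^^ l) r = \<zero>" using nilpotent_powers[OF r(1)] by blast
  then have "r = \<zero>" using l2.d_kernel_trivial[OF r(1)] w' wr by simp
  then show ?thesis using wr by simp
qed

end

section \<open>The projection to the Whittaker vectors and the category Omega\<close>

text \<open>The projection along \<open>d\<^sub>1 M + d\<^sub>2 M\<close>. As this complement is expressed by the action alone, the
  projection is natural in \<open>M\<close>.\<close>

definition proj :: "'m lie_module \<Rightarrow> 'm \<Rightarrow> 'm" where
  "proj M v = (THE w. w \<in> Wh M \<and> (\<exists>p\<in>carrier M. \<exists>q\<in>carrier M.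
     v = w \<oplus>\<^bsub>M\<^esub> (act M d1 p \<oplus>\<^bsub>M\<^esub> act M d2 q)))"

context whittaker_mod
begin

lemma proj_eqI:
  assumes w: "w \<in> Wh M" and p: "p \<in> carrier M" "q \<in> carrier M"
    and v: "v = w \<oplus> (dd\<^sub>1 p \<oplus> dd\<^sub>2 q)"
  shows "proj M v = w"
  unfolding proj_def
proof (rule the_equality)
  show "w \<in> Wh M \<and> (\<exists>p\<in>carrier M. \<exists>q\<in>carrier M. v = w \<oplus> (dd\<^sub>1 p \<oplus> dd\<^sub>2 q))"
    using assms by blast
next
  fix w' assume "w' \<in> Wh M \<and> (\<exists>p\<in>carrier M. \<exists>q\<in>carrier M. v = w' \<oplus> (dd\<^sub>1 p \<oplus> dd\<^sub>2 q))"
  then obtain p' q' where *: "w' \<in> Wh M" "p' \<in> carrier M" "q' \<in> carrier M"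
    "v = w' \<oplus> (dd\<^sub>1 p' \<oplus> dd\<^sub>2 q')" by blast
  have c: "w \<in> carrier M" "w' \<in> carrier M" using w *(1) by (simp_all add: Wh_carrier)
  define x where "x = dd\<^sub>1 p \<oplus> dd\<^sub>2 q"
  define x' where "x' = dd\<^sub>1 p' \<oplus> dd\<^sub>2 q'"
  have x: "x \<in> carrier M" "x' \<in> carrier M" using p * by (simp_all add: x_def x'_def)
  have "w' \<oplus> x' = w \<oplus> x" using v *(4) by (simp add: x_def x'_def)
  then have "(w' \<oplus> x') \<ominus> (w \<oplus> x') = (w \<oplus> x) \<ominus> (w \<oplus> x')" by simp
  then have "w' \<ominus> w = x \<ominus> x'"
    using c x unfolding add_minus_add[OF c(2) x(2) c(1) x(2)] add_minus_add[OF c(1) x(1) c(1) x(2)]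
    by (simp add: M.minus_eq M.r_neg)
  also have "\<dots> = dd\<^sub>1 (p \<ominus> p') \<oplus> dd\<^sub>2 (q \<ominus> q')"
    using p *(2,3) by (simp add: x_def x'_def minus_scale act_add act_scale scale_add_right M.a_ac)
  finally have "w' \<ominus> w = dd\<^sub>1 (p \<ominus> p') \<oplus> dd\<^sub>2 (q \<ominus> q')" .
  moreover have "w' \<ominus> w \<in> Wh M"
    using Wh_subspace w *(1) c by (simp add: minus_scale subspace_def)
  ultimately have "w' \<ominus> w = \<zero>"
    using p *(2,3) by (intro coinvariants_Wh_trivial[of _ "p \<ominus> p'" "q \<ominus> q'"]) simp_all
  then show "w' = w" using c by (simp add: minus_eq_zero_iff)
qed

lemma proj_decomp:
  assumes "v \<in> carrier M"
  obtains p q where "proj M v \<in> Wh M" "p \<in> carrier M" "q \<in> carrier M"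
    "v = proj M v \<oplus> (dd\<^sub>1 p \<oplus> dd\<^sub>2 q)"
  using coinvariants_decomp[OF assms] proj_eqI by metis

lemma proj_Wh: "w \<in> Wh M \<Longrightarrow> proj M w = w"
  using Wh_carrier[of w] by (intro proj_eqI[of _ \<zero> \<zero>]) simp_all

lemma proj_add:
  assumes v: "u \<in> carrier M" "v \<in> carrier M"
  shows "proj M (u \<oplus> v) = proj M u \<oplus> proj M v"
proof -
  obtain p q where *: "proj M u \<in> Wh M" "p \<in> carrier M" "q \<in> carrier M"
    "u = proj M u \<oplus> (dd\<^sub>1 p \<oplus> dd\<^sub>2 q)" using proj_decomp[OF v(1)] .
  obtain p' q' where **: "proj M v \<in> Wh M" "p' \<in> carrier M" "q' \<in> carrier M"
    "v = proj M v \<oplus> (dd\<^sub>1 p' \<oplus> dd\<^sub>2 q')" using proj_decomp[OF v(2)] .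
  have "proj M u \<oplus> proj M v \<in> Wh M"
    using Wh_subspace *(1) **(1) by (simp add: subspace_def)
  moreover have "u \<oplus> v = (proj M u \<oplus> proj M v) \<oplus> (dd\<^sub>1 (p \<oplus> p') \<oplus> dd\<^sub>2 (q \<oplus> q'))"
    by (subst *(4), subst **(4))
      (use *(2,3) **(2,3) Wh_carrier[OF *(1)] Wh_carrier[OF **(1)] in \<open>simp add: act_add M.a_ac\<close>)
  ultimately show ?thesis
    using *(2,3) **(2,3) by (intro proj_eqI[of _ "p \<oplus> p'" "q \<oplus> q'"]) simp_all
qed

text \<open>The span of the finitely many nonzero vectors among the \<open>D\<^sub>1\<^sup>a D\<^sub>2\<^sup>b v\<close>.\<close>

lemma fin_dim_stable_subspace:
  assumes v: "v \<in> carrier M"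
  obtains W where "v \<in> W" "subspace M W" "fin_dim (sub_vs M W)"
    "\<And>w. w \<in> W \<Longrightarrow> D\<^sub>1 w \<in> W" "\<And>w. w \<in> W \<Longrightarrow> D\<^sub>2 w \<in> W"
proof -
  obtain k l where kl: "(D\<^sub>1 ^^ k) v = \<zero>" "(D\<^sub>2 ^^ l) v = \<zero>" using nilpotent_powers[OF v] .
  define g where "g = (\<lambda>(a, b). (D\<^sub>1 ^^ a) ((D\<^sub>2 ^^ b) v))"
  define A where "A = g ` ({..k} \<times> {..l})"
  define W where "W = \<Inter>{S. subspace M S \<and> A \<subseteq> S}"
  have A: "finite A" "A \<subseteq> carrier M" using v by (auto simp: A_def g_def)
  note W = fin_dim_span_of_finite[OF complex_space_axioms A W_def]
  have swap: "(D\<^sub>1 ^^ a) ((D\<^sub>2 ^^ b) v) = (D\<^sub>2 ^^ b) ((D\<^sub>1 ^^ a) v)" for a b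
    by (rule funpow_commute_on[of "carrier M"]) (simp_all add: v commutations(1))
  have gW: "g (a, b) \<in> W" for a b
  proof -
    consider "a \<le> k" "b \<le> l" | "k < a" | "l < b" by linarith
    then show ?thesis
    proof cases
      case 1
      then have "g (a, b) \<in> A" unfolding A_def by (intro imageI) simp
      then show ?thesis using W(2) by blast
    next
      case 2
      then have "g (a, b) = \<zero>"
        using l1.Dpow_mono[OF kl(1), of a] by (simp add: g_def swap)
      then show ?thesis using W(1) by (simp add: subspace_def)
    next
      case 3
      then have "g (a, b) = \<zero>"
        using l2.Dpow_mono[OF kl(2), of b] by (simp add: g_def)
      then show ?thesis using W(1) by (simp add: subspace_def)
    qed
  qed
  have "subspace M {w \<in> W. D\<^sub>1 w \<in> W \<and> D\<^sub>2 w \<in> W}"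
    using W(1) unfolding subspace_def
    by (auto simp: l1.D_add l2.D_add l1.D_scale l2.D_scale subset_iff)
  moreover have "A \<subseteq> {w \<in> W. D\<^sub>1 w \<in> W \<and> D\<^sub>2 w \<in> W}"
  proof
    fix x assume "x \<in> A"
    then obtain a b where x: "x = g (a, b)" by (auto simp: A_def)
    have "D\<^sub>1 x = g (Suc a, b)" by (simp add: x g_def)
    moreover have "D\<^sub>2 x = g (a, Suc b)" by (simp add: x g_def swap)
    ultimately show "x \<in> {w \<in> W. D\<^sub>1 w \<in> W \<and> D\<^sub>2 w \<in> W}" using gW x by simp
  qed
  ultimately have "W \<subseteq> {w \<in> W. D\<^sub>1 w \<in> W \<and> D\<^sub>2 w \<in> W}"
    by (subst (1) W_def) blast
  moreover have "v \<in> W" using gW[of 0 0] by (simp add: g_def)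
  ultimately show thesis using that W by blast
qed

lemma Delta2_decomp:
  assumes "x \<in> Delta2"
  obtains a b where "x = vscale a partial1 + vscale b partial2" "phi1 x = a + b"
    "\<And>v. v \<in> carrier M \<Longrightarrow> act M x v \<ominus> phi1 x \<odot> v = a \<odot> D\<^sub>1 v \<oplus> b \<odot> D\<^sub>2 v"
    "\<And>v. v \<in> carrier M \<Longrightarrow> act M x v = a \<odot> (D\<^sub>1 v \<oplus> v) \<oplus> b \<odot> (D\<^sub>2 v \<oplus> v)"
proof -
  obtain a b where x: "x = vscale a partial1 + vscale b partial2"
    using assms unfolding Delta2_def by auto
  have phi: "phi1 x = a + b" by (simp add: x phi1_add phi1_vscale phi1_partials)
  have act: "act M x v = a \<odot> (D\<^sub>1 v \<oplus> v) \<oplus> b \<odot> (D\<^sub>2 v \<oplus> v)" if "v \<in> carrier M" for v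
    unfolding x using that
    by (simp add: act_plus S2bar_vscale act_vscale
        act_eq_shifted[of partial1, symmetric] act_eq_shifted[of partial2, symmetric])
  have "act M x v \<ominus> phi1 x \<odot> v = a \<odot> D\<^sub>1 v \<oplus> b \<odot> D\<^sub>2 v" if v: "v \<in> carrier M" for v
  proof -
    have "act M x v = (a \<odot> D\<^sub>1 v \<oplus> b \<odot> D\<^sub>2 v) \<oplus> phi1 x \<odot> v"
      unfolding act[OF v] phi using v by (simp add: scale_add_left scale_add_right M.a_ac)
    then show ?thesis using v by (simp add: add_minus_cancel)
  qed
  from that[OF x phi this act] show thesis .
qed

lemma locally_finite_Delta2: "locally_finite Delta2 M"
  unfolding locally_finite_def
proof
  fix v assume "v \<in> carrier M"
  then obtain W where W: "v \<in> W" "subspace M W" "fin_dim (sub_vs M W)"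
    "\<And>w. w \<in> W \<Longrightarrow> D\<^sub>1 w \<in> W" "\<And>w. w \<in> W \<Longrightarrow> D\<^sub>2 w \<in> W"
    using fin_dim_stable_subspace by blast
  have "act M x w \<in> W" if x: "x \<in> Delta2" and w: "w \<in> W" for x w
  proof -
    have "w \<in> carrier M" using W(2) w by (auto simp: subspace_def)
    then obtain a b where "act M x w = a \<odot> (D\<^sub>1 w \<oplus> w) \<oplus> b \<odot> (D\<^sub>2 w \<oplus> w)"
      using Delta2_decomp[OF x] by metis
    then show ?thesis
      using W(2) W(4,5)[OF w] w by (simp add: subspace_def)
  qed
  then show "\<exists>W. v \<in> W \<and> W \<subseteq> carrier M \<and> fin_dim (sub_vs M W) \<and> (\<forall>x\<in>Delta2. \<forall>w\<in>W. act M x w \<in> W)"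
    using W by (auto simp: subspace_def)
qed

text \<open>The operator \<open>x - \<phi>\<^sub>1(x)\<close> is \<open>a D\<^sub>1 + b D\<^sub>2\<close>. If \<open>D\<^sub>1\<^sup>k v = D\<^sub>2\<^sup>l v = 0\<close>, its power \<open>k + l\<close> kills \<open>v\<close>, since
  each application of \<open>D\<^sub>1\<close> or \<open>D\<^sub>2\<close> lowers one of the two exponents.\<close>

lemma phi1_generalized_eigenvectors:
  assumes v: "v \<in> carrier M" and x: "x \<in> Delta2"
  shows "\<exists>k::nat. ((\<lambda>w. act M x w \<ominus> phi1 x \<odot> w) ^^ k) v = \<zero>"
proof -
  obtain a b where ab: "\<And>v. v \<in> carrier M \<Longrightarrow> act M x v \<ominus> phi1 x \<odot> v = a \<odot> D\<^sub>1 v \<oplus> b \<odot> D\<^sub>2 v"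
    using Delta2_decomp[OF x] by metis
  define E where "E = (\<lambda>w. act M x w \<ominus> phi1 x \<odot> w)"
  have E: "E v = a \<odot> D\<^sub>1 v \<oplus> b \<odot> D\<^sub>2 v" if "v \<in> carrier M" for v
    using ab[OF that] by (simp add: E_def)
  have Ec: "E v \<in> carrier M" if "v \<in> carrier M" for v
    using that by (simp add: E)
  have Epc: "(E ^^ n) v \<in> carrier M" if "v \<in> carrier M" for v n
    using that by (induction n) (auto simp: Ec)
  have Elin: "E (c \<odot> v \<oplus> d \<odot> w) = c \<odot> E v \<oplus> d \<odot> E w" if "v \<in> carrier M" "w \<in> carrier M" for v w c d
    using that by (simp add: E l1.D_add l2.D_add l1.D_scale l2.D_scale scale_add_right scale_scale
        M.a_ac mult.commute)
  have Eplin: "(E ^^ n) (c \<odot> v \<oplus> d \<odot> w) = c \<odot> (E ^^ n) v \<oplus> d \<odot> (E ^^ n) w"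
    if "v \<in> carrier M" "w \<in> carrier M" for v w c d n
    using that by (induction n) (simp_all add: Elin Epc)
  have E0: "(E ^^ n) \<zero> = \<zero>" for n
    by (induction n) (simp_all add: E)
  have "(E ^^ n) v = \<zero>" if "n = k + l" "v \<in> carrier M" "(D\<^sub>1 ^^ k) v = \<zero>" "(D\<^sub>2 ^^ l) v = \<zero>" for n k l v
    using that
  proof (induction n arbitrary: k l v)
    case 0
    then show ?case by simp
  next
    case (Suc n)
    show ?case
    proof (cases "k = 0 \<or> l = 0")
      case True
      then have "v = \<zero>" using Suc.prems by auto
      then show ?thesis by (simp only: E0)
    next
      case False
      then obtain k' l' where kl: "k = Suc k'" "l = Suc l'" by (metis not0_implies_Suc)
      have 1: "(D\<^sub>1 ^^ k) (D\<^sub>2 v) = D\<^sub>2 ((D\<^sub>1 ^^ k) v)"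
        using funpow_commute_on[of "carrier M" D\<^sub>1 D\<^sub>2 v k 1] Suc.prems(2) by (simp add: commutations(1))
      have 2: "(D\<^sub>2 ^^ l) (D\<^sub>1 v) = D\<^sub>1 ((D\<^sub>2 ^^ l) v)"
        using funpow_commute_on[of "carrier M" D\<^sub>1 D\<^sub>2 v 1 l] Suc.prems(2) by (simp add: commutations(1))
      have "(E ^^ n) (D\<^sub>1 v) = \<zero>"
        using Suc.prems kl 2 by (intro Suc.IH[of k' l]) (simp_all add: funpow_swap1)
      moreover have "(E ^^ n) (D\<^sub>2 v) = \<zero>"
        using Suc.prems kl 1 by (intro Suc.IH[of k l']) (simp_all add: funpow_swap1)
      ultimately have "(E ^^ n) (E v) = \<zero>"
        using Suc.prems(2) by (simp add: E Eplin)
      then show ?thesis by (simp add: funpow_swap1)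
    qed
  qed
  moreover obtain k l where "(D\<^sub>1 ^^ k) v = \<zero>" "(D\<^sub>2 ^^ l) v = \<zero>" using nilpotent_powers[OF v] .
  ultimately show ?thesis using v unfolding E_def by blast
qed

end

lemma Omega_iff: "M \<in> Ob Omega \<longleftrightarrow> whittaker_mod M \<and> fin_dim (sub_vs M (Wh M))"
proof
  assume "whittaker_mod M \<and> fin_dim (sub_vs M (Wh M))"
  then interpret whittaker_mod M by blast
  show "M \<in> Ob Omega"
    using \<open>whittaker_mod M \<and> fin_dim (sub_vs M (Wh M))\<close> is_lie_module locally_finite_Delta2
      phi1_generalized_eigenvectors by (simp add: Omega_def)
next
  assume M: "M \<in> Ob Omega"
  then interpret S2bar_mod M
    by unfold_locales (simp add: Omega_def)
  have "nilpotent_at M x v" if v: "v \<in> carrier M" and x: "x \<in> Delta2" "phi1 x = 1" for x v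
  proof -
    define f where "f = (\<lambda>w. act M x w \<ominus>\<^bsub>M\<^esub> phi1 x \<odot>\<^bsub>M\<^esub> w)"
    have xS: "x \<in> S2bar" using x Delta2_subset_S2bar by blast
    obtain k :: nat where k: "(f ^^ k) v = \<zero>\<^bsub>M\<^esub>"
      using M v x(1) unfolding f_def Omega_def by auto
    have "(f ^^ n) v = (shifted M x ^^ n) v" for n
      by (induction n) (simp_all add: f_def x shifted_def xS v flip: shifted_def)
    then show ?thesis using k unfolding nilpotent_at_def by auto
  qed
  then have "whittaker_mod M"
    by unfold_locales (simp_all add: partials_in_Delta2 phi1_partials)
  then show "whittaker_mod M \<and> fin_dim (sub_vs M (Wh M))"
    using M by (simp add: Omega_def)
qed

lemma lie_hom_shifted:
  assumes M: "S2bar_mod M" and N: "S2bar_mod N" and f: "f \<in> lie_hom S2bar M N"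
    and x: "x \<in> S2bar" and v: "v \<in> carrier M"
  shows "f (shifted M x v) = shifted N x (f v)"
proof -
  interpret M: S2bar_mod M by fact
  interpret N: S2bar_mod N by fact
  show ?thesis
    using x v lie_homD(2)[OF f v]
    by (simp add: shifted_def M.minus_scale N.minus_scale lie_homD(3,4,5)[OF f])
qed

lemma lie_hom_Wh: "f \<in> lie_hom S2bar M N \<Longrightarrow> w \<in> Wh M \<Longrightarrow> f w \<in> Wh N"
  using lie_homD(2)[of f S2bar M N w] lie_homD(5)[of f S2bar M N partial1 w]
    lie_homD(5)[of f S2bar M N partial2 w]
  by (simp add: Wh_def)

lemma lie_hom_proj:
  assumes M: "whittaker_mod M" and N: "whittaker_mod N" and f: "f \<in> lie_hom S2bar M N"
    and v: "v \<in> carrier M"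
  shows "f (proj M v) = proj N (f v)"
proof -
  interpret M: whittaker_mod M by fact
  interpret N: whittaker_mod N by fact
  obtain p q where *: "proj M v \<in> Wh M" "p \<in> carrier M" "q \<in> carrier M"
    "v = proj M v \<oplus>\<^bsub>M\<^esub> (act M d1 p \<oplus>\<^bsub>M\<^esub> act M d2 q)" using M.proj_decomp[OF v] .
  have "f v = f (proj M v) \<oplus>\<^bsub>N\<^esub> (act N d1 (f p) \<oplus>\<^bsub>N\<^esub> act N d2 (f q))"
    using *(2,3) M.Wh_carrier[OF *(1)]
    by (subst *(4)) (simp add: lie_homD(3,5)[OF f])
  then show ?thesis
    using *(2,3) lie_hom_Wh[OF f *(1)] lie_homD(2)[OF f]
    by (intro N.proj_eqI[symmetric, of _ "f p" "f q"]) simp_all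
qed

text \<open>A nonzero vector of the kernel could be moved by \<open>D\<^sub>1\<close> and \<open>D\<^sub>2\<close> to a nonzero Whittaker vector of
  the kernel.\<close>

lemma lie_hom_injective_of_Wh:
  assumes M: "whittaker_mod M" and N: "whittaker_mod N" and f: "f \<in> lie_hom S2bar M N"
    and Wh: "\<And>w. w \<in> Wh M \<Longrightarrow> f w = \<zero>\<^bsub>N\<^esub> \<Longrightarrow> w = \<zero>\<^bsub>M\<^esub>"
  shows "inj_on f (carrier M)"
proof -
  interpret M: whittaker_mod M by fact
  interpret N: whittaker_mod N by fact
  have f0: "f \<zero>\<^bsub>M\<^esub> = \<zero>\<^bsub>N\<^esub>"
    by (rule lie_hom_zero[OF M.lie_mod_axioms N.lie_mod_axioms f])
  have "v = \<zero>\<^bsub>M\<^esub>" if "n = k + l" "v \<in> carrier M" "(M.D\<^sub>1 ^^ k) v = \<zero>\<^bsub>M\<^esub>" "(M.D\<^sub>2 ^^ l) v = \<zero>\<^bsub>M\<^esub>"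
    "f v = \<zero>\<^bsub>N\<^esub>" for n k l v
    using that
  proof (induction n arbitrary: k l v)
    case 0
    then show ?case by simp
  next
    case (Suc n)
    show ?case
    proof (cases "k = 0 \<or> l = 0")
      case True
      then show ?thesis using Suc.prems by auto
    next
      case False
      then obtain k' l' where kl: "k = Suc k'" "l = Suc l'" by (metis not0_implies_Suc)
      have 1: "(M.D\<^sub>1 ^^ k) (M.D\<^sub>2 v) = M.D\<^sub>2 ((M.D\<^sub>1 ^^ k) v)"
        using funpow_commute_on[of "carrier M" M.D\<^sub>1 M.D\<^sub>2 v k 1] Suc.prems(2)
        by (simp add: M.commutations(1))
      have 2: "(M.D\<^sub>2 ^^ l) (M.D\<^sub>1 v) = M.D\<^sub>1 ((M.D\<^sub>2 ^^ l) v)"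
        using funpow_commute_on[of "carrier M" M.D\<^sub>1 M.D\<^sub>2 v 1 l] Suc.prems(2)
        by (simp add: M.commutations(1))
      have fD: "f (shifted M x v) = \<zero>\<^bsub>N\<^esub>" if "x \<in> S2bar" for x
        using lie_hom_shifted[OF M.S2bar_mod_axioms N.S2bar_mod_axioms f that Suc.prems(2)]
          N.shifted_zero[OF that, of 1] Suc.prems(5) by simp
      have a: "(M.D\<^sub>1 ^^ k') (M.D\<^sub>1 v) = \<zero>\<^bsub>M\<^esub>" "(M.D\<^sub>2 ^^ l') (M.D\<^sub>2 v) = \<zero>\<^bsub>M\<^esub>"
        using Suc.prems(3,4) unfolding kl by (simp_all add: funpow_swap1)
      have b: "(M.D\<^sub>2 ^^ l) (M.D\<^sub>1 v) = \<zero>\<^bsub>M\<^esub>" "(M.D\<^sub>1 ^^ k) (M.D\<^sub>2 v) = \<zero>\<^bsub>M\<^esub>"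
        unfolding 1 2 Suc.prems(3,4) by simp_all
      have "M.D\<^sub>1 v = \<zero>\<^bsub>M\<^esub>"
        by (rule Suc.IH[of k' l, OF _ _ a(1) b(1) fD]) (use Suc.prems(1,2) kl in simp_all)
      moreover have "M.D\<^sub>2 v = \<zero>\<^bsub>M\<^esub>"
        by (rule Suc.IH[of k l', OF _ _ b(2) a(2) fD]) (use Suc.prems(1,2) kl in simp_all)
      ultimately have "v \<in> Wh M" using Suc.prems(2) by (simp add: M.Wh_iff)
      then show ?thesis using Wh Suc.prems(5) by blast
    qed
  qed
  note * = this
  have ker: "v = \<zero>\<^bsub>M\<^esub>" if v: "v \<in> carrier M" "f v = \<zero>\<^bsub>N\<^esub>" for v
  proof -
    obtain k l where "(M.D\<^sub>1 ^^ k) v = \<zero>\<^bsub>M\<^esub>" "(M.D\<^sub>2 ^^ l) v = \<zero>\<^bsub>M\<^esub>"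
      using M.nilpotent_powers[OF v(1)] .
    then show ?thesis by (rule *[OF refl v(1) _ _ v(2)])
  qed
  show ?thesis
  proof (rule inj_onI)
    fix u v assume *: "u \<in> carrier M" "v \<in> carrier M" "f u = f v"
    have "f (u \<ominus>\<^bsub>M\<^esub> v) = \<zero>\<^bsub>N\<^esub>"
      using * lie_homD(2)[OF f *(2)]
      by (simp add: M.minus_scale lie_homD(3,4)[OF f] flip: N.minus_scale)
        (simp add: N.minus_eq_zero_iff)
    then have "u \<ominus>\<^bsub>M\<^esub> v = \<zero>\<^bsub>M\<^esub>" using ker * by simp
    then show "u = v" using * by (simp add: M.minus_eq_zero_iff)
  qed
qed

section \<open>The universal property of the induced module\<close>

locale lie_alg_mod = vfield_algebra L + lie_mod L M for L and M :: "'m lie_module" (structure)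
begin

lemma free_act_diff:
  assumes "f \<in> carrier (free_assoc L)" "g \<in> carrier (free_assoc L)" "v \<in> carrier M"
  shows "free_act M (f - g) v = free_act M f v \<ominus> free_act M g v"
  using free_act_add[OF assms(1) free_assoc_closed(3)[OF assms(2,2)] assms(3)] free_act_minus[OF assms(2,3)]
  by (simp add: M.minus_eq)

lemma env_ideal_annihilates:
  assumes "f \<in> env_ideal L" "v \<in> carrier M"
  shows "free_act M f v = \<zero>"
proof -
  let ?J = "{f \<in> carrier (free_assoc L). \<forall>v\<in>carrier M. free_act M f v = \<zero>}"
  have "env_rels \<subseteq> ?J"
  proof
    fix f assume f: "f \<in> env_rels"
    have "free_act M f v = \<zero>" if v: "v \<in> carrier M" for v
    proof -
      have l: "letter x \<in> carrier (free_assoc L)" if "x \<in> L" for x using that by simp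
      have lm: "letter x * letter y \<in> carrier (free_assoc L)" if "x \<in> L" "y \<in> L" for x y
        using that by (intro free_assoc_closed) simp_all
      have lc: "free_const c * letter x \<in> carrier (free_assoc L)" if "x \<in> L" for x c
        using that by (intro free_assoc_closed free_assoc_const) simp_all
      from f consider x y where "f = letter (x + y) - letter x - letter y" "x \<in> L" "y \<in> L"
        | c x where "f = letter (vscale c x) - free_const c * letter x" "x \<in> L"
        | x y where "f = letter x * letter y - letter y * letter x - letter (vbracket x y)" "x \<in> L" "y \<in> L"
        unfolding env_rels_def by blast
      then show ?thesis
      proof cases
        case (1 x y)
        have "free_act M f v = (act M x v \<oplus> act M y v) \<ominus> act M x v \<ominus> act M y v"
          unfolding 1(1) using 1(2,3) v
          by (simp only: free_act_diff l add_closed free_assoc_closed free_act_letter act_plus)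
        also have "\<dots> = (act M y v \<oplus> act M x v) \<ominus> act M x v \<ominus> act M y v"
          using 1(2,3) v by (simp add: M.a_comm)
        also have "\<dots> = act M y v \<ominus> act M y v"
          using 1(2,3) v by (simp only: add_minus_cancel act_closed)
        also have "\<dots> = \<zero>"
          using 1(2,3) v by (simp add: minus_eq_zero_iff)
        finally show ?thesis .
      next
        case (2 c x)
        have "free_act M f v = c \<odot> act M x v \<ominus> c \<odot> act M x v"
          unfolding 2(1) using 2(2) v
          by (simp only: free_act_diff l lc vscale_closed free_act_const_mult free_act_letter act_vscale)
        then show ?thesis using 2(2) v by (simp add: M.minus_eq M.r_neg)
      next
        case (3 x y)
        have "free_act M f v = (act M x (act M y v) \<ominus> act M y (act M x v)) \<ominus>
            (act M x (act M y v) \<ominus> act M y (act M x v))"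
          unfolding 3(1) using 3(2,3) v
          by (simp only: free_act_diff l lm vbracket_closed free_assoc_closed free_act_letter_mult
              free_act_letter act_vbracket act_closed)
        then show ?thesis using 3(2,3) v by (simp add: minus_eq_zero_iff)
      qed
    qed
    then show "f \<in> ?J" using f env_rels_closed by blast
  qed
  from env_ideal_minimal[OF free_act_annihilator_ideal this] show ?thesis using assms by blast
qed

definition env_act :: "free_alg set \<Rightarrow> 'm \<Rightarrow> 'm" where
  "env_act u v = the_elem ((\<lambda>f. free_act M f v) ` u)"

lemma env_act_cl:
  assumes f: "f \<in> carrier (free_assoc L)" and v: "v \<in> carrier M"
  shows "env_act (cl f) v = free_act M f v"
proof -
  have "free_act M g v = free_act M f v" if "g \<in> cl f" for g
  proof -
    obtain i where i: "i \<in> env_ideal L" "g = i + f" using \<open>g \<in> cl f\<close> unfolding mem_cl by blast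
    show ?thesis
      unfolding i(2) using free_act_add[OF env_ideal_carrier[OF i(1)] f v] env_ideal_annihilates[OF i(1) v]
        free_act_closed[OF f v] by simp
  qed
  moreover have "f \<in> cl f"
    unfolding mem_cl by (rule bexI[of _ 0]) (simp_all add: env_ideal_closed(2))
  ultimately have "(\<lambda>f. free_act M f v) ` cl f = {free_act M f v}" by blast
  then show ?thesis by (simp add: env_act_def)
qed

lemma env_act_simps:
  assumes v: "v \<in> carrier M"
  shows env_act_closed: "u \<in> carrier (env L) \<Longrightarrow> env_act u v \<in> carrier M"
    and env_act_one: "env_act \<one>\<^bsub>env L\<^esub> v = v"
    and env_act_add: "u \<in> carrier (env L) \<Longrightarrow> u' \<in> carrier (env L) \<Longrightarrow>
      env_act (u \<oplus>\<^bsub>env L\<^esub> u') v = env_act u v \<oplus> env_act u' v"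
    and env_act_mult: "u \<in> carrier (env L) \<Longrightarrow> u' \<in> carrier (env L) \<Longrightarrow>
      env_act (u \<otimes>\<^bsub>env L\<^esub> u') v = env_act u (env_act u' v)"
    and env_act_of: "x \<in> L \<Longrightarrow> env_act (env_of L x) v = act M x v"
    and env_act_const: "env_act (env_const L c) v = c \<odot> v"
    and env_act_scale: "u \<in> carrier (env L) \<Longrightarrow> env_act u (c \<odot> v) = c \<odot> env_act u v"
proof -
  show "u \<in> carrier (env L) \<Longrightarrow> env_act u v \<in> carrier M"
    unfolding carrier_env using v by (auto simp: env_act_cl free_act_closed)
  show "env_act \<one>\<^bsub>env L\<^esub> v = v"
    using env_act_cl[OF free_assoc_one v] v by (simp add: cl_simps free_act_one)
  show "u \<in> carrier (env L) \<Longrightarrow> u' \<in> carrier (env L) \<Longrightarrow>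
      env_act (u \<oplus>\<^bsub>env L\<^esub> u') v = env_act u v \<oplus> env_act u' v"
    unfolding carrier_env using v
    by (auto simp: env_act_cl free_act_add free_assoc_closed simp flip: cl_simps)
  show "u \<in> carrier (env L) \<Longrightarrow> u' \<in> carrier (env L) \<Longrightarrow>
      env_act (u \<otimes>\<^bsub>env L\<^esub> u') v = env_act u (env_act u' v)"
    unfolding carrier_env using v
    by (auto simp: env_act_cl free_act_mult free_act_closed free_assoc_closed simp flip: cl_simps)
  show "x \<in> L \<Longrightarrow> env_act (env_of L x) v = act M x v"
    unfolding env_of_def using v by (simp add: env_act_cl free_act_letter)
  show "env_act (env_const L c) v = c \<odot> v"
    unfolding env_const_def using v by (simp add: env_act_cl free_act_const free_assoc_const)
  show "u \<in> carrier (env L) \<Longrightarrow> env_act u (c \<odot> v) = c \<odot> env_act u v"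
    unfolding carrier_env using v free_act_linear[OF _ v] by (auto simp: env_act_cl)
qed

end

interpretation S: vfield_algebra S2bar
  by unfold_locales (simp_all add: S2bar_add S2bar_vscale S2bar_vbracket)

interpretation Dl: vfield_algebra Delta2
  by unfold_locales (simp_all add: Delta2_closed)

lemma free_assoc_mono: "L \<subseteq> L' \<Longrightarrow> carrier (free_assoc L) \<subseteq> carrier (free_assoc L')"
  unfolding subset_iff free_assoc_carrier by blast

lemmas free_Delta2_S2bar = subsetD[OF free_assoc_mono[OF Delta2_subset_S2bar]]

text \<open>The larger ideal cuts out an ideal of the smaller free algebra that contains its relations.\<close>

lemma env_ideal_Delta2_subset: "env_ideal Delta2 \<subseteq> env_ideal S2bar"
proof -
  let ?J = "env_ideal S2bar \<inter> carrier (free_assoc Delta2)"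
  have "ideal ?J (free_assoc Delta2)"
  proof (rule idealI)
    show "ring (free_assoc Delta2)" by (rule free_assoc_ring)
    show "subgroup ?J (add_monoid (free_assoc Delta2))"
    proof (rule Dl.FA.add.subgroupI)
      have "0 \<in> ?J" by (simp add: free_assoc_zero S.env_ideal_closed(2))
      then show "?J \<noteq> {}" by blast
    next
      fix f assume f: "f \<in> ?J"
      then show "\<ominus>\<^bsub>free_assoc Delta2\<^esub> f \<in> ?J"
        using f free_assoc_closed(3)[of f Delta2 f] free_assoc_minus[of f Delta2]
          S.env_ideal_closed(4)[of f] by simp
    next
      fix f g assume "f \<in> ?J" "g \<in> ?J"
      then show "f \<oplus>\<^bsub>free_assoc Delta2\<^esub> g \<in> ?J"
        using S.env_ideal_closed(3)[of f g] free_assoc_closed(1)[of f Delta2 g] by simp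
    qed auto
    fix f g assume "f \<in> ?J" "g \<in> carrier (free_assoc Delta2)"
    then show "g \<otimes>\<^bsub>free_assoc Delta2\<^esub> f \<in> ?J" "f \<otimes>\<^bsub>free_assoc Delta2\<^esub> g \<in> ?J"
      using S.env_ideal_closed(5,6)[of f g] free_assoc_closed(2)[of f Delta2 g]
        free_assoc_closed(2)[of g Delta2 f] free_Delta2_S2bar[of g] by simp_all
  qed
  moreover have "Dl.env_rels \<subseteq> S.env_rels"
    unfolding Dl.env_rels_def S.env_rels_def using Delta2_subset_S2bar by blast
  then have "Dl.env_rels \<subseteq> ?J"
    using Dl.env_rels_closed S.env_rel_in_ideal by blast
  ultimately have "env_ideal Delta2 \<subseteq> ?J" by (rule Dl.env_ideal_minimal)
  then show ?thesis by blast
qed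

lemma env_incl_cl:
  assumes f: "f \<in> carrier (free_assoc Delta2)"
  shows "env_incl S2bar (Dl.cl f) = S.cl f"
proof -
  have "x \<in> env_incl S2bar (Dl.cl f) \<longleftrightarrow> x \<in> S.cl f" for x
  proof
    assume "x \<in> env_incl S2bar (Dl.cl f)"
    then obtain i g where "i \<in> env_ideal S2bar" "g \<in> Dl.cl f" "x = i + g"
      unfolding env_incl_def set_add_def' by auto
    then obtain j where j: "j \<in> env_ideal Delta2" "x = i + (j + f)" unfolding Dl.mem_cl by blast
    have "i + j \<in> env_ideal S2bar"
      using S.env_ideal_closed(3)[OF \<open>i \<in> env_ideal S2bar\<close>, of j] j env_ideal_Delta2_subset by blast
    then show "x \<in> S.cl f" unfolding S.mem_cl by (rule bexI[rotated]) (simp add: j add.assoc)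
  next
    assume "x \<in> S.cl f"
    then obtain i where i: "i \<in> env_ideal S2bar" "x = i + f" unfolding S.mem_cl by blast
    have "f \<in> Dl.cl f"
      unfolding Dl.mem_cl by (rule bexI[of _ 0]) (simp_all add: Dl.env_ideal_closed(2))
    then show "x \<in> env_incl S2bar (Dl.cl f)"
      using i unfolding env_incl_def set_add_def' by auto
  qed
  then show ?thesis by blast
qed

lemma env_incl_closed:
  assumes "r \<in> carrier (env Delta2)"
  shows "env_incl S2bar r \<in> carrier (env S2bar)"
proof -
  obtain f where f: "f \<in> carrier (free_assoc Delta2)" "r = Dl.cl f"
    using assms unfolding Dl.carrier_env by (elim imageE)
  show ?thesis
    unfolding f(2) env_incl_cl[OF f(1)] by (rule S.cl_closed[OF free_Delta2_S2bar[OF f(1)]])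
qed

lemma free_eval_add: "free_eval \<phi> (f + g) = free_eval \<phi> f + free_eval \<phi> g"
  unfolding free_eval_def
  by (rule setsum_keys_plus_distrib) (simp_all add: distrib_right)

lemma free_eval_single: "free_eval \<phi> (Poly_Mapping.single w c) = c * prod_list (map \<phi> (letters w))"
  by (simp add: free_eval_def)

text \<open>The one-dimensional \<open>\<Delta>\<^sub>2\<close>-module of the character \<open>\<phi>\<^sub>1\<close>: the extended character is the action of
  \<open>U(\<Delta>\<^sub>2)\<close> on its generator.\<close>

definition char_module :: "complex lie_module" where
  "char_module = \<lparr>carrier = UNIV, monoid.mult = undefined, one = undefined, ring.zero = 0,
     add = (+), Module.module.smult = (*), act = (\<lambda>x z. phi1 x * z)\<rparr>"

lemma char_module_simps [simp]:
  "carrier char_module = UNIV" "\<zero>\<^bsub>char_module\<^esub> = 0" "a \<oplus>\<^bsub>char_module\<^esub> b = a + b"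
  "a \<odot>\<^bsub>char_module\<^esub> b = a * b" "act char_module x a = phi1 x * a"
  by (simp_all add: char_module_def)

lemma char_module_is_lie_module: "is_lie_module Delta2 char_module"
proof -
  interpret complex_space char_module
    by (rule complex_spaceI) (simp_all add: algebra_simps)
  show ?thesis
    unfolding is_lie_module_def
    using module_axioms
    by (simp add: minus_scale phi1_add phi1_vscale vbracket_Delta2 phi1_partials algebra_simps)
qed

interpretation char: lie_alg_mod Delta2 char_module
  by unfold_locales (rule char_module_is_lie_module)

lemma free_act_char:
  assumes "f \<in> carrier (free_assoc Delta2)"
  shows "free_act char_module f 1 = free_eval phi1 f"
  using assms
proof (induction f rule: free_single_induct)
  case (single w c)
  have "foldr (act char_module) xs 1 = prod_list (map phi1 xs)" for xs
    by (induction xs) simp_all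
  then show ?case
    using char.free_act_single[OF single, of 1 c] by (simp add: free_eval_single)
next
  case (add f g)
  then show ?case using char.free_act_add[OF add.hyps, of 1] by (simp add: free_eval_add)
qed

lemma env_character_cl:
  assumes f: "f \<in> carrier (free_assoc Delta2)"
  shows "env_character phi1 (Dl.cl f) = free_eval phi1 f"
proof -
  have "g \<in> carrier (free_assoc Delta2)" if g: "g \<in> Dl.cl f" for g
  proof -
    obtain i where "i \<in> env_ideal Delta2" "g = i + f" using g unfolding Dl.mem_cl by (elim bexE)
    then show ?thesis using free_assoc_closed(1)[OF Dl.env_ideal_carrier f] by simp
  qed
  then have "free_eval phi1 ` Dl.cl f = (\<lambda>f. free_act char_module f 1) ` Dl.cl f"
    by (intro image_cong refl) (simp add: free_act_char)
  then show ?thesis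
    using char.env_act_cl[OF f, of 1] by (simp add: env_character_def char.env_act_def free_act_char[OF f])
qed

lemma US_lie_simps [simp]:
  "carrier US_lie = carrier (env S2bar)" "\<zero>\<^bsub>US_lie\<^esub> = \<zero>\<^bsub>env S2bar\<^esub>" "add US_lie = add (env S2bar)"
  "c \<odot>\<^bsub>US_lie\<^esub> u = env_const S2bar c \<otimes>\<^bsub>env S2bar\<^esub> u"
  "act US_lie x u = env_of S2bar x \<otimes>\<^bsub>env S2bar\<^esub> u"
  by (simp_all add: US_lie_def)

lemma US_right_simps [simp]:
  "carrier US_right = carrier (env S2bar)" "\<zero>\<^bsub>US_right\<^esub> = \<zero>\<^bsub>env S2bar\<^esub>"
  "add US_right = add (env S2bar)" "r \<odot>\<^bsub>US_right\<^esub> u = u \<otimes>\<^bsub>env S2bar\<^esub> env_incl S2bar r"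
  by (simp_all add: US_right_def)

lemma C1_simps [simp]: "carrier C1 = UNIV" "a \<oplus>\<^bsub>C1\<^esub> b = a + b" "\<zero>\<^bsub>C1\<^esub> = 0"
  "r \<odot>\<^bsub>C1\<^esub> z = env_character phi1 r * z"
  by (simp_all add: C1_def)

lemma US_lie_is_lie_module: "is_lie_module S2bar US_lie"
proof -
  interpret complex_space US_lie
  proof (rule complex_spaceI; unfold US_lie_simps)
    show "x \<oplus>\<^bsub>env S2bar\<^esub> y = y \<oplus>\<^bsub>env S2bar\<^esub> x" if "x \<in> carrier (env S2bar)" "y \<in> carrier (env S2bar)" for x y
      by (rule S.U.a_comm[OF that])
    show "env_const S2bar (a + b) \<otimes>\<^bsub>env S2bar\<^esub> x = env_const S2bar a \<otimes>\<^bsub>env S2bar\<^esub> x \<oplus>\<^bsub>env S2bar\<^esub> env_const S2bar b \<otimes>\<^bsub>env S2bar\<^esub> x"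
      if "x \<in> carrier (env S2bar)" for a b x
      unfolding S.env_const_simps by (rule S.U.l_distr[OF S.env_const_closed S.env_const_closed that])
    show "env_const S2bar a \<otimes>\<^bsub>env S2bar\<^esub> (x \<oplus>\<^bsub>env S2bar\<^esub> y) = env_const S2bar a \<otimes>\<^bsub>env S2bar\<^esub> x \<oplus>\<^bsub>env S2bar\<^esub> env_const S2bar a \<otimes>\<^bsub>env S2bar\<^esub> y"
      if "x \<in> carrier (env S2bar)" "y \<in> carrier (env S2bar)" for a x y
      by (rule S.U.r_distr[OF that S.env_const_closed])
    show "env_const S2bar (a * b) \<otimes>\<^bsub>env S2bar\<^esub> x = env_const S2bar a \<otimes>\<^bsub>env S2bar\<^esub> (env_const S2bar b \<otimes>\<^bsub>env S2bar\<^esub> x)"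
      if "x \<in> carrier (env S2bar)" for a b x
      unfolding S.env_const_simps by (rule S.U.m_assoc[OF S.env_const_closed S.env_const_closed that])
    show "env_const S2bar 0 \<otimes>\<^bsub>env S2bar\<^esub> x = \<zero>\<^bsub>env S2bar\<^esub>" if "x \<in> carrier (env S2bar)" for x
      unfolding S.env_const_simps by (rule S.U.l_null[OF that])
    show "env_const S2bar 1 \<otimes>\<^bsub>env S2bar\<^esub> x = x" if "x \<in> carrier (env S2bar)" for x
      unfolding S.env_const_simps by (rule S.U.l_one[OF that])
    show "\<zero>\<^bsub>env S2bar\<^esub> \<oplus>\<^bsub>env S2bar\<^esub> x = x" if "x \<in> carrier (env S2bar)" for x
      by (rule S.U.l_zero[OF that])
    show "env_const S2bar c \<otimes>\<^bsub>env S2bar\<^esub> x \<in> carrier (env S2bar)" if "x \<in> carrier (env S2bar)" for c x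
      by (rule S.U.m_closed[OF S.env_const_closed that])
    show "x \<oplus>\<^bsub>env S2bar\<^esub> y \<in> carrier (env S2bar)"
      if "x \<in> carrier (env S2bar)" "y \<in> carrier (env S2bar)" for x y
      by (rule S.U.a_closed[OF that])
    show "\<zero>\<^bsub>env S2bar\<^esub> \<in> carrier (env S2bar)" by (rule S.U.zero_closed)
    show "x \<oplus>\<^bsub>env S2bar\<^esub> y \<oplus>\<^bsub>env S2bar\<^esub> z = x \<oplus>\<^bsub>env S2bar\<^esub> (y \<oplus>\<^bsub>env S2bar\<^esub> z)"
      if "x \<in> carrier (env S2bar)" "y \<in> carrier (env S2bar)" "z \<in> carrier (env S2bar)" for x y z
      by (rule S.U.a_assoc[OF that])
  qed
  have bracket: "act US_lie (vbracket x y) u = act US_lie x (act US_lie y u) \<ominus>\<^bsub>US_lie\<^esub> act US_lie y (act US_lie x u)"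
    if x: "x \<in> S2bar" and y: "y \<in> S2bar" and u: "u \<in> carrier US_lie" for x y u
  proof -
    let ?x = "env_of S2bar x" and ?y = "env_of S2bar y" and ?b = "env_of S2bar (vbracket x y)"
    have c: "?x \<in> carrier (env S2bar)" "?y \<in> carrier (env S2bar)" "?b \<in> carrier (env S2bar)"
      "u \<in> carrier (env S2bar)"
      using x y u S2bar_vbracket by simp_all
    have "?x \<otimes>\<^bsub>env S2bar\<^esub> (?y \<otimes>\<^bsub>env S2bar\<^esub> u) = (?x \<otimes>\<^bsub>env S2bar\<^esub> ?y) \<otimes>\<^bsub>env S2bar\<^esub> u"
      by (rule S.U.m_assoc[OF c(1,2,4), symmetric])
    also have "\<dots> = (?b \<oplus>\<^bsub>env S2bar\<^esub> ?y \<otimes>\<^bsub>env S2bar\<^esub> ?x) \<otimes>\<^bsub>env S2bar\<^esub> u"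
      by (simp only: S.env_of_vbracket[OF x y])
    also have "\<dots> = ?b \<otimes>\<^bsub>env S2bar\<^esub> u \<oplus>\<^bsub>env S2bar\<^esub> (?y \<otimes>\<^bsub>env S2bar\<^esub> ?x) \<otimes>\<^bsub>env S2bar\<^esub> u"
      by (rule S.U.l_distr[OF c(3) S.U.m_closed[OF c(2,1)] c(4)])
    also have "(?y \<otimes>\<^bsub>env S2bar\<^esub> ?x) \<otimes>\<^bsub>env S2bar\<^esub> u = ?y \<otimes>\<^bsub>env S2bar\<^esub> (?x \<otimes>\<^bsub>env S2bar\<^esub> u)"
      by (rule S.U.m_assoc[OF c(2,1,4)])
    finally have "act US_lie x (act US_lie y u) = act US_lie (vbracket x y) u \<oplus>\<^bsub>US_lie\<^esub> act US_lie y (act US_lie x u)"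
      unfolding US_lie_simps .
    then show ?thesis
      using add_minus_cancel[of "act US_lie (vbracket x y) u" "act US_lie y (act US_lie x u)"] c
      by (simp only: US_lie_simps S.U.m_closed)
  qed
  have scale: "act US_lie x (k \<odot>\<^bsub>US_lie\<^esub> u) = k \<odot>\<^bsub>US_lie\<^esub> act US_lie x u"
    if x: "x \<in> S2bar" and u: "u \<in> carrier US_lie" for x u k
  proof -
    have c: "env_of S2bar x \<in> carrier (env S2bar)" "u \<in> carrier (env S2bar)"
      using x u by simp_all
    show ?thesis
      unfolding US_lie_simps S.U.m_assoc[OF c(1) S.env_const_closed c(2), symmetric]
        S.U.m_assoc[OF S.env_const_closed c, symmetric] S.env_const_central[OF c(1)] ..
  qed
  show ?thesis
    unfolding is_lie_module_def
  proof (intro conjI ballI allI)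
    show "Module.module complex_field US_lie" by (rule module_axioms)
    fix x u assume x: "x \<in> S2bar" and u: "u \<in> carrier US_lie"
    have c: "env_of S2bar x \<in> carrier (env S2bar)" "u \<in> carrier (env S2bar)"
      using x u by simp_all
    show "act US_lie x u \<in> carrier US_lie"
      unfolding US_lie_simps by (rule S.U.m_closed[OF c])
    show "act US_lie x (k \<odot>\<^bsub>US_lie\<^esub> u) = k \<odot>\<^bsub>US_lie\<^esub> act US_lie x u" for k
      by (rule scale[OF x u])
    show "act US_lie (vscale k x) u = k \<odot>\<^bsub>US_lie\<^esub> act US_lie x u" for k
      unfolding US_lie_simps S.env_of_vscale[OF x] by (rule S.U.m_assoc[OF S.env_const_closed c])
  next
    fix x u v assume x: "x \<in> S2bar" and u: "u \<in> carrier US_lie" "v \<in> carrier US_lie"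
    then show "act US_lie x (u \<oplus>\<^bsub>US_lie\<^esub> v) = act US_lie x u \<oplus>\<^bsub>US_lie\<^esub> act US_lie x v"
      unfolding US_lie_simps by (intro S.U.r_distr S.env_of_closed)
  next
    fix x y u assume x: "x \<in> S2bar" and y: "y \<in> S2bar" and u: "u \<in> carrier US_lie"
    then show "act US_lie (x + y) u = act US_lie x u \<oplus>\<^bsub>US_lie\<^esub> act US_lie y u"
      unfolding US_lie_simps S.env_of_add[OF x y] by (intro S.U.l_distr S.env_of_closed)
    show "act US_lie (vbracket x y) u = act US_lie x (act US_lie y u) \<ominus>\<^bsub>US_lie\<^esub> act US_lie y (act US_lie x u)"
      by (rule bracket[OF x y u])
  qed
qed

interpretation Q1: lie_tensor_setup S2bar "env Delta2" US_lie US_right C1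
  rewrites "lie_tensor (env Delta2) US_lie US_right C1 = Q1"
proof -
  show "lie_tensor_setup S2bar (env Delta2) US_lie US_right C1"
  proof (intro lie_tensor_setup.intro lie_bimodule.intro lie_mod.intro lie_bimodule_axioms.intro
      lie_tensor_setup_axioms.intro)
    show "is_lie_module S2bar US_lie" by (rule US_lie_is_lie_module)
    show "abelian_group C1"
    proof (rule abelian_groupI)
      fix x assume "x \<in> carrier C1"
      show "\<exists>y\<in>carrier C1. y \<oplus>\<^bsub>C1\<^esub> x = \<zero>\<^bsub>C1\<^esub>"
        by (rule bexI[of _ "- x"]) simp_all
    qed simp_all
    fix r u assume r: "r \<in> carrier (env Delta2)" and "u \<in> carrier US_lie"
    then have u: "u \<in> carrier (env S2bar)" by simp
    show "r \<odot>\<^bsub>US_right\<^esub> u \<in> carrier US_lie"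
      unfolding US_lie_simps US_right_simps by (rule S.U.m_closed[OF u env_incl_closed[OF r]])
    show "c \<odot>\<^bsub>US_lie\<^esub> (r \<odot>\<^bsub>US_right\<^esub> u) = r \<odot>\<^bsub>US_right\<^esub> (c \<odot>\<^bsub>US_lie\<^esub> u)" for c
      unfolding US_lie_simps US_right_simps
      by (rule S.U.m_assoc[OF S.env_const_closed u env_incl_closed[OF r], symmetric])
    show "act US_lie x (r \<odot>\<^bsub>US_right\<^esub> u) = r \<odot>\<^bsub>US_right\<^esub> act US_lie x u" if "x \<in> S2bar" for x
      unfolding US_lie_simps US_right_simps
      by (rule S.U.m_assoc[OF S.env_of_closed[OF that] u env_incl_closed[OF r], symmetric])
  qed (simp_all add: S2bar_add S2bar_vscale S2bar_vbracket)
qed (simp add: Q1_def)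

lemma Q1_is_lie_module: "is_lie_module S2bar Q1"
  by (rule Q1.lie_tensor_is_lie_module)

interpretation Qm: S2bar_mod Q1
  by unfold_locales (rule Q1_is_lie_module)

abbreviation generator :: Qelem (\<open>\<^bold>1\<^sub>Q\<close>) where "\<^bold>1\<^sub>Q \<equiv> Q1_tensor \<one>\<^bsub>env S2bar\<^esub>"

lemma Q1_tensor_closed [simp]: "u \<in> carrier (env S2bar) \<Longrightarrow> Q1_tensor u \<in> carrier Q1"
  unfolding Q1_tensor_def by (rule Q1.tens_closed) simp_all

lemma act_Q1_tensor: "x \<in> S2bar \<Longrightarrow> u \<in> carrier (env S2bar) \<Longrightarrow>
    act Q1 x (Q1_tensor u) = Q1_tensor (env_of S2bar x \<otimes>\<^bsub>env S2bar\<^esub> u)"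
  unfolding Q1_tensor_def by (subst Q1.act_tens) simp_all

text \<open>The scalar \<open>z\<close> is the value of the extended character at the constant \<open>z\<close>, so it moves across the
  tensor sign.\<close>

lemma Q1_tens_scalar:
  assumes "u \<in> carrier (env S2bar)"
  shows "pure_tensor (env Delta2) US_right C1 u z = z \<odot>\<^bsub>Q1\<^esub> Q1_tensor u"
proof -
  have c: "env_const Delta2 z \<in> carrier (env Delta2)" by simp
  have "env_incl S2bar (env_const Delta2 z) = env_const S2bar z"
    unfolding env_const_def by (rule env_incl_cl[OF free_assoc_const])
  moreover have "env_character phi1 (env_const Delta2 z) = z"
    unfolding env_const_def env_character_cl[OF free_assoc_const]
    by (simp add: free_const_def free_eval_single)
  ultimately have "pure_tensor (env Delta2) US_right C1 (u \<otimes>\<^bsub>env S2bar\<^esub> env_const S2bar z) 1 =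
      pure_tensor (env Delta2) US_right C1 u z"
    using Q1.tens_balanced[OF c, of u 1] assms by simp
  then show ?thesis
    using assms Q1.scale_tens[of u 1 z]
    by (simp add: Q1_tensor_def v1_def S.env_const_central)
qed

text \<open>\<open>Q\<^sub>1\<close> is generated by \<open>1 \<otimes> v\<^sub>1\<close>.\<close>

lemma Q1_induct [consumes 1, case_names gen scale act add]:
  assumes q: "q \<in> carrier Q1" and gen: "P \<^bold>1\<^sub>Q"
    and scale: "\<And>c q. q \<in> carrier Q1 \<Longrightarrow> P q \<Longrightarrow> P (c \<odot>\<^bsub>Q1\<^esub> q)"
    and act: "\<And>x q. x \<in> S2bar \<Longrightarrow> q \<in> carrier Q1 \<Longrightarrow> P q \<Longrightarrow> P (act Q1 x q)"
    and add: "\<And>p q. p \<in> carrier Q1 \<Longrightarrow> q \<in> carrier Q1 \<Longrightarrow> P p \<Longrightarrow> P q \<Longrightarrow> P (p \<oplus>\<^bsub>Q1\<^esub> q)"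
  shows "P q"
  using q
proof (induction q rule: Q1.Q_induct)
  case (tens u z)
  have "P (Q1_tensor u)" if "u \<in> carrier (env S2bar)"
    using that
  proof (induction u rule: S.env_induct)
    case (const c u)
    then have "Q1_tensor (env_const S2bar c \<otimes>\<^bsub>env S2bar\<^esub> u) = c \<odot>\<^bsub>Q1\<^esub> Q1_tensor u"
      unfolding Q1_tensor_def by (subst Q1.scale_tens) simp_all
    then show ?case using const scale by simp
  next
    case (letter x u)
    then show ?case using act[of x "Q1_tensor u"] by (simp add: act_Q1_tensor)
  next
    case (add u v)
    then have "Q1_tensor (u \<oplus>\<^bsub>env S2bar\<^esub> v) = Q1_tensor u \<oplus>\<^bsub>Q1\<^esub> Q1_tensor v"
      unfolding Q1_tensor_def using Q1.tens_add_left[of u v v1] by simp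
    then show ?case using add assms(5) by simp
  qed (rule gen)
  then show ?case using tens scale[of "Q1_tensor u" z] by (simp add: Q1_tens_scalar)
qed (rule add)

text \<open>\<open>U(\<Delta>\<^sub>2)\<close> acts on Whittaker vectors through the extended character; this is what makes
  \<open>u \<otimes> z \<mapsto> z u w\<close> balanced.\<close>

lemma Wh_free_act:
  assumes M: "lie_mod S2bar M" and w: "w \<in> Wh M" and f: "f \<in> carrier (free_assoc Delta2)"
  shows "free_act M f w = free_eval phi1 f \<odot>\<^bsub>M\<^esub> w"
proof -
  interpret lie_mod S2bar M by fact
  have w': "w \<in> carrier M" "act M partial1 w = w" "act M partial2 w = w" using w by (simp_all add: Wh_def)
  have act: "act M x w = phi1 x \<odot>\<^bsub>M\<^esub> w" if x: "x \<in> Delta2" for x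
  proof -
    obtain a b where "x = vscale a partial1 + vscale b partial2" using x unfolding Delta2_def by auto
    then show ?thesis
      using w' by (simp add: act_plus act_vscale S2bar_vscale phi1_add phi1_vscale phi1_partials scale_add_left)
  qed
  show ?thesis
    using f
  proof (induction f rule: free_single_induct)
    case (single v c)
    have "foldr (act M) xs w = prod_list (map phi1 xs) \<odot>\<^bsub>M\<^esub> w" if "set xs \<subseteq> Delta2" for xs
      using that
    proof (induction xs)
      case (Cons x xs)
      then have "x \<in> S2bar" using Delta2_subset_S2bar by auto
      then show ?case
        using Cons w' by (simp add: act_scale act scale_scale mult.commute)
    qed (use w' in simp)
    moreover have "set (letters v) \<subseteq> S2bar" using single Delta2_subset_S2bar by blast
    ultimately show ?case
      using single w' by (simp add: free_act_single free_eval_single scale_scale)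
  next
    case (add f g)
    then show ?case
      using w' by (simp add: free_act_add free_Delta2_S2bar free_eval_add scale_add_left)
  qed
qed

lemma lie_hom_Q1_unique:
  assumes M: "lie_mod S2bar M" and f: "f \<in> lie_hom S2bar Q1 M" and g: "g \<in> lie_hom S2bar Q1 M"
    and eq: "f \<^bold>1\<^sub>Q = g \<^bold>1\<^sub>Q"
  shows "f = g"
proof (rule lie_hom_eqI[OF f g])
  fix q assume "q \<in> carrier Q1"
  then show "f q = g q"
    by (induction q rule: Q1_induct) (simp_all add: eq lie_homD[OF f] lie_homD[OF g])
qed

text \<open>Frobenius reciprocity: the homomorphism with value \<open>w\<close> at the generator is \<open>u \<otimes> z \<mapsto> z u w\<close>.\<close>

lemma Q1_universal:
  assumes M: "lie_mod S2bar M" and w: "w \<in> Wh M"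
  shows "\<exists>f\<in>lie_hom S2bar Q1 M. f \<^bold>1\<^sub>Q = w"
proof -
  interpret lie_mod S2bar M by fact
  interpret lie_alg_mod S2bar M by unfold_locales
  have w': "w \<in> carrier M" using w by (simp add: Wh_def)
  define \<beta> where "\<beta> u z = z \<odot>\<^bsub>M\<^esub> env_act u w" for u z
  have bal: "\<beta> (u \<otimes>\<^bsub>env S2bar\<^esub> env_incl S2bar r) z = \<beta> u (env_character phi1 r * z)"
    if u: "u \<in> carrier (env S2bar)" and r: "r \<in> carrier (env Delta2)" for u r z
  proof -
    obtain f where f: "f \<in> carrier (free_assoc Delta2)" "r = Dl.cl f"
      using r unfolding Dl.carrier_env by (elim imageE)
    have fS: "f \<in> carrier (free_assoc S2bar)" by (rule free_Delta2_S2bar[OF f(1)])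
    have "env_act (u \<otimes>\<^bsub>env S2bar\<^esub> env_incl S2bar r) w = env_act u (free_act M f w)"
      unfolding f(2) env_incl_cl[OF f(1)]
      using env_act_mult[OF w' u S.cl_closed[OF fS]] env_act_cl[OF fS w'] by simp
    also have "\<dots> = free_eval phi1 f \<odot>\<^bsub>M\<^esub> env_act u w"
      unfolding Wh_free_act[OF M w f(1)] by (rule env_act_scale[OF w' u])
    finally show ?thesis
      using env_act_closed[OF w' u]
      by (simp add: \<beta>_def f(2) env_character_cl[OF f(1)] scale_scale mult.commute)
  qed
  obtain h where h: "h \<in> hom (tensor_group (env Delta2) US_right C1) (add_monoid M)"
    "\<And>u z. u \<in> carrier US_right \<Longrightarrow> z \<in> carrier C1 \<Longrightarrow> h (pure_tensor (env Delta2) US_right C1 u z) = \<beta> u z"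
  proof (rule Q1.tf.tensor_universal[of "add_monoid M" \<beta>])
    show "comm_group (add_monoid M)" by (rule M.a_comm_group)
  qed (use w' bal in \<open>simp_all add: \<beta>_def env_act_closed env_act_add scale_add_left scale_add_right\<close>)
  have hadd: "h (p \<oplus>\<^bsub>Q1\<^esub> q) = h p \<oplus>\<^bsub>M\<^esub> h q" "h p \<in> carrier M"
    if "p \<in> carrier Q1" "q \<in> carrier Q1" for p q
    using hom_mult[OF h(1), of p q] hom_in_carrier[OF h(1), of p] that
    by (simp_all add: Q1_def lie_tensor_simps)
  have hscale: "h (c \<odot>\<^bsub>Q1\<^esub> q) = c \<odot>\<^bsub>M\<^esub> h q" if "q \<in> carrier Q1" for c q
    using that
  proof (induction q rule: Q1.Q_induct)
    case (tens u z)
    then show ?case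
      using w' by (subst Q1.scale_tens) (simp_all add: h(2) \<beta>_def env_act_mult env_act_const
          env_act_closed scale_scale mult.commute)
  next
    case (add s t)
    then show ?case
      by (simp add: Qm.scale_add_right hadd scale_add_right)
  qed
  have hact: "h (act Q1 x q) = act M x (h q)" if "x \<in> S2bar" "q \<in> carrier Q1" for x q
    using that(2)
  proof (induction q rule: Q1.Q_induct)
    case (tens u z)
    then show ?case
      using w' that(1) by (subst Q1.act_tens) (simp_all add: h(2) \<beta>_def env_act_mult env_act_of
          env_act_closed act_scale)
  next
    case (add s t)
    then show ?case
      using that(1) by (simp add: Qm.act_add hadd act_add)
  qed
  have "restrict h (carrier Q1) \<in> lie_hom S2bar Q1 M"
    by (rule lie_homI)
      (use Qm.scale_closed in \<open>auto simp: hadd hscale hact\<close>)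
  moreover have "h \<^bold>1\<^sub>Q = w"
    using w' h(2)[of "\<one>\<^bsub>env S2bar\<^esub>" v1] by (simp add: Q1_tensor_def \<beta>_def v1_def env_act_one)
  ultimately show ?thesis
    by (intro bexI[of _ "restrict h (carrier Q1)"]) simp_all
qed

section \<open>The monomial basis over the endomorphism algebra\<close>

lemma generator_Wh: "\<^bold>1\<^sub>Q \<in> Wh Q1"
proof -
  have "act Q1 x \<^bold>1\<^sub>Q = phi1 x \<odot>\<^bsub>Q1\<^esub> \<^bold>1\<^sub>Q" if x: "x \<in> Delta2" for x
  proof -
    have l: "letter x \<in> carrier (free_assoc Delta2)" using x by simp
    have r: "env_of Delta2 x \<in> carrier (env Delta2)" using x by simp
    have xS: "x \<in> S2bar" using x Delta2_subset_S2bar by blast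
    have "env_incl S2bar (env_of Delta2 x) = env_of S2bar x"
      unfolding env_of_def by (rule env_incl_cl[OF l])
    moreover have "env_character phi1 (env_of Delta2 x) = phi1 x"
      unfolding env_of_def env_character_cl[OF l] by (simp add: letter_def free_eval_single)
    ultimately have "pure_tensor (env Delta2) US_right C1 (env_of S2bar x) 1 =
        pure_tensor (env Delta2) US_right C1 \<one>\<^bsub>env S2bar\<^esub> (phi1 x)"
      using Q1.tens_balanced[OF r, of "\<one>\<^bsub>env S2bar\<^esub>" 1] xS by simp
    then show ?thesis
      using xS by (simp add: act_Q1_tensor Q1_tens_scalar)
  qed
  from this[OF partials_in_Delta2(1)] this[OF partials_in_Delta2(2)] show ?thesis
    by (simp add: Wh_def phi1_partials)
qed

lemma generator_closed [simp]: "\<^bold>1\<^sub>Q \<in> carrier Q1"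
  by simp

text \<open>The generator is killed by \<open>D\<^sub>1\<close> and \<open>D\<^sub>2\<close>, and local nilpotency is inherited along the action.\<close>

interpretation Qw: whittaker_mod Q1
proof
  have "nilpotent_at Q1 e q" if e: "e = partial1 \<or> e = partial2" and q: "q \<in> carrier Q1" for e q
    using q
  proof (induction q rule: Q1_induct)
    case gen
    have "(shifted Q1 e ^^ 1) \<^bold>1\<^sub>Q = \<zero>\<^bsub>Q1\<^esub>"
      using generator_Wh e by (auto simp: Qm.Wh_iff)
    then show ?case unfolding nilpotent_at_def by blast
  next
    case (scale c q)
    then show ?case using e by (intro Qm.nilpotent_at_scale) auto
  next
    case (act x q)
    then show ?case using e by (intro Qm.nilpotent_at_act)
  next
    case (add p q)
    then show ?case using e by (intro Qm.nilpotent_at_add) auto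
  qed
  then show "q \<in> carrier Q1 \<Longrightarrow> nilpotent_at Q1 partial1 q" "q \<in> carrier Q1 \<Longrightarrow> nilpotent_at Q1 partial2 q" for q
    by simp_all
qed

lemma inj_on_generator_value:
  assumes "lie_mod S2bar M"
  shows "inj_on (\<lambda>\<psi>. \<psi> \<^bold>1\<^sub>Q) (lie_hom S2bar Q1 M)"
  by (rule inj_onI) (rule lie_hom_Q1_unique[OF assms])

lemma whittaker_hom_of_value:
  assumes M: "lie_mod S2bar M" and f: "f \<in> lie_hom S2bar Q1 M"
  shows "whittaker_hom M (f \<^bold>1\<^sub>Q) = f"
  unfolding whittaker_hom_def by (rule the_inv_into_f_eq[OF inj_on_generator_value[OF M] refl f])

lemma whittaker_hom:
  assumes M: "lie_mod S2bar M" and w: "w \<in> Wh M"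
  shows whittaker_hom_lie_hom: "whittaker_hom M w \<in> lie_hom S2bar Q1 M"
    and whittaker_hom_generator: "whittaker_hom M w \<^bold>1\<^sub>Q = w"
proof -
  obtain f where f: "f \<in> lie_hom S2bar Q1 M" "f \<^bold>1\<^sub>Q = w" using Q1_universal[OF M w] by blast
  have "whittaker_hom M w = f" using whittaker_hom_of_value[OF M f(1)] f(2) by simp
  then show "whittaker_hom M w \<in> lie_hom S2bar Q1 M" "whittaker_hom M w \<^bold>1\<^sub>Q = w" using f by simp_all
qed

lemma whittaker_hom_eqI:
  assumes "lie_mod S2bar M" "f \<in> lie_hom S2bar Q1 M" "f \<^bold>1\<^sub>Q = w"
  shows "whittaker_hom M w = f"
  using whittaker_hom_of_value[OF assms(1,2)] assms(3) by simp

lemma whittaker_hom_comp: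
  assumes M: "lie_mod S2bar M" and N: "lie_mod S2bar N" and f: "f \<in> lie_hom S2bar M N"
    and w: "w \<in> Wh M"
  shows "whittaker_hom N (f w) = compose (carrier Q1) f (whittaker_hom M w)"
  by (rule whittaker_hom_eqI[OF N])
    (simp_all add: lie_hom_compose[OF whittaker_hom_lie_hom[OF M w] f Q1_is_lie_module] compose_eq
      whittaker_hom_generator[OF M w])

lemma whittaker_hom_add:
  assumes M: "lie_mod S2bar M" and w: "w \<in> Wh M" "w' \<in> Wh M" and q: "q \<in> carrier Q1"
  shows "whittaker_hom M (w \<oplus>\<^bsub>M\<^esub> w') q = whittaker_hom M w q \<oplus>\<^bsub>M\<^esub> whittaker_hom M w' q"
proof -
  interpret S2bar_mod M using M by (simp add: S2bar_mod_def)
  have ww: "w \<oplus>\<^bsub>M\<^esub> w' \<in> Wh M" using Wh_subspace w by (simp add: subspace_def)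
  note h = whittaker_hom_lie_hom[OF M w(1)] whittaker_hom_lie_hom[OF M w(2)]
    whittaker_hom_lie_hom[OF M ww]
  show ?thesis
    using q
    by (induction q rule: Q1_induct)
      (simp_all add: whittaker_hom_generator[OF M] w ww lie_homD[OF h(1)] lie_homD[OF h(2)]
        lie_homD[OF h(3)] scale_add_right act_add M.a_ac)
qed

lemma lie_hom_act_pow:
  assumes M: "lie_mod L M" and f: "f \<in> lie_hom L M N" and x: "x \<in> L" and v: "v \<in> carrier M"
  shows "f ((act M x ^^ n) v) = (act N x ^^ n) (f v) \<and> (act M x ^^ n) v \<in> carrier M"
proof -
  interpret lie_mod L M by fact
  show ?thesis using v x by (induction n) (simp_all add: lie_homD(5)[OF f])
qed

lemma H1_simps [simp]:
  "carrier H1 = lie_hom S2bar Q1 Q1" "f \<otimes>\<^bsub>H1\<^esub> g = compose (carrier Q1) g f"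
  "\<one>\<^bsub>H1\<^esub> = (\<lambda>q\<in>carrier Q1. q)" "\<zero>\<^bsub>H1\<^esub> = (\<lambda>q\<in>carrier Q1. \<zero>\<^bsub>Q1\<^esub>)"
  "f \<oplus>\<^bsub>H1\<^esub> g = (\<lambda>q\<in>carrier Q1. f q \<oplus>\<^bsub>Q1\<^esub> g q)"
  by (simp_all add: H1_def)

lemma H1_ring: "ring H1"
  unfolding H1_def by (rule opposite_ring_ring[OF Qm.lie_End_ring])

lemma Q1_right_simps [simp]:
  "carrier Q1_right = carrier Q1" "\<zero>\<^bsub>Q1_right\<^esub> = \<zero>\<^bsub>Q1\<^esub>" "add Q1_right = add Q1"
  "\<theta> \<odot>\<^bsub>Q1_right\<^esub> q = \<theta> q"
  by (simp_all add: Q1_right_def)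

lemma finsum_Q1_right: "finsum Q1_right f A = finsum Q1 f A"
  by (simp add: finsum_def finprod_def)

lemma Q1_right_module: "right_module H1 Q1_right"
  unfolding right_module_def left_module_def
proof (intro conjI ballI H1_ring opposite_ring_ring)
  show "abelian_group Q1_right"
    by (rule abelian_groupI) (simp_all add: Q1.Q.a_ac Q1.Q.add.l_inv_ex)
qed (simp_all add: lie_homD compose_eq)

definition monomial :: "nat \<times> nat \<Rightarrow> Qelem" where
  "monomial m = (act Q1 d1 ^^ fst m) ((act Q1 d2 ^^ snd m) \<^bold>1\<^sub>Q)"

lemma monomial_closed [simp]: "monomial m \<in> carrier Q1"
  by (simp add: monomial_def)

lemma Q1_tensor_pow:
  assumes x: "x \<in> S2bar" and u: "u \<in> carrier (env S2bar)"
  shows "Q1_tensor (env_of S2bar x [^]\<^bsub>env S2bar\<^esub> n \<otimes>\<^bsub>env S2bar\<^esub> u) = (act Q1 x ^^ n) (Q1_tensor u)"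
proof (induction n)
  case 0
  then show ?case using u by simp
next
  case (Suc n)
  have c: "env_of S2bar x \<in> carrier (env S2bar)" using x by simp
  have p: "env_of S2bar x [^]\<^bsub>env S2bar\<^esub> n \<in> carrier (env S2bar)" by (rule S.U.nat_pow_closed[OF c])
  have "env_of S2bar x [^]\<^bsub>env S2bar\<^esub> Suc n \<otimes>\<^bsub>env S2bar\<^esub> u =
      env_of S2bar x \<otimes>\<^bsub>env S2bar\<^esub> (env_of S2bar x [^]\<^bsub>env S2bar\<^esub> n \<otimes>\<^bsub>env S2bar\<^esub> u)"
    unfolding S.U.nat_pow_Suc2[OF c] by (rule S.U.m_assoc[OF c p u])
  then show ?case
    using act_Q1_tensor[OF x S.U.m_closed[OF p u]] Suc by simp
qed

lemma Q1_tensor_hpow: "Q1_tensor (hpow m) = monomial m"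
proof -
  have c: "env_of S2bar d2 [^]\<^bsub>env S2bar\<^esub> snd m \<in> carrier (env S2bar)"
    by (rule S.U.nat_pow_closed) simp
  have "Q1_tensor (env_of S2bar d2 [^]\<^bsub>env S2bar\<^esub> snd m) = (act Q1 d2 ^^ snd m) \<^bold>1\<^sub>Q"
    using Q1_tensor_pow[of d2 "\<one>\<^bsub>env S2bar\<^esub>" "snd m"] S.U.r_one[OF c] by simp
  then show ?thesis
    unfolding hpow_def monomial_def using Q1_tensor_pow[OF vfields_in_S2bar(3) c] by simp
qed

lemma endomorphism_monomial:
  assumes M: "lie_mod S2bar M" and f: "f \<in> lie_hom S2bar Q1 M"
  shows "f (monomial m) = (act M d1 ^^ fst m) ((act M d2 ^^ snd m) (f \<^bold>1\<^sub>Q))"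
  unfolding monomial_def using lie_hom_act_pow[OF Qm.lie_mod_axioms f] by simp

text \<open>A Whittaker vector \<open>w\<close> of \<open>Q\<^sub>1\<close> is the value \<open>\<theta>(1 \<otimes> v\<^sub>1)\<close> of some \<open>\<theta>\<close> in \<open>H\<^sub>1\<close>, and then
  \<open>d\<^sub>1\<^sup>k d\<^sub>2\<^sup>l w = \<theta>(d\<^sub>1\<^sup>k d\<^sub>2\<^sup>l \<otimes> v\<^sub>1)\<close>.\<close>

lemma monomials_generate:
  assumes "q \<in> carrier Q1"
  shows "\<exists>A a. finite A \<and> A \<subseteq> range monomial \<and> a \<in> A \<rightarrow> lie_hom S2bar Q1 Q1 \<and>
    q = (\<Oplus>\<^bsub>Q1\<^esub>b\<in>A. a b b)"
  using assms
proof (induction q rule: Qw.whittaker_induct)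
  case (gen k l w)
  define \<theta> where "\<theta> = whittaker_hom Q1 w"
  have \<theta>: "\<theta> \<in> lie_hom S2bar Q1 Q1" "\<theta> \<^bold>1\<^sub>Q = w"
    using whittaker_hom[OF Qm.lie_mod_axioms gen] by (simp_all add: \<theta>_def)
  have "\<theta> (monomial (k, l)) = (act Q1 d1 ^^ k) ((act Q1 d2 ^^ l) w)"
    using endomorphism_monomial[OF Qm.lie_mod_axioms \<theta>(1), of "(k, l)"] \<theta>(2) by simp
  moreover have "\<theta> (monomial (k, l)) \<in> carrier Q1" by (rule lie_homD(2)[OF \<theta>(1)]) simp
  ultimately show ?case
    using \<theta>(1) by (intro exI[of _ "{monomial (k, l)}"] exI[of _ "\<lambda>_. \<theta>"]) simp
next
  case (add u v)
  then obtain A a A' a' where *: "finite A" "A \<subseteq> range monomial" "a \<in> A \<rightarrow> lie_hom S2bar Q1 Q1"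
      "u = (\<Oplus>\<^bsub>Q1\<^esub>b\<in>A. a b b)" "finite A'" "A' \<subseteq> range monomial" "a' \<in> A' \<rightarrow> lie_hom S2bar Q1 Q1"
      "v = (\<Oplus>\<^bsub>Q1\<^esub>b\<in>A'. a' b b)" by blast
  \<comment> \<open>To add the two sums, both are extended by zero to the union of their index sets.\<close>
  define z where "z = (\<lambda>q\<in>carrier Q1. \<zero>\<^bsub>Q1\<^esub>)"
  have z: "z \<in> lie_hom S2bar Q1 Q1" unfolding z_def by (rule Qm.lie_hom_0)
  define e where "e b = (if b \<in> A then a b else z)" for b
  define e' where "e' b = (if b \<in> A' then a' b else z)" for b
  have e: "e b \<in> lie_hom S2bar Q1 Q1" "e' b \<in> lie_hom S2bar Q1 Q1" for b
    using *(3,7) z by (auto simp: e_def e'_def)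
  define s where "s b = (\<lambda>q\<in>carrier Q1. e b q \<oplus>\<^bsub>Q1\<^esub> e' b q)" for b
  have U: "b \<in> carrier Q1" if "b \<in> A \<union> A'" for b using that *(2,6) by auto
  have ec: "e b b \<in> carrier Q1" "e' b b \<in> carrier Q1" if "b \<in> A \<union> A'" for b
    using e U[OF that] by (auto intro: lie_homD(2))
  have "u = (\<Oplus>\<^bsub>Q1\<^esub>b\<in>A \<union> A'. e b b)"
    unfolding *(4)
    by (rule Q1.Q.add.finprod_mono_neutral_cong_left) (use *(1,5) ec U in \<open>auto simp: e_def z_def\<close>)
  moreover have "v = (\<Oplus>\<^bsub>Q1\<^esub>b\<in>A \<union> A'. e' b b)"
    unfolding *(8)
    by (rule Q1.Q.add.finprod_mono_neutral_cong_left) (use *(1,5) ec U in \<open>auto simp: e'_def z_def\<close>)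
  ultimately have "u \<oplus>\<^bsub>Q1\<^esub> v = (\<Oplus>\<^bsub>Q1\<^esub>b\<in>A \<union> A'. e b b \<oplus>\<^bsub>Q1\<^esub> e' b b)"
    using ec by (subst Q1.Q.finsum_addf) auto
  also have "\<dots> = (\<Oplus>\<^bsub>Q1\<^esub>b\<in>A \<union> A'. s b b)"
    by (rule Q1.Q.finsum_cong') (use ec U in \<open>auto simp: s_def\<close>)
  finally have "u \<oplus>\<^bsub>Q1\<^esub> v = (\<Oplus>\<^bsub>Q1\<^esub>b\<in>A \<union> A'. s b b)" .
  moreover have "s b \<in> lie_hom S2bar Q1 Q1" for b
    unfolding s_def by (rule Qm.lie_hom_add[OF e])
  ultimately show ?case
    using *(1,2,5,6) by (intro exI[of _ "A \<union> A'"] exI[of _ s]) auto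
qed

lemma monomials_right_independent:
  assumes A: "finite A" "A \<subseteq> range monomial" and a: "a \<in> A \<rightarrow> lie_hom S2bar Q1 Q1"
    and sum: "(\<Oplus>\<^bsub>Q1\<^esub>b\<in>A. a b b) = \<zero>\<^bsub>Q1\<^esub>" and b: "b \<in> A"
  shows "a b = (\<lambda>q\<in>carrier Q1. \<zero>\<^bsub>Q1\<^esub>)"
proof -
  \<comment> \<open>Each element of \<open>A\<close> gets one exponent that yields it; distinct elements get distinct exponents.\<close>
  define e where "e = inv_into UNIV monomial"
  have e: "monomial (e b) = b" if "b \<in> A" for b
    unfolding e_def using that A(2) by (intro f_inv_into_f) blast
  have inj: "inj_on e A" by (rule inj_on_inverseI[of _ monomial]) (rule e)
  define w where "w m = a (monomial m) \<^bold>1\<^sub>Q" for m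
  have w: "w m \<in> Wh Q1" if "m \<in> e ` A" for m
  proof -
    obtain b where "b \<in> A" "m = e b" using \<open>m \<in> e ` A\<close> by blast
    then show ?thesis using a lie_hom_Wh[OF _ generator_Wh] by (auto simp: w_def e)
  qed
  have val: "(act Q1 d1 ^^ fst (e b)) ((act Q1 d2 ^^ snd (e b)) (w (e b))) = a b b" if b: "b \<in> A" for b
    using endomorphism_monomial[OF Qm.lie_mod_axioms, of "a b" "e b"] a b by (auto simp: w_def e)
  have "(\<Oplus>\<^bsub>Q1\<^esub>m\<in>e ` A. (act Q1 d1 ^^ fst m) ((act Q1 d2 ^^ snd m) (w m))) =
      (\<Oplus>\<^bsub>Q1\<^esub>b\<in>A. (act Q1 d1 ^^ fst (e b)) ((act Q1 d2 ^^ snd (e b)) (w (e b))))"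
    by (rule Q1.Q.finsum_reindex[OF _ inj]) (auto dest!: w Qm.Wh_carrier)
  also have "\<dots> = (\<Oplus>\<^bsub>Q1\<^esub>b\<in>A. a b b)"
  proof (rule Q1.Q.finsum_cong')
    show "(\<lambda>b. a b b) \<in> A \<rightarrow> carrier Q1"
    proof
      fix b assume "b \<in> A"
      then have "a b \<in> lie_hom S2bar Q1 Q1" "b \<in> carrier Q1" using a A(2) by auto
      then show "a b b \<in> carrier Q1" by (rule lie_homD(2))
    qed
  qed (simp_all only: val)
  finally have "w (e b) = \<zero>\<^bsub>Q1\<^esub>"
    using sum A(1) w b by (intro Qw.monomials_independent[of "e ` A" w]) simp_all
  then have "a b \<^bold>1\<^sub>Q = \<zero>\<^bsub>Q1\<^esub>" using b by (simp add: w_def e)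
  moreover have "a b \<in> lie_hom S2bar Q1 Q1" using a b by blast
  ultimately show ?thesis
    by (intro lie_hom_Q1_unique[OF Qm.lie_mod_axioms _ Qm.lie_hom_0]) simp_all
qed

theorem Q1_basis: "module_basis H1 Q1_right {Q1_tensor (hpow m) | m. True}"
proof -
  have B: "{Q1_tensor (hpow m) | m. True} = range monomial" by (auto simp: Q1_tensor_hpow)
  show ?thesis
    unfolding module_basis_def B finsum_Q1_right Q1_right_simps H1_simps
  proof (intro conjI ballI allI impI)
    show "range monomial \<subseteq> carrier Q1" by auto
  next
    fix q assume "q \<in> carrier Q1"
    then show "\<exists>A a. finite A \<and> A \<subseteq> range monomial \<and> a \<in> A \<rightarrow> lie_hom S2bar Q1 Q1 \<and>
        q = (\<Oplus>\<^bsub>Q1\<^esub>b\<in>A. a b b)"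
      by (rule monomials_generate)
  next
    fix A a b assume "finite A \<and> A \<subseteq> range monomial \<and> a \<in> A \<rightarrow> lie_hom S2bar Q1 Q1 \<and>
      (\<Oplus>\<^bsub>Q1\<^esub>b\<in>A. a b b) = \<zero>\<^bsub>Q1\<^esub>" "b \<in> A"
    then show "a b = (\<lambda>q\<in>carrier Q1. \<zero>\<^bsub>Q1\<^esub>)"
      by (elim conjE) (rule monomials_right_independent)
  qed
qed

section \<open>The two functors on objects, and the unit\<close>

lemma complex_space_cong:
  assumes K: "complex_space K" and same: "carrier K' = carrier K" "add K' = add K" "zero K' = zero K"
    and smult: "\<And>c x. x \<in> carrier K \<Longrightarrow> c \<odot>\<^bsub>K'\<^esub> x = c \<odot>\<^bsub>K\<^esub> x"
  shows "complex_space K'"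
proof -
  interpret complex_space K by fact
  show ?thesis
    by (rule complex_spaceI)
      (simp_all add: same smult scale_add_left scale_add_right scale_scale M.a_ac)
qed

lemma Wh_ob_simps [simp]:
  "carrier (Wh_ob M) = Wh M" "zero (Wh_ob M) = zero M" "add (Wh_ob M) = add M"
  "\<theta> \<odot>\<^bsub>Wh_ob M\<^esub> w = whittaker_hom M w (\<theta> \<^bold>1\<^sub>Q)"
  by (simp_all add: Wh_ob_def compose_eq)

lemma H1_vector_space_simps [simp]:
  "carrier (H1_vector_space V) = carrier V" "zero (H1_vector_space V) = zero V"
  "add (H1_vector_space V) = add V" "c \<odot>\<^bsub>H1_vector_space V\<^esub> v = H1_const c \<odot>\<^bsub>V\<^esub> v"
  by (simp_all add: H1_vector_space_def)

lemma H1_const: "H1_const c \<in> lie_hom S2bar Q1 Q1" "q \<in> carrier Q1 \<Longrightarrow> H1_const c q = c \<odot>\<^bsub>Q1\<^esub> q"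
proof -
  show "H1_const c \<in> lie_hom S2bar Q1 Q1"
    using Qm.lie_hom_scale[OF Qm.lie_hom_id, of c] by (simp add: H1_const_def cong: restrict_cong)
  show "q \<in> carrier Q1 \<Longrightarrow> H1_const c q = c \<odot>\<^bsub>Q1\<^esub> q" by (simp add: H1_const_def)
qed

lemma H1_value_Wh: "\<theta> \<in> lie_hom S2bar Q1 Q1 \<Longrightarrow> \<theta> \<^bold>1\<^sub>Q \<in> Wh Q1"
  by (rule lie_hom_Wh[OF _ generator_Wh])

lemma Wh_ob_smult_closed:
  "lie_mod S2bar M \<Longrightarrow> \<theta> \<in> lie_hom S2bar Q1 Q1 \<Longrightarrow> w \<in> Wh M \<Longrightarrow> whittaker_hom M w (\<theta> \<^bold>1\<^sub>Q) \<in> Wh M"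
  by (rule lie_hom_Wh[OF whittaker_hom_lie_hom H1_value_Wh])

text \<open>\<open>\<theta>\<close> acts on \<open>Hom(Q\<^sub>1, M)\<close> by precomposition, which turns the product of \<open>H\<^sub>1\<close> into a left action.\<close>

lemma whittaker_hom_smult:
  assumes M: "lie_mod S2bar M" and \<theta>: "\<theta> \<in> lie_hom S2bar Q1 Q1" and w: "w \<in> Wh M"
  shows "whittaker_hom M (whittaker_hom M w (\<theta> \<^bold>1\<^sub>Q)) = compose (carrier Q1) (whittaker_hom M w) \<theta>"
  by (rule whittaker_hom_eqI[OF M])
    (simp_all add: lie_hom_compose[OF \<theta> whittaker_hom_lie_hom[OF M w] Q1_is_lie_module] compose_eq)

lemma Wh_ob_left_module:
  assumes M: "lie_mod S2bar M"
  shows "left_module H1 (Wh_ob M)"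
proof -
  interpret S2bar_mod M using M by (simp add: S2bar_mod_def)
  interpret W: complex_space "sub_vs M (Wh M)"
    by (rule sub_vs_complex_space[OF complex_space_axioms Wh_subspace])
  note hD = lie_homD[OF whittaker_hom_lie_hom[OF M]]
  show ?thesis
    unfolding left_module_def
  proof (intro conjI ballI H1_ring)
    show "abelian_group (Wh_ob M)"
    proof (rule abelian_groupI)
      fix x assume "x \<in> carrier (Wh_ob M)"
      then show "\<exists>y\<in>carrier (Wh_ob M). y \<oplus>\<^bsub>Wh_ob M\<^esub> x = \<zero>\<^bsub>Wh_ob M\<^esub>"
        using W.M.add.l_inv_ex[of x] by simp
    qed (use W.M.a_closed W.M.zero_closed W.M.a_assoc W.M.a_comm W.M.l_zero in simp_all)
  next
    fix \<theta> w assume "\<theta> \<in> carrier H1" "w \<in> carrier (Wh_ob M)"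
    then show "\<theta> \<odot>\<^bsub>Wh_ob M\<^esub> w \<in> carrier (Wh_ob M)"
      using Wh_ob_smult_closed[OF M] by simp
  next
    fix \<theta> w w' assume "\<theta> \<in> carrier H1" "w \<in> carrier (Wh_ob M)" "w' \<in> carrier (Wh_ob M)"
    then show "\<theta> \<odot>\<^bsub>Wh_ob M\<^esub> (w \<oplus>\<^bsub>Wh_ob M\<^esub> w') = \<theta> \<odot>\<^bsub>Wh_ob M\<^esub> w \<oplus>\<^bsub>Wh_ob M\<^esub> \<theta> \<odot>\<^bsub>Wh_ob M\<^esub> w'"
      using whittaker_hom_add[OF M] lie_homD(2)[of \<theta> S2bar Q1 Q1 "\<^bold>1\<^sub>Q"] by simp
  next
    fix \<theta> \<theta>' w assume *: "\<theta> \<in> carrier H1" "\<theta>' \<in> carrier H1" "w \<in> carrier (Wh_ob M)"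
    then have c: "\<theta> \<^bold>1\<^sub>Q \<in> carrier Q1" "\<theta>' \<^bold>1\<^sub>Q \<in> carrier Q1"
      using lie_homD(2)[of \<theta> S2bar Q1 Q1 "\<^bold>1\<^sub>Q"] lie_homD(2)[of \<theta>' S2bar Q1 Q1 "\<^bold>1\<^sub>Q"] by simp_all
    show "(\<theta> \<oplus>\<^bsub>H1\<^esub> \<theta>') \<odot>\<^bsub>Wh_ob M\<^esub> w = \<theta> \<odot>\<^bsub>Wh_ob M\<^esub> w \<oplus>\<^bsub>Wh_ob M\<^esub> \<theta>' \<odot>\<^bsub>Wh_ob M\<^esub> w"
      using * c hD(3) by simp
    show "(\<theta> \<otimes>\<^bsub>H1\<^esub> \<theta>') \<odot>\<^bsub>Wh_ob M\<^esub> w = \<theta> \<odot>\<^bsub>Wh_ob M\<^esub> (\<theta>' \<odot>\<^bsub>Wh_ob M\<^esub> w)"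
      using * c whittaker_hom_smult[OF M, of \<theta>' w] by (simp add: compose_eq)
  next
    fix w assume "w \<in> carrier (Wh_ob M)"
    then show "\<one>\<^bsub>H1\<^esub> \<odot>\<^bsub>Wh_ob M\<^esub> w = w"
      using whittaker_hom_generator[OF M] by simp
  qed
qed

lemma Wh_ob_H1_fmod:
  assumes "M \<in> Ob Omega"
  shows "Wh_ob M \<in> Ob H1_fmod"
proof -
  have "whittaker_mod M" and fd: "fin_dim (sub_vs M (Wh M))" using assms by (simp_all add: Omega_iff)
  then interpret whittaker_mod M by simp
  have W: "complex_space (sub_vs M (Wh M))"
    by (rule sub_vs_complex_space[OF complex_space_axioms Wh_subspace])
  have s: "H1_const c \<odot>\<^bsub>Wh_ob M\<^esub> w = c \<odot>\<^bsub>M\<^esub> w" if "w \<in> Wh M" for c w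
    using lie_homD(4)[OF whittaker_hom_lie_hom[OF lie_mod_axioms that], of "\<^bold>1\<^sub>Q" c]
      whittaker_hom_generator[OF lie_mod_axioms that] H1_const(2) by simp
  have V: "complex_space (H1_vector_space (Wh_ob M))"
    by (rule complex_space_cong[OF W]) (simp_all del: Wh_ob_simps(4) add: s)
  have "fin_dim (H1_vector_space (Wh_ob M))"
    by (rule fin_dim_surjective_image[OF W V fd, of "\<lambda>w. w"]) (simp_all del: Wh_ob_simps(4) add: s)
  then show ?thesis
    using Wh_ob_left_module[OF lie_mod_axioms] by (simp add: H1_fmod_def)
qed

lemma concrete_category_simps [simp]:
  "Und Omega = carrier" "Hom Omega = lie_hom S2bar" "Und H1_fmod = carrier" "Hom H1_fmod = mod_hom H1"
  by (simp_all add: Omega_def H1_fmod_def)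

lemma Wh_map_hom:
  assumes M: "lie_mod S2bar M" and N: "lie_mod S2bar N" and f: "f \<in> lie_hom S2bar M N"
  shows "Wh_map M N f \<in> mod_hom H1 (Wh_ob M) (Wh_ob N)"
proof (rule mod_homI)
  fix \<theta> w assume *: "\<theta> \<in> carrier H1" "w \<in> carrier (Wh_ob M)"
  then have "\<theta> \<^bold>1\<^sub>Q \<in> carrier Q1" using lie_homD(2)[of \<theta> S2bar Q1 Q1 "\<^bold>1\<^sub>Q"] by simp
  then show "Wh_map M N f (\<theta> \<odot>\<^bsub>Wh_ob M\<^esub> w) = \<theta> \<odot>\<^bsub>Wh_ob N\<^esub> Wh_map M N f w"
    using * Wh_ob_smult_closed[OF M] whittaker_hom_comp[OF M N f, of w]
    by (simp add: Wh_map_def compose_eq)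
next
  fix v w assume *: "v \<in> carrier (Wh_ob M)" "w \<in> carrier (Wh_ob M)"
  interpret S2bar_mod M using M by (simp add: S2bar_mod_def)
  have "v \<oplus>\<^bsub>M\<^esub> w \<in> Wh M" using * Wh_subspace by (simp add: subspace_def)
  then show "Wh_map M N f (v \<oplus>\<^bsub>Wh_ob M\<^esub> w) = Wh_map M N f v \<oplus>\<^bsub>Wh_ob N\<^esub> Wh_map M N f w"
    using * lie_homD(3)[OF f] Wh_carrier by (simp add: Wh_map_def)
qed (use lie_hom_Wh[OF f] in \<open>simp_all add: Wh_map_def\<close>)

lemma Wh_functor: "is_functor Omega H1_fmod Wh_ob Wh_map"
  unfolding is_functor_def concrete_category_simps
proof (intro conjI ballI)
  fix A :: "'m lie_module" assume "A \<in> Ob Omega"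
  then show "Wh_ob A \<in> Ob H1_fmod" by (rule Wh_ob_H1_fmod)
  show "Wh_map A A (\<lambda>x\<in>carrier A. x) = (\<lambda>x\<in>carrier (Wh_ob A). x)"
    by (auto simp: Wh_map_def Wh_def)
next
  fix A B :: "'m lie_module" and f assume "A \<in> Ob Omega" "B \<in> Ob Omega" "f \<in> lie_hom S2bar A B"
  then show "Wh_map A B f \<in> mod_hom H1 (Wh_ob A) (Wh_ob B)"
    by (intro Wh_map_hom) (simp_all add: Omega_iff whittaker_mod_def S2bar_mod_def)
next
  fix A A' A'' :: "'m lie_module" and f g
  assume f: "f \<in> lie_hom S2bar A A'"
  show "Wh_map A A'' (compose (carrier A) g f) =
      compose (carrier (Wh_ob A)) (Wh_map A' A'' g) (Wh_map A A' f)"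
    using lie_hom_Wh[OF f] by (auto simp: Wh_map_def compose_def Wh_def)
qed

locale H1_mod =
  fixes V :: "(Qelem \<Rightarrow> Qelem, 'v) Module.module"
  assumes left_module: "left_module H1 V"
begin

lemmas modD = left_moduleD[OF left_module]

sublocale V: abelian_group V by (rule modD(2))

sublocale T: lie_tensor_setup S2bar H1 Q1 Q1_right V
proof (intro lie_tensor_setup.intro lie_bimodule.intro lie_mod.intro lie_bimodule_axioms.intro
      lie_tensor_setup_axioms.intro)
  show "is_lie_module S2bar Q1" by (rule Q1_is_lie_module)
  show "abelian_group V" by (rule modD(2))
  show "r \<odot>\<^bsub>V\<^esub> y \<in> carrier V" if "r \<in> carrier H1" "y \<in> carrier V" for r y
    by (rule modD(3)[OF that])
qed (simp_all add: lie_homD S2bar_add S2bar_vscale S2bar_vbracket)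

abbreviation T :: "(Qelem \<times> 'v \<Rightarrow>\<^sub>0 int) set lie_module" where "T \<equiv> QH_ob V"
abbreviation tens (infixl \<open>\<^bold>\<otimes>\<close> 72) where "q \<^bold>\<otimes> v \<equiv> pure_tensor H1 Q1_right V q v"
abbreviation \<eta> where "\<eta> v \<equiv> \<^bold>1\<^sub>Q \<^bold>\<otimes> v"

lemma T_is_lie_module: "is_lie_module S2bar T"
  unfolding QH_ob_def by (rule T.lie_tensor_is_lie_module)

sublocale Tm: S2bar_mod T
  by unfold_locales (rule T_is_lie_module)

lemmas T_induct [consumes 1, case_names tens add] = T.Q_induct[folded QH_ob_def]
lemmas tens_closed = T.tens_closed[folded QH_ob_def]
  and tens_add_left = T.tens_add_left[folded QH_ob_def]
  and tens_add_right = T.tens_add_right[folded QH_ob_def]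

lemma tens_balanced: "\<theta> \<in> lie_hom S2bar Q1 Q1 \<Longrightarrow> q \<in> carrier Q1 \<Longrightarrow> v \<in> carrier V \<Longrightarrow>
    \<theta> q \<^bold>\<otimes> v = q \<^bold>\<otimes> (\<theta> \<odot>\<^bsub>V\<^esub> v)"
  using T.tens_balanced[of \<theta> q v] by simp

lemma act_tens: "x \<in> S2bar \<Longrightarrow> q \<in> carrier Q1 \<Longrightarrow> v \<in> carrier V \<Longrightarrow>
    act T x (q \<^bold>\<otimes> v) = act Q1 x q \<^bold>\<otimes> v"
  unfolding QH_ob_def by (subst T.act_tens) simp_all

lemma scale_tens: "q \<in> carrier Q1 \<Longrightarrow> v \<in> carrier V \<Longrightarrow> c \<odot>\<^bsub>T\<^esub> (q \<^bold>\<otimes> v) = (c \<odot>\<^bsub>Q1\<^esub> q) \<^bold>\<otimes> v"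
  unfolding QH_ob_def by (subst T.scale_tens) simp_all

lemma zero_tens: "v \<in> carrier V \<Longrightarrow> \<zero>\<^bsub>Q1\<^esub> \<^bold>\<otimes> v = \<zero>\<^bsub>T\<^esub>"
  using scale_tens[of "\<zero>\<^bsub>Q1\<^esub>" v 0] tens_closed[of "\<zero>\<^bsub>Q1\<^esub>" v] by simp

lemma shifted_tens: "x \<in> S2bar \<Longrightarrow> q \<in> carrier Q1 \<Longrightarrow> v \<in> carrier V \<Longrightarrow>
    shifted T x (q \<^bold>\<otimes> v) = shifted Q1 x q \<^bold>\<otimes> v"
  using tens_closed[of q v] tens_closed[of "act Q1 x q" v]
  by (simp add: shifted_def Tm.minus_scale Qm.minus_scale act_tens scale_tens tens_add_left)

lemma shifted_pow_tens: "x \<in> S2bar \<Longrightarrow> q \<in> carrier Q1 \<Longrightarrow> v \<in> carrier V \<Longrightarrow>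
    (shifted T x ^^ n) (q \<^bold>\<otimes> v) = (shifted Q1 x ^^ n) q \<^bold>\<otimes> v"
  by (induction n) (simp_all add: shifted_tens)

sublocale Tw: whittaker_mod T
proof
  have "nilpotent_at T e t" if e: "e = partial1 \<or> e = partial2" and t: "t \<in> carrier T" for e t
    using t
  proof (induction t rule: T_induct)
    case (tens q v)
    obtain k where "(shifted Q1 e ^^ k) q = \<zero>\<^bsub>Q1\<^esub>"
      using Qw.nilpotent[OF tens(1)] e unfolding nilpotent_at_def by blast
    then have "(shifted T e ^^ k) (q \<^bold>\<otimes> v) = \<zero>\<^bsub>T\<^esub>"
      using tens e shifted_pow_tens[of e q v k] zero_tens by auto
    then show ?case unfolding nilpotent_at_def ..
  next
    case (add s t)
    then show ?case using e by (intro Tm.nilpotent_at_add) auto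
  qed
  then show "t \<in> carrier T \<Longrightarrow> nilpotent_at T partial1 t" "t \<in> carrier T \<Longrightarrow> nilpotent_at T partial2 t" for t
    by simp_all
qed

lemma \<eta>_Wh: "v \<in> carrier V \<Longrightarrow> \<eta> v \<in> Wh T"
  using generator_Wh tens_closed[of "\<^bold>1\<^sub>Q" v] by (simp add: Wh_def act_tens)

lemma whittaker_hom_\<eta>:
  assumes v: "v \<in> carrier V" and q: "q \<in> carrier Q1"
  shows "whittaker_hom T (\<eta> v) q = q \<^bold>\<otimes> v"
proof -
  have "(\<lambda>q\<in>carrier Q1. q \<^bold>\<otimes> v) \<in> lie_hom S2bar Q1 T"
    by (rule lie_homI) (use v in \<open>simp_all add: tens_closed tens_add_left scale_tens act_tens\<close>)
  from whittaker_hom_eqI[OF Tm.lie_mod_axioms this] show ?thesis using q by simp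
qed

text \<open>Decompose \<open>q\<close> in \<open>q \<otimes> v\<close>: its Whittaker part is \<open>\<theta>(1 \<otimes> v\<^sub>1)\<close> for some \<open>\<theta>\<close> in \<open>H\<^sub>1\<close>, and \<open>\<theta>\<close> moves to \<open>v\<close>.\<close>

lemma T_decomp:
  assumes "t \<in> carrier T"
  shows "\<exists>v\<in>carrier V. \<exists>x\<in>carrier T. \<exists>y\<in>carrier T. t = \<eta> v \<oplus>\<^bsub>T\<^esub> (act T d1 x \<oplus>\<^bsub>T\<^esub> act T d2 y)"
  using assms
proof (induction t rule: T_induct)
  case (tens q v)
  obtain p p' where p: "proj Q1 q \<in> Wh Q1" "p \<in> carrier Q1" "p' \<in> carrier Q1"
    "q = proj Q1 q \<oplus>\<^bsub>Q1\<^esub> (act Q1 d1 p \<oplus>\<^bsub>Q1\<^esub> act Q1 d2 p')" using Qw.proj_decomp[OF tens(1)] .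
  define \<theta> where "\<theta> = whittaker_hom Q1 (proj Q1 q)"
  have \<theta>: "\<theta> \<in> lie_hom S2bar Q1 Q1" "\<theta> \<^bold>1\<^sub>Q = proj Q1 q"
    using whittaker_hom[OF Qm.lie_mod_axioms p(1)] by (simp_all add: \<theta>_def)
  have \<theta>v: "\<theta> \<odot>\<^bsub>V\<^esub> v \<in> carrier V" using modD(3)[of \<theta> v] \<theta>(1) tens(2) by simp
  have "q \<^bold>\<otimes> v = (proj Q1 q \<oplus>\<^bsub>Q1\<^esub> (act Q1 d1 p \<oplus>\<^bsub>Q1\<^esub> act Q1 d2 p')) \<^bold>\<otimes> v"
    using p(4) by (rule arg_cong)
  also have "\<dots> = proj Q1 q \<^bold>\<otimes> v \<oplus>\<^bsub>T\<^esub> (act T d1 (p \<^bold>\<otimes> v) \<oplus>\<^bsub>T\<^esub> act T d2 (p' \<^bold>\<otimes> v))"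
    using p(2,3) Qm.Wh_carrier[OF p(1)] tens(2) by (simp add: tens_add_left act_tens)
  also have "proj Q1 q \<^bold>\<otimes> v = \<eta> (\<theta> \<odot>\<^bsub>V\<^esub> v)"
    unfolding \<theta>(2)[symmetric] by (rule tens_balanced[OF \<theta>(1) generator_closed tens(2)])
  finally show ?case
    using \<theta>v p(2,3) tens(2) tens_closed by blast
next
  case (add s t)
  then obtain v x y v' x' y' where *: "v \<in> carrier V" "x \<in> carrier T" "y \<in> carrier T"
    "s = \<eta> v \<oplus>\<^bsub>T\<^esub> (act T d1 x \<oplus>\<^bsub>T\<^esub> act T d2 y)" "v' \<in> carrier V" "x' \<in> carrier T" "y' \<in> carrier T"
    "t = \<eta> v' \<oplus>\<^bsub>T\<^esub> (act T d1 x' \<oplus>\<^bsub>T\<^esub> act T d2 y')" by blast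
  have c: "\<eta> v \<in> carrier T" "\<eta> v' \<in> carrier T"
    using *(1,5) tens_closed by simp_all
  have "s \<oplus>\<^bsub>T\<^esub> t = (\<eta> v \<oplus>\<^bsub>T\<^esub> \<eta> v') \<oplus>\<^bsub>T\<^esub> (act T d1 (x \<oplus>\<^bsub>T\<^esub> x') \<oplus>\<^bsub>T\<^esub> act T d2 (y \<oplus>\<^bsub>T\<^esub> y'))"
    unfolding *(4,8) using *(2,3,6,7) c by (simp add: Tm.act_add Tm.M.a_ac)
  also have "\<eta> v \<oplus>\<^bsub>T\<^esub> \<eta> v' = \<eta> (v \<oplus>\<^bsub>V\<^esub> v')"
    by (rule tens_add_right[OF generator_closed *(1,5), symmetric])
  finally have eq: "s \<oplus>\<^bsub>T\<^esub> t = \<eta> (v \<oplus>\<^bsub>V\<^esub> v') \<oplus>\<^bsub>T\<^esub> (act T d1 (x \<oplus>\<^bsub>T\<^esub> x') \<oplus>\<^bsub>T\<^esub> act T d2 (y \<oplus>\<^bsub>T\<^esub> y'))" .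
  show ?case
    by (rule bexI[of _ "v \<oplus>\<^bsub>V\<^esub> v'"], rule bexI[of _ "x \<oplus>\<^bsub>T\<^esub> x'"], rule bexI[of _ "y \<oplus>\<^bsub>T\<^esub> y'"], rule eq)
      (use *(1-3,5-7) in simp_all)
qed

lemma \<eta>_surj:
  assumes "t \<in> Wh T"
  shows "\<exists>v\<in>carrier V. t = \<eta> v"
proof -
  obtain v x y where *: "v \<in> carrier V" "x \<in> carrier T" "y \<in> carrier T"
    "t = \<eta> v \<oplus>\<^bsub>T\<^esub> (act T d1 x \<oplus>\<^bsub>T\<^esub> act T d2 y)"
    using T_decomp[OF Tm.Wh_carrier[OF assms]] by blast
  have "proj T t = \<eta> v" by (rule Tw.proj_eqI[OF \<eta>_Wh[OF *(1)] *(2,3,4)])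
  then show ?thesis using Tw.proj_Wh[OF assms] *(1) by auto
qed

text \<open>Let \<open>c(q)\<close> be the endomorphism that maps the generator to the projection of \<open>q\<close>; it is the
  coefficient of \<open>q\<close> at the basis element \<open>1 \<otimes> v\<^sub>1\<close>. It is right \<open>H\<^sub>1\<close>-linear by naturality of the
  projection, so \<open>q \<otimes> v \<mapsto> c(q) v\<close> is well defined, and it is a left inverse of \<open>\<eta>\<close>.\<close>

lemma \<eta>_inj: "inj_on \<eta> (carrier V)"
proof -
  define c where "c q = whittaker_hom Q1 (proj Q1 q)" for q
  have pW: "proj Q1 q \<in> Wh Q1" if "q \<in> carrier Q1" for q
    using Qw.proj_decomp[OF that] by metis
  have c: "c q \<in> carrier H1" if "q \<in> carrier Q1" for q
    unfolding c_def using whittaker_hom_lie_hom[OF Qm.lie_mod_axioms pW[OF that]] by simp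
  have cadd: "c (q \<oplus>\<^bsub>Q1\<^esub> q') = c q \<oplus>\<^bsub>H1\<^esub> c q'" if q: "q \<in> carrier Q1" "q' \<in> carrier Q1" for q q'
  proof -
    have s: "c q \<oplus>\<^bsub>H1\<^esub> c q' \<in> lie_hom S2bar Q1 Q1"
      using c[OF q(1)] c[OF q(2)] Qm.lie_hom_add by simp
    show ?thesis
      unfolding c_def[of "q \<oplus>\<^bsub>Q1\<^esub> q'"] Qw.proj_add[OF q]
      by (rule whittaker_hom_eqI[OF Qm.lie_mod_axioms s])
        (simp add: c_def whittaker_hom_generator[OF Qm.lie_mod_axioms pW] q)
  qed
  have cbal: "c (\<theta> q) = c q \<otimes>\<^bsub>H1\<^esub> \<theta>" if \<theta>: "\<theta> \<in> lie_hom S2bar Q1 Q1" and q: "q \<in> carrier Q1" for \<theta> q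
    unfolding c_def lie_hom_proj[OF Qw.whittaker_mod_axioms Qw.whittaker_mod_axioms \<theta> q, symmetric]
    using whittaker_hom_comp[OF Qm.lie_mod_axioms Qm.lie_mod_axioms \<theta> pW[OF q]] by simp
  obtain h where h: "h \<in> hom (tensor_group H1 Q1_right V) (add_monoid V)"
    "\<And>q v. q \<in> carrier Q1_right \<Longrightarrow> v \<in> carrier V \<Longrightarrow> h (q \<^bold>\<otimes> v) = c q \<odot>\<^bsub>V\<^esub> v"
  proof (rule T.tf.tensor_universal[of "add_monoid V" "\<lambda>q v. c q \<odot>\<^bsub>V\<^esub> v"])
    show "comm_group (add_monoid V)" by (rule V.a_comm_group)
    fix q v assume q: "q \<in> carrier Q1_right" and v: "v \<in> carrier V"
    then have q': "q \<in> carrier Q1" by simp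
    show "c q \<odot>\<^bsub>V\<^esub> v \<in> carrier (add_monoid V)" using modD(3)[OF c[OF q'] v] by simp
    show "c (r \<odot>\<^bsub>Q1_right\<^esub> q) \<odot>\<^bsub>V\<^esub> v = c q \<odot>\<^bsub>V\<^esub> (r \<odot>\<^bsub>V\<^esub> v)" if r: "r \<in> carrier H1" for r
      using modD(6)[OF c[OF q'] r v] cbal[of r q] r q' by simp
    show "c q \<odot>\<^bsub>V\<^esub> (v \<oplus>\<^bsub>V\<^esub> v') = (c q \<odot>\<^bsub>V\<^esub> v) \<otimes>\<^bsub>add_monoid V\<^esub> (c q \<odot>\<^bsub>V\<^esub> v')" if "v' \<in> carrier V" for v'
      using modD(4)[OF c[OF q'] v that] by simp
    show "c (q \<oplus>\<^bsub>Q1_right\<^esub> q'') \<odot>\<^bsub>V\<^esub> v = (c q \<odot>\<^bsub>V\<^esub> v) \<otimes>\<^bsub>add_monoid V\<^esub> (c q'' \<odot>\<^bsub>V\<^esub> v)"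
      if "q'' \<in> carrier Q1_right" for q''
      using modD(5)[OF c[OF q'] c[of q''] v] cadd[OF q', of q''] that by simp
  qed (rule that; simp)
  have "c \<^bold>1\<^sub>Q = \<one>\<^bsub>H1\<^esub>"
    unfolding c_def Qw.proj_Wh[OF generator_Wh]
    by (rule whittaker_hom_eqI[OF Qm.lie_mod_axioms]) (simp_all add: Qm.lie_hom_id)
  then have "h (\<eta> v) = v" if "v \<in> carrier V" for v
    using h(2)[of "\<^bold>1\<^sub>Q" v] modD(7)[OF that] that by simp
  then show ?thesis by (rule inj_on_inverseI)
qed

lemma \<eta>_mod_hom: "(\<lambda>v\<in>carrier V. \<eta> v) \<in> mod_hom H1 V (Wh_ob T)"
proof (rule mod_homI)
  fix \<theta> v assume *: "\<theta> \<in> carrier H1" "v \<in> carrier V"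
  then have t: "\<theta> \<in> lie_hom S2bar Q1 Q1" by simp
  show "(\<lambda>v\<in>carrier V. \<eta> v) (\<theta> \<odot>\<^bsub>V\<^esub> v) = \<theta> \<odot>\<^bsub>Wh_ob T\<^esub> (\<lambda>v\<in>carrier V. \<eta> v) v"
    using * modD(3)[OF *] tens_balanced[OF t generator_closed *(2)]
      whittaker_hom_\<eta>[OF *(2) lie_homD(2)[OF t generator_closed]] by simp
qed (simp_all add: \<eta>_Wh tens_add_right)

lemma \<eta>_mod_iso: "(\<lambda>v\<in>carrier V. \<eta> v) \<in> mod_iso H1 V (Wh_ob T)"
proof (rule mod_iso_of_bij[OF left_module \<eta>_mod_hom])
  have "inj_on (\<lambda>v\<in>carrier V. \<eta> v) (carrier V)"
    using \<eta>_inj by (simp add: inj_on_def)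
  moreover have "(\<lambda>v\<in>carrier V. \<eta> v) ` carrier V = Wh T"
    using \<eta>_surj \<eta>_Wh by auto
  ultimately show "bij_betw (\<lambda>v\<in>carrier V. \<eta> v) (carrier V) (carrier (Wh_ob T))"
    by (simp add: bij_betw_def)
qed

text \<open>The finite-dimensional space \<open>V\<close> maps onto the Whittaker vectors by \<open>\<eta>\<close>.\<close>

lemma QH_ob_Omega:
  assumes fd: "fin_dim (H1_vector_space V)"
  shows "T \<in> Ob Omega"
proof -
  have V: "complex_space (H1_vector_space V)"
    using fd by (simp add: fin_dim_def complex_space_def)
  have W: "complex_space (sub_vs T (Wh T))"
    by (rule sub_vs_complex_space[OF Tm.complex_space_axioms Tm.Wh_subspace])
  have "fin_dim (sub_vs T (Wh T))"
  proof (rule fin_dim_surjective_image[OF V W fd, of \<eta>])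
    show "\<eta> (c \<odot>\<^bsub>H1_vector_space V\<^esub> v) = c \<odot>\<^bsub>sub_vs T (Wh T)\<^esub> \<eta> v"
      if "v \<in> carrier (H1_vector_space V)" for c v
      using that tens_balanced[OF H1_const(1) generator_closed, of v c, symmetric]
      by (simp add: H1_const(2) scale_tens)
  qed (use \<eta>_Wh \<eta>_surj in \<open>auto simp: tens_add_right\<close>)
  then show ?thesis using Tw.whittaker_mod_axioms by (simp add: Omega_iff)
qed

end

section \<open>Functoriality, the counit, and the equivalence\<close>

lemma H1_fmod_iff: "V \<in> Ob H1_fmod \<longleftrightarrow> H1_mod V \<and> fin_dim (H1_vector_space V)"
  by (simp add: H1_fmod_def H1_mod_def)

lemma Omega_lie_mod: "M \<in> Ob Omega \<Longrightarrow> lie_mod S2bar M"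
  by (simp add: Omega_iff whittaker_mod_def S2bar_mod_def)

lemma (in H1_mod) additive_T_eqI:
  assumes "f \<in> extensional (carrier T)" "g \<in> extensional (carrier T)"
    and "\<And>s t. s \<in> carrier T \<Longrightarrow> t \<in> carrier T \<Longrightarrow> f (s \<oplus>\<^bsub>T\<^esub> t) = add N (f s) (f t)"
    and "\<And>s t. s \<in> carrier T \<Longrightarrow> t \<in> carrier T \<Longrightarrow> g (s \<oplus>\<^bsub>T\<^esub> t) = add N (g s) (g t)"
    and eq: "\<And>q v. q \<in> carrier Q1 \<Longrightarrow> v \<in> carrier V \<Longrightarrow> f (q \<^bold>\<otimes> v) = g (q \<^bold>\<otimes> v)"
  shows "f = g"
proof (rule extensionalityI[OF assms(1,2)])
  fix t assume "t \<in> carrier T"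
  then show "f t = g t"
    by (induction t rule: T_induct) (simp_all add: assms)
qed

lemma QH_map:
  assumes V: "H1_mod V" and W: "H1_mod W" and f: "f \<in> mod_hom H1 V W"
  shows QH_map_lie_hom: "QH_map V W f \<in> lie_hom S2bar (QH_ob V) (QH_ob W)"
    and QH_map_tens: "q \<in> carrier Q1 \<Longrightarrow> v \<in> carrier V \<Longrightarrow>
      QH_map V W f (pure_tensor H1 Q1_right V q v) = pure_tensor H1 Q1_right W q (f v)"
proof -
  interpret V: H1_mod V by fact
  interpret W: H1_mod W by fact
  let ?f = "QH_map V W f"
  note * = tensor_map_pure_hom[OF V.T.tf.tensor_factors_axioms W.T.tf.tensor_factors_axioms,
      of "\<lambda>q. q" f, folded QH_map_def]
  have hom: "?f \<in> hom (tensor_group H1 Q1_right V) (tensor_group H1 Q1_right W)"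
    by (rule *(1)) (simp_all add: mod_homD[OF f])
  have pure: "?f (pure_tensor H1 Q1_right V q v) = pure_tensor H1 Q1_right W q (f v)"
    if "q \<in> carrier Q1" "v \<in> carrier V" for q v
    by (rule *(2)) (simp_all add: mod_homD[OF f] that)
  then show "q \<in> carrier Q1 \<Longrightarrow> v \<in> carrier V \<Longrightarrow>
      ?f (pure_tensor H1 Q1_right V q v) = pure_tensor H1 Q1_right W q (f v)" by simp
  have closed: "?f t \<in> carrier W.T" if "t \<in> carrier V.T" for t
    using hom_in_carrier[OF hom, of t] that by (simp add: QH_ob_def lie_tensor_simps)
  have add: "?f (s \<oplus>\<^bsub>V.T\<^esub> t) = ?f s \<oplus>\<^bsub>W.T\<^esub> ?f t" if "s \<in> carrier V.T" "t \<in> carrier V.T" for s t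
    using hom_mult[OF hom, of s t] that by (simp add: QH_ob_def lie_tensor_simps)
  show "?f \<in> lie_hom S2bar V.T W.T"
  proof (rule lie_homI)
    show "?f \<in> extensional (carrier V.T)"
      by (simp add: QH_map_def tensor_map_def QH_ob_def lie_tensor_simps)
    show "?f (c \<odot>\<^bsub>V.T\<^esub> t) = c \<odot>\<^bsub>W.T\<^esub> ?f t" if "t \<in> carrier V.T" for c t
      using that
      by (induction t rule: V.T_induct)
        (simp_all add: V.scale_tens W.scale_tens pure mod_homD(2)[OF f] V.Tm.scale_add_right
          W.Tm.scale_add_right add closed)
    show "?f (act V.T x t) = act W.T x (?f t)" if x: "x \<in> S2bar" and "t \<in> carrier V.T" for x t
      using that(2)
      by (induction t rule: V.T_induct)
        (simp_all add: x V.act_tens W.act_tens pure mod_homD(2)[OF f] V.Tm.act_add W.Tm.act_add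
          add closed)
  qed (simp_all add: closed add)
qed

lemma QH_functor: "is_functor H1_fmod Omega QH_ob QH_map"
  unfolding is_functor_def concrete_category_simps
proof (intro conjI ballI)
  fix A :: "(Qelem \<Rightarrow> Qelem, 'v) Module.module" assume A: "A \<in> Ob H1_fmod"
  then interpret A: H1_mod A by (simp add: H1_fmod_iff)
  show "QH_ob A \<in> Ob Omega" by (rule A.QH_ob_Omega) (use A in \<open>simp add: H1_fmod_iff\<close>)
  have id: "(\<lambda>v\<in>carrier A. v) \<in> mod_hom H1 A A"
    by (rule mod_homI) (simp_all add: A.modD(3))
  note h = QH_map[OF A.H1_mod_axioms A.H1_mod_axioms id]
  show "QH_map A A (\<lambda>v\<in>carrier A. v) = (\<lambda>t\<in>carrier (QH_ob A). t)"
    by (rule A.additive_T_eqI[where N = A.T, OF lie_homD(1)[OF h(1)]])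
      (simp_all add: lie_homD(3)[OF h(1)] h(2) A.tens_closed)
next
  fix A B :: "(Qelem \<Rightarrow> Qelem, 'v) Module.module" and f
  assume "A \<in> Ob H1_fmod" "B \<in> Ob H1_fmod" "f \<in> mod_hom H1 A B"
  then show "QH_map A B f \<in> lie_hom S2bar (QH_ob A) (QH_ob B)"
    by (intro QH_map_lie_hom) (simp_all add: H1_fmod_iff)
next
  fix A A' A'' :: "(Qelem \<Rightarrow> Qelem, 'v) Module.module" and f g
  assume A: "A \<in> Ob H1_fmod" "A' \<in> Ob H1_fmod" "A'' \<in> Ob H1_fmod"
    and f: "f \<in> mod_hom H1 A A'" and g: "g \<in> mod_hom H1 A' A''"
  interpret A: H1_mod A using A by (simp add: H1_fmod_iff)
  interpret A': H1_mod A' using A by (simp add: H1_fmod_iff)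
  interpret A'': H1_mod A'' using A by (simp add: H1_fmod_iff)
  have gf: "compose (carrier A) g f \<in> mod_hom H1 A A''"
    by (rule mod_homI) (simp_all add: compose_def mod_homD[OF f] mod_homD[OF g] A.modD(3))
  note h = QH_map[OF A.H1_mod_axioms A'.H1_mod_axioms f] and k = QH_map[OF A'.H1_mod_axioms A''.H1_mod_axioms g]
    and l = QH_map[OF A.H1_mod_axioms A''.H1_mod_axioms gf]
  note kh = lie_hom_compose[OF h(1) k(1) A.T_is_lie_module]
  show "QH_map A A'' (compose (carrier A) g f) = compose (carrier (QH_ob A)) (QH_map A' A'' g) (QH_map A A' f)"
    by (rule A.additive_T_eqI[where N = A''.T, OF lie_homD(1)[OF l(1)] lie_homD(1)[OF kh]])
      (simp_all add: lie_homD(3)[OF l(1)] lie_homD(2,3)[OF h(1)] lie_homD(3)[OF k(1)] h(2) k(2) l(2)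
        A.tens_closed mod_homD(2)[OF f] compose_eq)
qed

text \<open>Evaluation \<open>q \<otimes> w \<mapsto> \<psi>\<^sub>w(q)\<close>, where \<open>\<psi>\<^sub>w\<close> is the homomorphism with value \<open>w\<close> at the generator. It is
  balanced because \<open>\<theta>\<close> acts on \<open>w\<close> as precomposition acts on \<open>\<psi>\<^sub>w\<close>.\<close>

lemma counit_exists:
  assumes M: "lie_mod S2bar M"
  shows "\<exists>h\<in>lie_hom S2bar (QH_ob (Wh_ob M)) M. \<forall>q\<in>carrier Q1. \<forall>w\<in>Wh M.
    h (pure_tensor H1 Q1_right (Wh_ob M) q w) = whittaker_hom M w q"
proof -
  interpret M: lie_mod S2bar M by fact
  interpret W: H1_mod "Wh_ob M" by unfold_locales (rule Wh_ob_left_module[OF M])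
  note hD = lie_homD[OF whittaker_hom_lie_hom[OF M]]
  obtain h where h: "h \<in> hom (tensor_group H1 Q1_right (Wh_ob M)) (add_monoid M)"
    "\<And>q w. q \<in> carrier Q1_right \<Longrightarrow> w \<in> carrier (Wh_ob M) \<Longrightarrow>
      h (pure_tensor H1 Q1_right (Wh_ob M) q w) = whittaker_hom M w q"
  proof (rule W.T.tf.tensor_universal[of "add_monoid M" "\<lambda>q w. whittaker_hom M w q"])
    show "comm_group (add_monoid M)" by (rule M.M.a_comm_group)
    fix q w assume q: "q \<in> carrier Q1_right" and w: "w \<in> carrier (Wh_ob M)"
    show "whittaker_hom M w q \<in> carrier (add_monoid M)" using q w hD(2) by simp
    show "whittaker_hom M w (q \<oplus>\<^bsub>Q1_right\<^esub> q') = whittaker_hom M w q \<otimes>\<^bsub>add_monoid M\<^esub> whittaker_hom M w q'"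
      if "q' \<in> carrier Q1_right" for q' using q w that hD(3) by simp
    show "whittaker_hom M (w \<oplus>\<^bsub>Wh_ob M\<^esub> w') q = whittaker_hom M w q \<otimes>\<^bsub>add_monoid M\<^esub> whittaker_hom M w' q"
      if "w' \<in> carrier (Wh_ob M)" for w' using q w that whittaker_hom_add[OF M] by simp
    show "whittaker_hom M w (r \<odot>\<^bsub>Q1_right\<^esub> q) = whittaker_hom M (r \<odot>\<^bsub>Wh_ob M\<^esub> w) q"
      if "r \<in> carrier H1" for r
      using q w that whittaker_hom_smult[OF M, of r w] by (simp add: compose_eq)
  qed (rule that; simp)
  have closed: "h t \<in> carrier M" if "t \<in> carrier W.T" for t
    using hom_in_carrier[OF h(1), of t] that by (simp add: QH_ob_def lie_tensor_simps)
  have add: "h (s \<oplus>\<^bsub>W.T\<^esub> t) = h s \<oplus>\<^bsub>M\<^esub> h t" if "s \<in> carrier W.T" "t \<in> carrier W.T" for s t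
    using hom_mult[OF h(1), of s t] that by (simp add: QH_ob_def lie_tensor_simps)
  have pure: "h (pure_tensor H1 Q1_right (Wh_ob M) q w) = whittaker_hom M w q"
    if "q \<in> carrier Q1" "w \<in> Wh M" for q w using h(2)[of q w] that by simp
  have scale: "h (c \<odot>\<^bsub>W.T\<^esub> t) = c \<odot>\<^bsub>M\<^esub> h t" if "t \<in> carrier W.T" for c t
    using that
    by (induction t rule: W.T_induct)
      (simp_all add: W.scale_tens pure hD W.Tm.scale_add_right M.scale_add_right add closed)
  have act: "h (act W.T x t) = act M x (h t)" if x: "x \<in> S2bar" and "t \<in> carrier W.T" for x t
    using that(2)
    by (induction t rule: W.T_induct)
      (simp_all add: x W.act_tens pure hD W.Tm.act_add M.act_add add closed)
  have "restrict h (carrier W.T) \<in> lie_hom S2bar W.T M"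
    by (rule lie_homI) (simp_all add: closed add scale act)
  moreover have "restrict h (carrier W.T) (pure_tensor H1 Q1_right (Wh_ob M) q w) = whittaker_hom M w q"
    if "q \<in> carrier Q1" "w \<in> Wh M" for q w
    using that W.tens_closed[of q w] by (simp add: pure)
  ultimately show ?thesis by blast
qed

definition counit :: "'m lie_module \<Rightarrow> (Qelem \<times> 'm \<Rightarrow>\<^sub>0 int) set \<Rightarrow> 'm" where
  "counit M = (SOME h. h \<in> lie_hom S2bar (QH_ob (Wh_ob M)) M \<and> (\<forall>q\<in>carrier Q1. \<forall>w\<in>Wh M.
     h (pure_tensor H1 Q1_right (Wh_ob M) q w) = whittaker_hom M w q))"

lemma counit:
  assumes M: "lie_mod S2bar M"
  shows counit_lie_hom: "counit M \<in> lie_hom S2bar (QH_ob (Wh_ob M)) M"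
    and counit_tens: "q \<in> carrier Q1 \<Longrightarrow> w \<in> Wh M \<Longrightarrow>
      counit M (pure_tensor H1 Q1_right (Wh_ob M) q w) = whittaker_hom M w q"
proof -
  have "counit M \<in> lie_hom S2bar (QH_ob (Wh_ob M)) M \<and> (\<forall>q\<in>carrier Q1. \<forall>w\<in>Wh M.
      counit M (pure_tensor H1 Q1_right (Wh_ob M) q w) = whittaker_hom M w q)"
    unfolding counit_def by (rule someI_ex[OF counit_exists[OF M, unfolded Bex_def]])
  then show "counit M \<in> lie_hom S2bar (QH_ob (Wh_ob M)) M"
    "q \<in> carrier Q1 \<Longrightarrow> w \<in> Wh M \<Longrightarrow>
      counit M (pure_tensor H1 Q1_right (Wh_ob M) q w) = whittaker_hom M w q" by simp_all
qed

text \<open>The Whittaker vectors of \<open>Q\<^sub>1 \<otimes> Wh M\<close> are the \<open>\<eta> w\<close>, and evaluation maps \<open>\<eta> w\<close> to \<open>w\<close>, so it is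
  injective on them and hence everywhere. Its image contains all \<open>d\<^sub>1\<^sup>a d\<^sub>2\<^sup>b w\<close>, which span \<open>M\<close>.\<close>

lemma counit_iso:
  assumes "whittaker_mod M"
  shows "counit M \<in> lie_iso S2bar (QH_ob (Wh_ob M)) M"
proof -
  interpret whittaker_mod M by fact
  interpret W: H1_mod "Wh_ob M" by unfold_locales (rule Wh_ob_left_module[OF lie_mod_axioms])
  note h = counit[OF lie_mod_axioms]
  have unit: "counit M (W.\<eta> w) = w" if "w \<in> Wh M" for w
    using h(2)[OF generator_closed that] whittaker_hom_generator[OF lie_mod_axioms that] by simp
  have "inj_on (counit M) (carrier W.T)"
  proof (rule lie_hom_injective_of_Wh[OF W.Tw.whittaker_mod_axioms whittaker_mod_axioms h(1)])
    fix t assume t: "t \<in> Wh W.T" "counit M t = \<zero>\<^bsub>M\<^esub>"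
    obtain w where w: "w \<in> Wh M" "t = W.\<eta> w" using W.\<eta>_surj[OF t(1)] by auto
    then have "w = \<zero>\<^bsub>M\<^esub>" using t(2) unit by simp
    then have "t = W.\<eta> \<zero>\<^bsub>Wh_ob M\<^esub>" using w(2) by simp
    moreover have "W.\<eta> \<zero>\<^bsub>Wh_ob M\<^esub> \<oplus>\<^bsub>W.T\<^esub> W.\<eta> \<zero>\<^bsub>Wh_ob M\<^esub> = W.\<eta> \<zero>\<^bsub>Wh_ob M\<^esub>"
      using W.tens_add_right[OF generator_closed W.V.zero_closed W.V.zero_closed, symmetric]
        W.V.l_zero[OF W.V.zero_closed] by simp
    ultimately have "t \<oplus>\<^bsub>W.T\<^esub> t = t" by simp
    moreover have "t \<in> carrier W.T" by (rule W.Tm.Wh_carrier[OF t(1)])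
    ultimately show "t = \<zero>\<^bsub>W.T\<^esub>"
      using W.Tm.minus_eq_zero_iff[of t t] W.Tm.add_minus_cancel[of t t] by simp
  qed
  moreover have "v \<in> counit M ` carrier W.T" if "v \<in> carrier M" for v
    using that
  proof (induction v rule: whittaker_induct)
    case (gen a b w)
    have \<eta>: "W.\<eta> w \<in> carrier W.T" using W.tens_closed[of "\<^bold>1\<^sub>Q" w] gen by simp
    have 2: "counit M ((act W.T d2 ^^ b) (W.\<eta> w)) = (act M d2 ^^ b) w \<and> (act W.T d2 ^^ b) (W.\<eta> w) \<in> carrier W.T"
      using lie_hom_act_pow[OF W.Tm.lie_mod_axioms h(1) vfields_in_S2bar(4) \<eta>, of b] unit[OF gen] by simp
    then have "counit M ((act W.T d1 ^^ a) ((act W.T d2 ^^ b) (W.\<eta> w))) = (act M d1 ^^ a) ((act M d2 ^^ b) w) \<and>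
        (act W.T d1 ^^ a) ((act W.T d2 ^^ b) (W.\<eta> w)) \<in> carrier W.T"
      using lie_hom_act_pow[OF W.Tm.lie_mod_axioms h(1) vfields_in_S2bar(3), of _ a] by simp
    then show ?case by (metis imageI)
  next
    case (add u v)
    then obtain s t where "s \<in> carrier W.T" "t \<in> carrier W.T" "u = counit M s" "v = counit M t" by blast
    then show ?case
      using lie_homD(3)[OF h(1), of s t] by (intro image_eqI[of _ _ "s \<oplus>\<^bsub>W.T\<^esub> t"]) simp_all
  qed
  ultimately have "bij_betw (counit M) (carrier W.T) (carrier M)"
    using lie_homD(2)[OF h(1)] unfolding bij_betw_def by blast
  then show ?thesis by (rule lie_iso_of_bij[OF W.Tm.lie_mod_axioms h(1)])
qed

lemma counit_natural:
  assumes M: "lie_mod S2bar M" and N: "lie_mod S2bar N" and f: "f \<in> lie_hom S2bar M N"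
  shows "compose (carrier (QH_ob (Wh_ob M))) (counit N) (QH_map (Wh_ob M) (Wh_ob N) (Wh_map M N f)) =
    compose (carrier (QH_ob (Wh_ob M))) f (counit M)"
proof -
  interpret W: H1_mod "Wh_ob M" by unfold_locales (rule Wh_ob_left_module[OF M])
  interpret W': H1_mod "Wh_ob N" by unfold_locales (rule Wh_ob_left_module[OF N])
  note h = QH_map[OF W.H1_mod_axioms W'.H1_mod_axioms Wh_map_hom[OF M N f]]
  note k = lie_hom_compose[OF h(1) counit_lie_hom[OF N] W.T_is_lie_module]
    and l = lie_hom_compose[OF counit_lie_hom[OF M] f W.T_is_lie_module]
  show ?thesis
  proof (rule W.additive_T_eqI[where N = N, OF lie_homD(1)[OF k] lie_homD(1)[OF l] lie_homD(3)[OF k] lie_homD(3)[OF l]])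
    fix q w assume q: "q \<in> carrier Q1" and w: "w \<in> carrier (Wh_ob M)"
    then have w': "w \<in> Wh M" by simp
    have "counit N (pure_tensor H1 Q1_right (Wh_ob N) q (f w)) = f (whittaker_hom M w q)"
      using counit_tens[OF N q lie_hom_Wh[OF f w']] whittaker_hom_comp[OF M N f w'] q
      by (simp add: compose_eq)
    then show "compose (carrier W.T) (counit N) (QH_map (Wh_ob M) (Wh_ob N) (Wh_map M N f))
        (pure_tensor H1 Q1_right (Wh_ob M) q w) =
      compose (carrier W.T) f (counit M) (pure_tensor H1 Q1_right (Wh_ob M) q w)"
      using W.tens_closed[OF q w] h(2)[OF q w] counit_tens[OF M q w'] w'
      by (simp add: compose_eq Wh_map_def)
  qed
qed

definition unit :: "(Qelem \<Rightarrow> Qelem, 'v) Module.module \<Rightarrow> 'v \<Rightarrow> (Qelem \<times> 'v \<Rightarrow>\<^sub>0 int) set" where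
  "unit V = (\<lambda>v\<in>carrier V. pure_tensor H1 Q1_right V \<^bold>1\<^sub>Q v)"

lemma unit_natural:
  assumes V: "H1_mod V" and W: "H1_mod W" and f: "f \<in> mod_hom H1 V W"
  shows "compose (carrier V) (unit W) f =
    compose (carrier V) (Wh_map (QH_ob V) (QH_ob W) (QH_map V W f)) (unit V)"
proof -
  interpret V: H1_mod V by fact
  show ?thesis
    unfolding compose_def
  proof (rule restrict_ext)
    fix v assume v: "v \<in> carrier V"
    then show "unit W (f v) = Wh_map (QH_ob V) (QH_ob W) (QH_map V W f) (unit V v)"
      using QH_map_tens[OF V W f generator_closed v] V.\<eta>_Wh[OF v] mod_homD(2)[OF f v]
      by (simp add: unit_def Wh_map_def)
  qed
qed

theorem theorem5p1:
  shows
    \<comment> \<open>(1)\<close>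
    "right_module H1 Q1_right \<and>
     free_module H1 Q1_right \<and>
     module_basis H1 Q1_right {Q1_tensor (hpow m) | m. True}
   \<and>
     \<comment> \<open>(2)\<close>
     is_functor (Omega :: ('m lie_module, 'm) concrete_category) H1_fmod Wh_ob Wh_map \<and>
     is_functor (H1_fmod :: ((Qelem \<Rightarrow> Qelem, 'v) Module.module, 'v) concrete_category)
       Omega QH_ob QH_map \<and>
     (\<exists>\<epsilon> :: 'm lie_module \<Rightarrow> (Qelem \<times> 'm \<Rightarrow>\<^sub>0 int) set \<Rightarrow> 'm.
        (\<forall>M\<in>Ob Omega. \<epsilon> M \<in> lie_iso S2bar (QH_ob (Wh_ob M)) M) \<and>
        (\<forall>M\<in>Ob Omega. \<forall>N\<in>Ob Omega. \<forall>f\<in>Hom Omega M N.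
           compose (carrier (QH_ob (Wh_ob M))) (\<epsilon> N)
             (QH_map (Wh_ob M) (Wh_ob N) (Wh_map M N f)) =
           compose (carrier (QH_ob (Wh_ob M))) f (\<epsilon> M))) \<and>
     (\<exists>\<eta> :: (Qelem \<Rightarrow> Qelem, 'v) Module.module \<Rightarrow> 'v \<Rightarrow> (Qelem \<times> 'v \<Rightarrow>\<^sub>0 int) set.
        (\<forall>V\<in>Ob H1_fmod. \<eta> V \<in> mod_iso H1 V (Wh_ob (QH_ob V))) \<and>
        (\<forall>V\<in>Ob H1_fmod. \<forall>W\<in>Ob H1_fmod. \<forall>f\<in>Hom H1_fmod V W.
           compose (carrier V) (\<eta> W) f =
           compose (carrier V) (Wh_map (QH_ob V) (QH_ob W) (QH_map V W f)) (\<eta> V)))"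
proof -
  have Q: "free_module H1 Q1_right"
    unfolding free_module_def using Q1_basis by (rule exI)
  have counits: "\<exists>\<epsilon> :: 'm lie_module \<Rightarrow> (Qelem \<times> 'm \<Rightarrow>\<^sub>0 int) set \<Rightarrow> 'm.
      (\<forall>M\<in>Ob Omega. \<epsilon> M \<in> lie_iso S2bar (QH_ob (Wh_ob M)) M) \<and>
      (\<forall>M\<in>Ob Omega. \<forall>N\<in>Ob Omega. \<forall>f\<in>Hom Omega M N.
         compose (carrier (QH_ob (Wh_ob M))) (\<epsilon> N)
           (QH_map (Wh_ob M) (Wh_ob N) (Wh_map M N f)) =
         compose (carrier (QH_ob (Wh_ob M))) f (\<epsilon> M))"
  proof (intro exI[of _ counit] conjI ballI)
    fix M :: "'m lie_module" assume "M \<in> Ob Omega"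
    then show "counit M \<in> lie_iso S2bar (QH_ob (Wh_ob M)) M"
      by (intro counit_iso) (simp add: Omega_iff)
  next
    fix M N :: "'m lie_module" and f
    assume "M \<in> Ob Omega" "N \<in> Ob Omega" "f \<in> Hom Omega M N"
    then show "compose (carrier (QH_ob (Wh_ob M))) (counit N)
        (QH_map (Wh_ob M) (Wh_ob N) (Wh_map M N f)) =
      compose (carrier (QH_ob (Wh_ob M))) f (counit M)"
      by (intro counit_natural Omega_lie_mod) simp_all
  qed
  have units: "\<exists>\<eta> :: (Qelem \<Rightarrow> Qelem, 'v) Module.module \<Rightarrow> 'v \<Rightarrow> (Qelem \<times> 'v \<Rightarrow>\<^sub>0 int) set.
      (\<forall>V\<in>Ob H1_fmod. \<eta> V \<in> mod_iso H1 V (Wh_ob (QH_ob V))) \<and>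
      (\<forall>V\<in>Ob H1_fmod. \<forall>W\<in>Ob H1_fmod. \<forall>f\<in>Hom H1_fmod V W.
         compose (carrier V) (\<eta> W) f =
         compose (carrier V) (Wh_map (QH_ob V) (QH_ob W) (QH_map V W f)) (\<eta> V))"
  proof (intro exI[of _ unit] conjI ballI)
    fix V :: "(Qelem \<Rightarrow> Qelem, 'v) Module.module" assume "V \<in> Ob H1_fmod"
    then interpret H1_mod V by (simp add: H1_fmod_iff)
    show "unit V \<in> mod_iso H1 V (Wh_ob (QH_ob V))"
      unfolding unit_def by (rule \<eta>_mod_iso)
  next
    fix V W :: "(Qelem \<Rightarrow> Qelem, 'v) Module.module" and f
    assume "V \<in> Ob H1_fmod" "W \<in> Ob H1_fmod" "f \<in> Hom H1_fmod V W"
    then show "compose (carrier V) (unit W) f =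
        compose (carrier V) (Wh_map (QH_ob V) (QH_ob W) (QH_map V W f)) (unit V)"
      by (intro unit_natural) (simp_all add: H1_fmod_iff)
  qed
  show ?thesis
    by (intro conjI Q1_right_module Q Q1_basis Wh_functor QH_functor counits units)
qed

end
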